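(* Let $B$ be a building set on $[n]$ such that the nestohedron $P_B$ is flag. Then there is a flag simplicial complex $\Gamma(B)$ such that $f(\Gamma(B))=\gamma(P_B)$. In particular, $\gamma(P_B)$ satisfies the Frankl–Füredi–Kalai inequalities.
   Context: A building set $B$ on a finite set $S$ is a collection of nonempty subsets of $S$ such that (i) if $I,J\in B$ and $I\cap J\neq\emptyset$ then $I\cup J\in B$, and (ii) $\{i\}\in B$ for every $i\in S$. For the standard basis $e_1,\dots,e_n$ of $\mathbb{R}^n$ and $I\subseteq[n]$ let $\Delta_I$ be the convex hull of $\{e_i: i\in I\}$. For a building set $B$ on $[n]$, the nestohedron is the Minkowski sum $P_B=\sum_{I\in B}\Delta_I$; it is a simple polytope. A simple polytope is flag if every collection of pairwise intersecting facets has nonempty intersection. A simplicial complex is flag if every set of pairwise adjacent vertices is a face. For a $(d-1)$-dimensional simplicial complex $\Delta$, $f(\Delta)(t)=\sum_{i=0}^{d} f_i t^i$ where $f_0=1$ and $f_i$ is the number of $(i-1)$-dimensional faces; $h(\Delta)(t)=(t-1)^d f(\Delta)(1/(t-1))$. When $\Delta$ is a homology sphere, $h(\Delta)(t)=\sum_{i=0}^{\lfloor d/2\rfloor}\gamma_i t^i(1+t)^{d-2i}$ for unique integers $\gamma_i$, and $\gamma(\Delta)(t)=\sum_i \gamma_i t^i$. For a simple $(d+1)$-dimensional polytope $P$, let $\Delta_P$ be the boundary complex of its polar dual polytope, and $\gamma(P):=\gamma(\Delta_P)$. The Frankl–Füredi–Kalai inequalities are the numerical conditions (due to Frankl, Füredi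 and Kalai) that characterize the $f$-vectors of balanced simplicial complexes, i.e. $(d-1)$-dimensional complexes whose vertices can be properly colored with $d$ colors; a vector satisfies them if it is the $f$-vector of such a complex. *)

theory Defs
  imports "HOL-Analysis.Analysis" "HOL-Computational_Algebra.Polynomial"
    "HOL-Library.Set_Algebras"
begin

subsection \<open>Building sets and nestohedra\<close>

definition building_set :: "'a set \<Rightarrow> 'a set set \<Rightarrow> bool" where
  "building_set S B \<longleftrightarrow>
     finite S \<and>
     (\<forall>I\<in>B. I \<noteq> {} \<and> I \<subseteq> S) \<and>
     (\<forall>I\<in>B. \<forall>J\<in>B. I \<inter> J \<noteq> {} \<longrightarrow> I \<union> J \<in> B) \<and>
     (\<forall>i\<in>S. {i} \<in> B)"

definition coord_simplex :: "'n::finite set \<Rightarrow> (real ^ 'n) set" where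
  "coord_simplex I = convex hull ((\<lambda>i. axis i 1) ` I)"

text \<open>The sum is the Minkowski sum, i.e. addition of sets from \<^theory>\<open>HOL-Library.Set_Algebras\<close>.\<close>

definition nestohedron :: "'n::finite set set \<Rightarrow> (real ^ 'n) set" where
  "nestohedron B = (\<Sum>I\<in>B. coord_simplex I)"


subsection \<open>Simple and flag polytopes\<close>

text \<open>Polytopes need not be full-dimensional; dimension means affine dimension.\<close>

definition simple_polytope :: "'a::euclidean_space set \<Rightarrow> bool" where
  "simple_polytope P \<longleftrightarrow>
     polytope P \<and>
     (\<forall>v. v extreme_point_of P \<longrightarrow> int (card {F. F facet_of P \<and> v \<in> F}) = aff_dim P)"

definition flag_polytope :: "'a::euclidean_space set \<Rightarrow> bool" where
  "flag_polytope P \<longleftrightarrow>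
     simple_polytope P \<and>
     (\<forall>C. C \<subseteq> {F. F facet_of P} \<and> (\<forall>F\<in>C. \<forall>G\<in>C. F \<inter> G \<noteq> {}) \<longrightarrow> \<Inter>C \<noteq> {})"


subsection \<open>Abstract simplicial complexes\<close>

text \<open>A complex is given by its set of faces, including the empty face, so that
  \<open>f\<^sub>0 = 1\<close> always. Its vertices are the elements of \<open>\<Union>\<Delta>\<close>.\<close>

definition asc :: "'a set set \<Rightarrow> bool" where
  "asc \<Delta> \<longleftrightarrow>
     finite \<Delta> \<and> {} \<in> \<Delta> \<and> (\<forall>\<sigma>\<in>\<Delta>. finite \<sigma>) \<and> (\<forall>\<sigma>\<in>\<Delta>. \<forall>\<tau>. \<tau> \<subseteq> \<sigma> \<longrightarrow> \<tau> \<in> \<Delta>)"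

definition flag_complex :: "'a set set \<Rightarrow> bool" where
  "flag_complex \<Delta> \<longleftrightarrow>
     asc \<Delta> \<and>
     (\<forall>\<sigma>. \<sigma> \<subseteq> \<Union>\<Delta> \<and> (\<forall>u\<in>\<sigma>. \<forall>v\<in>\<sigma>. u \<noteq> v \<longrightarrow> {u, v} \<in> \<Delta>) \<longrightarrow> \<sigma> \<in> \<Delta>)"

text \<open>The number \<open>d\<close> such that the complex has dimension \<open>d - 1\<close>.\<close>

definition rank_complex :: "'a set set \<Rightarrow> nat" where
  "rank_complex \<Delta> = Max (card ` \<Delta>)"

text \<open>The number of faces of dimension \<open>i - 1\<close>.\<close>

definition f_num :: "'a set set \<Rightarrow> nat \<Rightarrow> nat" where
  "f_num \<Delta> i = card {\<sigma>\<in>\<Delta>. card \<sigma> = i}"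

definition f_poly :: "'a set set \<Rightarrow> int poly" where
  "f_poly \<Delta> = (\<Sum>i\<le>rank_complex \<Delta>. monom (int (f_num \<Delta> i)) i)"

text \<open>\<open>h(t) = (t - 1)\<^sup>d f(1 / (t - 1))\<close> with the denominators cleared term by term;
  see \<open>poly_h_poly\<close> below.\<close>

definition h_poly :: "'a set set \<Rightarrow> int poly" where
  "h_poly \<Delta> = (\<Sum>i\<le>rank_complex \<Delta>.
     smult (int (f_num \<Delta> i)) ([:-1, 1:] ^ (rank_complex \<Delta> - i)))"

lemma poly_h_poly:
  fixes t :: real
  assumes "t \<noteq> 1"
  shows "poly (map_poly of_int (h_poly \<Delta>)) t =
    (t - 1) ^ rank_complex \<Delta> * poly (map_poly of_int (f_poly \<Delta>)) (1 / (t - 1))"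
proof -
  let ?d = "rank_complex \<Delta>"
  let ?R = "map_poly (of_int :: int \<Rightarrow> real)"
  have R_sum: "?R (sum p A) = (\<Sum>i\<in>A. ?R (p i))" for p :: "nat \<Rightarrow> int poly" and A
    by (rule poly_eqI) (simp add: coeff_map_poly coeff_sum)
  have R_smult: "?R (smult c p) = smult (of_int c) (?R p)" for c p
    by (rule poly_eqI) (simp add: coeff_map_poly)
  have R_mult: "?R (p * q) = ?R p * ?R q" for p q
    by (rule poly_eqI) (simp add: coeff_map_poly coeff_mult)
  have R_power: "?R (p ^ n) = ?R p ^ n" for p n
    by (induction n) (simp_all add: R_mult)
  have "poly (?R (h_poly \<Delta>)) t = (\<Sum>i\<le>?d. real (f_num \<Delta> i) * (t - 1) ^ (?d - i))"
    by (simp add: h_poly_def R_sum R_smult R_power poly_sum poly_power map_poly_pCons)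
  also have "\<dots> = (\<Sum>i\<le>?d. (t - 1) ^ ?d * (real (f_num \<Delta> i) * (1 / (t - 1)) ^ i))"
    using assms by (intro sum.cong) (auto simp: power_diff field_simps)
  also have "\<dots> = (t - 1) ^ ?d * poly (?R (f_poly \<Delta>)) (1 / (t - 1))"
    by (simp add: f_poly_def R_sum map_poly_monom poly_sum poly_monom sum_distrib_left)
  finally show ?thesis .
qed

text \<open>The \<open>\<gamma>\<close>-expansion; the coefficients are unique by \<open>gamma_poly_eqI\<close> below.\<close>

definition gamma_expansion :: "nat \<Rightarrow> int poly \<Rightarrow> int poly" where
  "gamma_expansion d g =
     (\<Sum>i\<le>d div 2. smult (coeff g i) (monom 1 i * [:1, 1:] ^ (d - 2 * i)))"

definition gamma_poly :: "'a set set \<Rightarrow> int poly" where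
  "gamma_poly \<Delta> = (THE g. degree g \<le> rank_complex \<Delta> div 2 \<and>
     h_poly \<Delta> = gamma_expansion (rank_complex \<Delta>) g)"

lemma gamma_expansion_inject:
  assumes eq: "gamma_expansion d g = gamma_expansion d g'"
    and deg: "degree g \<le> d div 2" "degree g' \<le> d div 2"
  shows "g = g'"
proof (rule poly_eqI)
  fix k
  have c: "coeff (gamma_expansion d p) k =
      coeff p k + (\<Sum>i<k. coeff p i * coeff ([:1, 1:] ^ (d - 2 * i)) (k - i))"
    if "k \<le> d div 2" for k p
  proof -
    have "coeff (gamma_expansion d p) k =
        (\<Sum>i\<le>d div 2. coeff p i *
           (if k < i then 0 else coeff ([:1, 1:] ^ (d - 2 * i)) (k - i)))"
      by (simp add: gamma_expansion_def coeff_sum coeff_monom_mult cong: if_cong)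
    also have "\<dots> = (\<Sum>i\<le>k. coeff p i *
           (if k < i then 0 else coeff ([:1, 1:] ^ (d - 2 * i)) (k - i)))"
      by (rule sum.mono_neutral_right) (use that in auto)
    also have "\<dots> = (\<Sum>i\<le>k. coeff p i * coeff ([:1, 1:] ^ (d - 2 * i)) (k - i))"
      by (rule sum.cong) auto
    also have "\<dots> = coeff p k + (\<Sum>i<k. coeff p i * coeff ([:1, 1:] ^ (d - 2 * i)) (k - i))"
      by (simp add: lessThan_Suc_atMost [symmetric] coeff_linear_poly_power)
    finally show ?thesis .
  qed
  show "coeff g k = coeff g' k"
  proof (induction k rule: less_induct)
    case (less k)
    show ?case
    proof (cases "k \<le> d div 2")
      case True
      have "(\<Sum>i<k. coeff g i * coeff ([:1, 1:] ^ (d - 2 * i)) (k - i)) =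
            (\<Sum>i<k. coeff g' i * coeff ([:1, 1:] ^ (d - 2 * i)) (k - i))"
        by (rule sum.cong) (auto simp: less)
      then show ?thesis
        using c [OF True, of g] c [OF True, of g'] eq by simp
    next
      case False
      then show ?thesis
        using deg by (simp add: coeff_eq_0)
    qed
  qed
qed

lemma gamma_poly_eqI:
  assumes "degree g \<le> rank_complex \<Delta> div 2"
    and "h_poly \<Delta> = gamma_expansion (rank_complex \<Delta>) g"
  shows "gamma_poly \<Delta> = g"
  unfolding gamma_poly_def
  by (rule the_equality) (use assms gamma_expansion_inject in auto)


subsection \<open>The Frankl--Fueredi--Kalai inequalities\<close>

definition balanced_complex :: "'a set set \<Rightarrow> bool" where
  "balanced_complex \<Delta> \<longleftrightarrow>
     asc \<Delta> \<and>
     (\<exists>c :: 'a \<Rightarrow> nat.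
        (\<forall>v\<in>\<Union>\<Delta>. c v < rank_complex \<Delta>) \<and>
        (\<forall>u v. u \<noteq> v \<and> {u, v} \<in> \<Delta> \<longrightarrow> c u \<noteq> c v))"

text \<open>Satisfying the inequalities is taken to mean being the \<open>f\<close>-vector of a balanced
  complex. Vertices in \<^typ>\<open>nat\<close> are no restriction, as complexes are finite.\<close>

definition satisfies_FFK :: "int poly \<Rightarrow> bool" where
  "satisfies_FFK p \<longleftrightarrow> (\<exists>\<Delta> :: nat set set. balanced_complex \<Delta> \<and> f_poly \<Delta> = p)"


subsection \<open>The dual complex of a polytope\<close>

text \<open>The polar is taken in the linear span of \<open>P - c\<close>, for a relative interior point \<open>c\<close>
  of \<open>P\<close>, because nestohedra are never full-dimensional. The choice of \<open>c\<close> does not affect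
  the face lattice.\<close>

definition polar_dual :: "'a::euclidean_space set \<Rightarrow> 'a set" where
  "polar_dual P = (let c = (SOME c. c \<in> rel_interior P) in
     {y \<in> span ((\<lambda>x. x - c) ` P). \<forall>x\<in>P. (x - c) \<bullet> y \<le> 1})"

text \<open>Each proper face (including the empty one) is recorded by its set of vertices.\<close>

definition boundary_complex :: "'a::euclidean_space set \<Rightarrow> 'a set set" where
  "boundary_complex Q = {{v. v extreme_point_of F} |F. F face_of Q \<and> F \<noteq> Q}"

definition gamma_polytope :: "'a::euclidean_space set \<Rightarrow> int poly" where
  "gamma_polytope P = gamma_poly (boundary_complex (polar_dual P))"

end

theory Submission
  imports Defs "HOL-Library.Nat_Bijection"
begin

text \<open>
  A point \<open>x\<close> of the nestohedron of \<open>B\<close> determines the set of members \<open>I\<close> for which the sum of the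
  coordinates of \<open>x\<close> over \<open>I\<close> is as small as possible. The sets so obtained are the nested sets, and
  every linear functional is, up to terms constant on the nestohedron, minus a positive combination
  of the indicators of a nested set. Hence the boundary complex of the polar dual is the complex of
  nested sets. If the nestohedron is flag, every member of \<open>B\<close> with at least two elements is the
  disjoint union of two members, and nestedness is a condition on pairs.

  Such a flag building set \<open>B\<close> is reached from the singletons by adding one set at a time through
  flag building sets. Adding \<open>Z = A \<union> C\<close> suspends the nested complex if \<open>Z\<close> becomes maximal, and
  subdivides its edge \<open>{A, C}\<close> otherwise; so \<open>\<gamma>(B \<union> {Z}) = \<gamma>(B) + t \<gamma>(B|Z) \<gamma>(B/Z)\<close> in the second
  case. The complex \<open>\<Gamma>(B)\<close> (Aisbett) is the clique complex of the graph on the stages of the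
  second kind in which stage \<open>i\<close> is joined to a later stage \<open>j\<close> iff \<open>i\<close> is still of the second kind
  after restriction to, or contraction by, the set added at stage \<open>j\<close>. Restriction and contraction
  commute with this construction, so the neighbourhood of the last vertex is the join of the
  graphs for \<open>B|Z\<close> and \<open>B/Z\<close>, which gives the same recursion.

  The Frankl--Fueredi--Kalai inequalities hold for the clique vector of any graph (Frohmader). This
  follows from the coloured Kruskal--Katona theorem, which is proved by compression.
\<close>

subsection \<open>The coloured Kruskal--Katona theorem\<close>

text \<open>The relation between \<open>h\<close> and \<open>\<gamma>\<close> is used in one shape
  only. With \<open>u = 1 / (t - 1)\<close> it says that the f-polynomial of the sphere at
  \<open>u\<close> is \<open>(1 + 2 * u) ^ d\<close> times the f-polynomial of
  \<open>\<Gamma>\<close> at \<open>u * (1 + u) / (1 + 2 * u) ^ 2\<close>. A suspension multiplies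
  the left side by \<open>1 + 2 * u\<close>, and the subdivision of an edge adds
  \<open>u * (1 + u)\<close> times its link, so both kinds of stages can be read off on both sides.

  \<open>\<Gamma>\<close> depends on the order in which the sets are added, so the induction runs
  over filtrations and not over building sets. What shapes it is that adjacency of two stages must
  survive restriction and contraction by a later set; contraction is the hard case.

  In the coloured Kruskal--Katona theorem, compression in each colour separately is not enough: with
  two colours, the pairs \<open>{0, 1}\<close>, \<open>{0, 3}\<close>, \<open>{0, 5}\<close> are
  stable under it, but \<open>{1, 2}\<close> precedes \<open>{0, 3}\<close>. A further exchange,
  sometimes of whole blocks of sets, has to follow.\<close>

text \<open>The colour of a vertex is its residue modulo \<open>R\<close>. Sets are compared by \<^const>\<open>set_encode\<close>,
  that is, colexicographically; removing a colour then leaves an order of the same kind.\<close>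

definition rainbow :: "nat \<Rightarrow> nat set \<Rightarrow> nat \<Rightarrow> nat set set" where
  "rainbow R C k = {A. finite A \<and> card A = k \<and> (\<lambda>v. v mod R) ` A \<subseteq> C \<and> inj_on (\<lambda>v. v mod R) A}"

definition shadow :: "'a set set \<Rightarrow> 'a set set" where
  "shadow \<F> = {A - {a} |A a. A \<in> \<F> \<and> a \<in> A}"

definition initial :: "nat \<Rightarrow> nat set \<Rightarrow> nat \<Rightarrow> nat set set \<Rightarrow> bool" where
  "initial R C k \<I> \<longleftrightarrow> \<I> \<subseteq> rainbow R C k \<and> finite \<I> \<and>
     (\<forall>B\<in>\<I>. \<forall>A\<in>rainbow R C k. set_encode A \<le> set_encode B \<longrightarrow> A \<in> \<I>)"

text \<open>Termination measure: exchanging a member for an earlier set lowers it.\<close>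

definition weight :: "nat set set \<Rightarrow> nat" where
  "weight \<F> = (\<Sum>A\<in>\<F>. set_encode A)"

section \<open>Colexicographic order and rainbow sets\<close>

lemma set_encode_less_power:
  assumes "\<And>v. v \<in> A \<Longrightarrow> v < b"
  shows "set_encode A < 2 ^ b"
proof -
  have "A \<subseteq> {..<b}" using assms by auto
  then have "set_encode A \<le> (\<Sum>v<b. 2 ^ v)"
    unfolding set_encode_def by (intro sum_mono2) auto
  also have "\<dots> < 2 ^ b" by (induction b) auto
  finally show ?thesis .
qed

lemma power_le_set_encode: "finite B \<Longrightarrow> b \<in> B \<Longrightarrow> 2 ^ b \<le> set_encode B"
  unfolding set_encode_def by (rule member_le_sum) auto

lemma set_encode_less:
  assumes "finite B" "b \<in> B" "\<And>v. v \<in> A \<Longrightarrow> v < b"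
  shows "set_encode A < set_encode B"
proof -
  have "set_encode A < 2 ^ b" using assms(3) by (rule set_encode_less_power)
  then show ?thesis using power_le_set_encode [OF assms(1,2)] by linarith
qed

lemma set_encode_remove:
  "finite A \<Longrightarrow> a \<in> A \<Longrightarrow> set_encode A = set_encode (A - {a}) + 2 ^ a"
  unfolding set_encode_def by (simp add: sum.remove [of A a])

lemma set_encode_add:
  "finite A \<Longrightarrow> a \<notin> A \<Longrightarrow> set_encode (insert a A) = set_encode A + 2 ^ a"
  unfolding set_encode_def by simp

lemma set_encode_exchange:
  assumes "finite A" "a \<in> A" "x \<notin> A" "x < a"
  shows "set_encode (insert x (A - {a})) < set_encode A"
proof -
  have "(2::nat) ^ x < 2 ^ a" using assms by simp
  then show ?thesis
    using assms set_encode_remove [of A a] set_encode_add [of "A - {a}" x] by simp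
qed

lemma rainbowD:
  assumes "A \<in> rainbow R C k"
  shows "finite A" "card A = k" "\<And>v. v \<in> A \<Longrightarrow> v mod R \<in> C"
    "\<And>v w. v \<in> A \<Longrightarrow> w \<in> A \<Longrightarrow> v mod R = w mod R \<Longrightarrow> v = w"
  using assms by (auto simp: rainbow_def inj_on_def)

lemma rainbow_finite: "A \<in> rainbow R C k \<Longrightarrow> finite A"
  and rainbow_card: "A \<in> rainbow R C k \<Longrightarrow> card A = k"
  by (auto simp: rainbow_def)

lemma rainbow_0: "rainbow R C 0 = {{}}"
  by (auto simp: rainbow_def)

lemma rainbowI:
  assumes "finite A" "card A = k" "\<And>v. v \<in> A \<Longrightarrow> v mod R \<in> C"
    "\<And>v w. v \<in> A \<Longrightarrow> w \<in> A \<Longrightarrow> v mod R = w mod R \<Longrightarrow> v = w"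
  shows "A \<in> rainbow R C k"
  using assms by (auto simp: rainbow_def inj_on_def)

lemma rainbow_card_colours:
  "A \<in> rainbow R C k \<Longrightarrow> card ((\<lambda>v. v mod R) ` A) = k"
  by (auto simp: rainbow_def card_image)

lemma rainbow_remove: "A \<in> rainbow R C (Suc k) \<Longrightarrow> a \<in> A \<Longrightarrow> A - {a} \<in> rainbow R C k"
    unfolding rainbow_def by (auto intro: inj_on_subset)

lemma rainbow_remove_colour:
  "A \<in> rainbow R C (Suc k) \<Longrightarrow> a \<in> A \<Longrightarrow> A - {a} \<in> rainbow R (C - {a mod R}) k"
  unfolding rainbow_def by (auto simp: inj_on_def)

lemma rainbow_insert:
  assumes "A \<in> rainbow R C k" "x mod R \<in> C" "x mod R \<notin> (\<lambda>v. v mod R) ` A"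
  shows "insert x A \<in> rainbow R C (Suc k)"
proof -
  have "x \<notin> A" "finite A" "A - {x} = A" using assms by (auto simp: rainbow_def)
  then show ?thesis using assms by (simp add: rainbow_def inj_on_insert)
qed

lemma rainbow_exchange:
  assumes "A \<in> rainbow R C k" "a \<in> A" "x mod R \<in> C" "x mod R \<notin> (\<lambda>v. v mod R) ` (A - {a})"
  shows "insert x (A - {a}) \<in> rainbow R C k"
proof -
  obtain k' where "k = Suc k'" using assms(1,2) rainbow_0 by (cases k) auto
  then show ?thesis using assms rainbow_insert rainbow_remove by blast
qed

lemma rainbow_mono: "C \<subseteq> D \<Longrightarrow> rainbow R C k \<subseteq> rainbow R D k"
  by (auto simp: rainbow_def)

text \<open>This is what makes the shadow of an initial segment initial. A common maximum is removed
  together with its colour, which leaves the same problem with one colour less. Otherwise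
  \<open>A\<close> lies strictly below the maximum of \<open>B\<close>, and it suffices to add the
  smallest vertex whose colour \<open>A\<close> does not use.\<close>

lemma superset_mono:
  assumes "C \<subseteq> {..<R}" "A \<in> rainbow R C j" "B \<in> rainbow R C j" "set_encode A \<le> set_encode B"
    and "insert b B \<in> rainbow R C (Suc j)" "b \<notin> B"
  shows "\<exists>x. x \<notin> A \<and> insert x A \<in> rainbow R C (Suc j) \<and>
    set_encode (insert x A) \<le> set_encode (insert b B)"
  using assms
proof (induction j arbitrary: C A B)
  case 0
  then have "A = {}" "B = {}" by (auto simp: rainbow_0)
  then show ?case using 0 by auto
next
  case (Suc j)
  note fA = rainbowD [OF Suc.prems(2)] and fB = rainbowD [OF Suc.prems(3)]
  note fbB = rainbowD [OF Suc.prems(5)]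
  define m where "m = Max B"
  have "B \<noteq> {}" using fB by auto
  then have m: "m \<in> B" "\<And>v. v \<in> B \<Longrightarrow> v \<le> m" using fB by (auto simp: m_def)
  have Am: "v \<le> m" if "v \<in> A" for v
  proof (rule ccontr)
    assume "\<not> v \<le> m"
    then have "set_encode B < set_encode A"
      using that fA(1) m by (intro set_encode_less [of A v]) force+
    then show False using Suc.prems(4) by simp
  qed
  show ?case
  proof (cases "m \<in> A")
    case True
    let ?C = "C - {m mod R}"
    have "set_encode (A - {m}) \<le> set_encode (B - {m})"
      using Suc.prems(4) True m(1) fA(1) fB(1)
        set_encode_remove [of A m] set_encode_remove [of B m] by simp
    moreover have bm: "insert b (B - {m}) = insert b B - {m}" using m(1) Suc.prems(6) by auto
    moreover have "insert b B - {m} \<in> rainbow R ?C (Suc j)"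
      using rainbow_remove_colour [OF Suc.prems(5), of m] m(1) by simp
    ultimately obtain x where x: "x \<notin> A - {m}" "insert x (A - {m}) \<in> rainbow R ?C (Suc j)"
      "set_encode (insert x (A - {m})) \<le> set_encode (insert b (B - {m}))"
      using Suc.IH [of ?C "A - {m}" "B - {m}"] Suc.prems(1,6)
        rainbow_remove_colour [OF Suc.prems(2) True] rainbow_remove_colour [OF Suc.prems(3) m(1)]
      by auto
    have xm: "x \<noteq> m" "x mod R \<noteq> m mod R" using rainbowD(3) [OF x(2), of x] by auto
    have "insert m (insert x (A - {m})) \<in> rainbow R C (Suc (Suc j))"
    proof (rule rainbow_insert)
      show "insert x (A - {m}) \<in> rainbow R C (Suc j)"
        using x(2) rainbow_mono [of ?C C R "Suc j"] by auto
      show "m mod R \<notin> (\<lambda>v. v mod R) ` insert x (A - {m})"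
        using rainbowD(3) [OF x(2)] by force
    qed (use fA(3) [OF True] in simp)
    moreover have "insert m (insert x (A - {m})) = insert x A" using True by auto
    moreover have "set_encode (insert x A) \<le> set_encode (insert b B)"
    proof -
      have "set_encode (insert x A) = set_encode (insert x (A - {m})) + 2 ^ m"
        using calculation(2) xm fA(1) set_encode_add [of "insert x (A - {m})" m] by simp
      moreover have "set_encode (insert b B) = set_encode (insert b (B - {m})) + 2 ^ m"
        using bm m(1) fB(1) set_encode_remove [of "insert b B" m] by simp
      ultimately show ?thesis using x(3) by simp
    qed
    ultimately show ?thesis using x xm by auto
  next
    case False
    have Am': "v < m" if "v \<in> A" for v using Am [OF that] False that by (cases "v = m") auto
    \<comment> \<open>The smallest colour that \<open>A\<close> does not use, read as a vertex:
      below \<open>R\<close> a vertex is its own residue. It exists because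
      \<open>insert b B\<close> uses \<open>j + 2\<close> colours of \<open>C\<close> and
      \<open>A\<close> only \<open>j + 1\<close>.\<close>
    define x where "x = Min (C - (\<lambda>v. v mod R) ` A)"
    have fC: "finite C" using Suc.prems(1) finite_subset by auto
    have "card ((\<lambda>v. v mod R) ` insert b B) \<le> card C"
      using fbB fC by (intro card_mono) auto
    then have "Suc (Suc j) \<le> card C" using rainbow_card_colours [OF Suc.prems(5)] by simp
    then have "card ((\<lambda>v. v mod R) ` A) < card C" using rainbow_card_colours [OF Suc.prems(2)]
        by simp
    then have "\<not> C \<subseteq> (\<lambda>v. v mod R) ` A" using fA(1) card_mono [of "(\<lambda>v. v mod R) ` A" C] by auto
    then have "C - (\<lambda>v. v mod R) ` A \<noteq> {}" by auto
    then have x: "x \<in> C" "x \<notin> (\<lambda>v. v mod R) ` A"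
      and xmin: "\<And>c. c \<in> C \<Longrightarrow> c < x \<Longrightarrow> c \<in> (\<lambda>v. v mod R) ` A"
      using Min_in [of "C - (\<lambda>v. v mod R) ` A"] Min_le [of "C - (\<lambda>v. v mod R) ` A"] fC
      unfolding x_def by (auto simp: not_le [symmetric])
    have xR: "x < R" "x mod R = x" using x Suc.prems(1) by auto
    have xA: "x \<notin> A" using x xR by force
    have ins: "insert x A \<in> rainbow R C (Suc (Suc j))"
      using x xR Suc.prems(2) by (intro rainbow_insert) auto
    have le: "set_encode (insert x A) \<le> set_encode (insert b B)"
    proof (cases "x < m")
      case True
      then have "set_encode (insert x A) < set_encode (insert b B)"
        using Am' m fB by (intro set_encode_less [of _ m]) auto
      then show ?thesis by simp
    next
      case False
      \<comment> \<open>Now \<open>m \<le> x < R\<close>, so the elements of \<open>A\<close> are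
        their own colours, and minimality of \<open>x\<close> makes \<open>A\<close> the set of all
        colours of \<open>C\<close> below \<open>x\<close>. The set \<open>insert x A\<close> is
        then as early as its cardinality permits.\<close>
      have Alow: "v \<in> C" "v < x" if "v \<in> A" for v
        using fA(3) [OF that] Am' [OF that] False xR by auto
      have "A = {c \<in> C. c < x}"
      proof
        show "{c \<in> C. c < x} \<subseteq> A" using xmin Alow xR by fastforce
      qed (use Alow in auto)
      moreover have "B \<subseteq> {c \<in> C. c \<le> x}" using m fB(3) False xR by (force)
      ultimately have Bsub: "B \<subseteq> insert x A" by auto
      have "b \<in> insert x A \<or> x < b"
      proof (cases "b \<le> x")
        case True
        then have "b \<in> C" using fbB(3) [of b] xR by auto
        then show ?thesis using True \<open>A = _\<close> by (cases "b = x") auto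
      qed simp
      then show ?thesis
      proof
        assume "b \<in> insert x A"
        then have "insert b B \<subseteq> insert x A" using Bsub by simp
        then have "insert b B = insert x A"
          using rainbowD(1,2) [OF ins] fbB(1,2) by (simp add: card_subset_eq)
        then show ?thesis by simp
      next
        assume "x < b"
        then have "set_encode (insert x A) < set_encode (insert b B)"
          using Alow fB by (intro set_encode_less [of _ b]) force+
        then show ?thesis by simp
      qed
    qed
    show ?thesis using xA ins le by blast
  qed
qed

section \<open>Initial segments and their shadows\<close>

lemma initial_shadow:
  assumes "C \<subseteq> {..<R}" "initial R C (Suc j) \<I>"
  shows "initial R C j (shadow \<I>)"
proof -
  have "shadow \<I> = (\<lambda>(A, a). A - {a}) ` (SIGMA A:\<I>. A)" by (auto simp: shadow_def)
  moreover have "finite (SIGMA A:\<I>. A)" using assms(2)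
      by (auto simp: initial_def dest: rainbow_finite)
  ultimately have fin: "finite (shadow \<I>)" by simp
  have sub: "shadow \<I> \<subseteq> rainbow R C j"
    using assms(2) rainbow_remove by (fastforce simp: shadow_def initial_def)
  have "A \<in> shadow \<I>" if B: "B \<in> shadow \<I>" and A: "A \<in> rainbow R C j"
    and le: "set_encode A \<le> set_encode B" for A B
  proof -
    obtain D b where D: "D \<in> \<I>" "b \<in> D" "B = D - {b}" using B by (auto simp: shadow_def)
    then have ins: "insert b B = D" by auto
    then have "insert b B \<in> rainbow R C (Suc j)" using D assms(2) by (auto simp: initial_def)
    then obtain x where "x \<notin> A" "insert x A \<in> rainbow R C (Suc j)"
      "set_encode (insert x A) \<le> set_encode D"
      using superset_mono [OF assms(1) A _ le, of b] sub B D(3) ins by auto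
    then have "insert x A \<in> \<I>" using D assms(2) by (auto simp: initial_def)
    then show ?thesis using \<open>x \<notin> A\<close> unfolding shadow_def by (intro CollectI exI [of _ "insert x A"] exI [of _ x]) auto
  qed
  then show ?thesis using fin sub unfolding initial_def by blast
qed

lemma finite_shadow: "finite \<F> \<Longrightarrow> (\<And>A. A \<in> \<F> \<Longrightarrow> finite A) \<Longrightarrow> finite (shadow \<F>)"
proof -
  assume a: "finite \<F>" "\<And>A. A \<in> \<F> \<Longrightarrow> finite A"
  have "shadow \<F> = (\<lambda>(A, a). A - {a}) ` (SIGMA A:\<F>. A)" by (auto simp: shadow_def)
  then show ?thesis using a by simp
qed

lemma weight_exchange:
  assumes "finite \<F>" "B \<in> \<F>" "A \<notin> \<F>" "set_encode A < set_encode B"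
  shows "weight (insert A (\<F> - {B})) < weight \<F>" "card (insert A (\<F> - {B})) = card \<F>"
proof -
  show "weight (insert A (\<F> - {B})) < weight \<F>"
    using assms by (simp add: weight_def sum.remove [of \<F> B])
  show "card (insert A (\<F> - {B})) = card \<F>" using assms card.remove [of \<F> B] by simp
qed

text \<open>Replacing a member by an earlier missing set, again and again, stops because the weight
  drops. The strict inequality for families that are not initial drives the induction on the weight
  in \<open>coloured_Kruskal_Katona\<close>.\<close>

lemma initial_exists:
  assumes "finite \<F>" "\<F> \<subseteq> rainbow R C k"
  shows "\<exists>\<I>. initial R C k \<I> \<and> card \<I> = card \<F> \<and> weight \<I> \<le> weight \<F> \<and>
    (\<not> initial R C k \<F> \<longrightarrow> weight \<I> < weight \<F>)"
  using assms
proof (induction "weight \<F>" arbitrary: \<F> rule: less_induct)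
  case less
  show ?case
  proof (cases "initial R C k \<F>")
    case False
    then obtain A B where AB: "B \<in> \<F>" "A \<in> rainbow R C k" "A \<notin> \<F>" "set_encode A \<le> set_encode B"
      using less.prems by (auto simp: initial_def)
    have "A \<noteq> B" "finite A" "finite B" using AB less.prems by (auto dest: rainbow_finite)
    then have "set_encode A < set_encode B" using AB(4) set_encode_eq [of A B] by simp
    then have w: "weight (insert A (\<F> - {B})) < weight \<F>" "card (insert A (\<F> - {B})) = card \<F>"
      using weight_exchange less.prems AB by blast+
    then obtain \<I> where "initial R C k \<I>" "card \<I> = card \<F>" "weight \<I> \<le> weight (insert A (\<F> - {B}))"
      using less.hyps [OF w(1)] less.prems AB by auto
    then show ?thesis using w(1) by (intro exI [of _ \<I>]) auto
  qed auto
qed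

lemma initial_chain:
  assumes "initial R C k \<I>" "initial R C k \<J>" "card \<I> \<le> card \<J>"
  shows "\<I> \<subseteq> \<J>"
proof (rule ccontr)
  assume "\<not> \<I> \<subseteq> \<J>"
  then obtain A where A: "A \<in> \<I>" "A \<notin> \<J>" by auto
  have A': "A \<in> rainbow R C k" using A assms(1) by (auto simp: initial_def)
  have "\<J> \<subseteq> \<I>"
  proof
    fix B assume B: "B \<in> \<J>"
    then have B': "B \<in> rainbow R C k" using assms(2) by (auto simp: initial_def)
    have "\<not> set_encode A \<le> set_encode B"
      using A A' B assms(2) unfolding initial_def by blast
    then have "set_encode B \<le> set_encode A" by simp
    then show "B \<in> \<I>" using A B' assms(1) unfolding initial_def by blast
  qed
  then have "\<J> \<subset> \<I>" using A by auto
  then show False using assms psubset_card_mono [of \<I> \<J>] by (auto simp: initial_def)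
qed

section \<open>Sections of a family by one colour, and compression\<close>

definition vertex_link :: "nat \<Rightarrow> nat set set \<Rightarrow> nat set set" where
  "vertex_link w \<F> = {A. w \<notin> A \<and> insert w A \<in> \<F>}"

definition colour_deletion :: "nat \<Rightarrow> nat \<Rightarrow> nat set set \<Rightarrow> nat set set" where
  "colour_deletion R c \<F> = {A \<in> \<F>. \<forall>v\<in>A. v mod R \<noteq> c}"

lemma insert_image_vertex_link: "insert w ` vertex_link w \<F> = {A \<in> \<F>. w \<in> A}"
proof -
  have "A \<in> insert w ` vertex_link w \<F>" if "A \<in> \<F>" "w \<in> A" for A
    using that by (intro image_eqI [of _ _ "A - {w}"]) (auto simp: vertex_link_def insert_absorb)
  then show ?thesis by (auto simp: vertex_link_def)
qed

lemma inj_on_insert_vertex_link: "inj_on (insert w) (vertex_link w \<F>)"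
  by (auto simp: inj_on_def vertex_link_def)

lemma vertex_link_rainbow:
  assumes "\<F> \<subseteq> rainbow R C (Suc k)"
  shows "vertex_link w \<F> \<subseteq> rainbow R (C - {w mod R}) k"
proof
  fix A assume "A \<in> vertex_link w \<F>"
  then have "insert w A \<in> rainbow R C (Suc k)" "w \<notin> A" using assms by (auto simp: vertex_link_def)
  then show "A \<in> rainbow R (C - {w mod R}) k"
    using rainbow_remove_colour [of "insert w A" R C k w] by simp
qed

lemma colour_deletion_rainbow: "\<F> \<subseteq> rainbow R C k \<Longrightarrow> colour_deletion R c \<F> \<subseteq> rainbow R (C - {c}) k"
  by (auto simp: colour_deletion_def rainbow_def)

lemma finite_vertex_link: "finite \<F> \<Longrightarrow> finite (vertex_link w \<F>)"
proof (rule finite_subset)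
  show "vertex_link w \<F> \<subseteq> (\<lambda>A. A - {w}) ` \<F>"
  proof
    fix A assume "A \<in> vertex_link w \<F>"
    then show "A \<in> (\<lambda>A. A - {w}) ` \<F>"
      by (intro image_eqI [of _ _ "insert w A"]) (auto simp: vertex_link_def)
  qed
qed simp

lemma finite_colour_deletion: "finite \<F> \<Longrightarrow> finite (colour_deletion R c \<F>)"
  by (auto simp: colour_deletion_def)

text \<open>A rainbow set has at most one vertex of colour \<open>c\<close>, so the family splits
  into its part without this colour and the parts through single vertices. \<open>W\<close> may
  exceed the set of vertices that occur, so that one \<open>W\<close> serves a family, its
  compression and the shadows of both.\<close>

lemma sum_sections:
  fixes g :: "nat set \<Rightarrow> 'b::comm_monoid_add"
  assumes "finite \<F>" "\<F> \<subseteq> rainbow R C k" "finite W"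
    and W: "\<forall>w\<in>W. w mod R = c" "{w \<in> \<Union>\<F>. w mod R = c} \<subseteq> W"
  shows "sum g \<F> = sum g (colour_deletion R c \<F>) + (\<Sum>w\<in>W. \<Sum>A\<in>vertex_link w \<F>. g (insert w A))"
proof -
  have "\<F> = colour_deletion R c \<F> \<union> (\<Union>w\<in>W. {A \<in> \<F>. w \<in> A})"
    using W by (auto simp: colour_deletion_def)
  then have "sum g \<F> = sum g (colour_deletion R c \<F> \<union> (\<Union>w\<in>W. {A \<in> \<F>. w \<in> A}))" by simp
  also have "\<dots> = sum g (colour_deletion R c \<F>) + sum g (\<Union>w\<in>W. {A \<in> \<F>. w \<in> A})"
    using assms(1,3) W(1) by (intro sum.union_disjoint) (auto simp: colour_deletion_def)
  also have "sum g (\<Union>w\<in>W. {A \<in> \<F>. w \<in> A}) = (\<Sum>w\<in>W. sum g {A \<in> \<F>. w \<in> A})"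
  proof (rule sum.UNION_disjoint)
    show "\<forall>i\<in>W. \<forall>j\<in>W. i \<noteq> j \<longrightarrow> {A \<in> \<F>. i \<in> A} \<inter> {A \<in> \<F>. j \<in> A} = {}"
    proof (intro ballI impI)
      fix i j assume ij: "i \<in> W" "j \<in> W" "i \<noteq> j"
      have "\<not> (i \<in> A \<and> j \<in> A)" if "A \<in> \<F>" for A
        using rainbowD(4) [of A R C k i j] that ij W(1) assms(2) by auto
      then show "{A \<in> \<F>. i \<in> A} \<inter> {A \<in> \<F>. j \<in> A} = {}" by auto
    qed
  qed (use assms(1,3) in auto)
  also have "\<dots> = (\<Sum>w\<in>W. \<Sum>A\<in>vertex_link w \<F>. g (insert w A))"
    by (simp add: insert_image_vertex_link [symmetric] sum.reindex [OF inj_on_insert_vertex_link])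
  finally show ?thesis .
qed

lemma card_sections:
  assumes "finite \<F>" "\<F> \<subseteq> rainbow R C k" "finite W"
    and "\<forall>w\<in>W. w mod R = c" "{w \<in> \<Union>\<F>. w mod R = c} \<subseteq> W"
  shows "card \<F> = card (colour_deletion R c \<F>) + (\<Sum>w\<in>W. card (vertex_link w \<F>))"
  using sum_sections [OF assms, where g = "\<lambda>_. 1::nat"] by (simp)

lemma weight_sections:
  assumes "finite \<F>" "\<F> \<subseteq> rainbow R C k" "finite W"
    and "\<forall>w\<in>W. w mod R = c" "{w \<in> \<Union>\<F>. w mod R = c} \<subseteq> W"
  shows "weight \<F> =
      weight (colour_deletion R c \<F>) + (\<Sum>w\<in>W. weight (vertex_link w \<F>) + 2 ^ w * card (vertex_link w
      \<F>))"
proof -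
  have "(\<Sum>A\<in>vertex_link w \<F>. set_encode (insert w A)) =
      weight (vertex_link w \<F>) + 2 ^ w * card (vertex_link w \<F>)" for w
  proof -
    have "(\<Sum>A\<in>vertex_link w \<F>. set_encode (insert w A)) =
        (\<Sum>A\<in>vertex_link w \<F>. set_encode A + 2 ^ w)"
    proof (rule sum.cong)
      fix A assume "A \<in> vertex_link w \<F>"
      then have "w \<notin> A" "finite (insert w A)"
        using assms(2) rainbow_finite [of "insert w A" R C k] by (auto simp: vertex_link_def)
      then show "set_encode (insert w A) = set_encode A + 2 ^ w" by (simp add: set_encode_add)
    qed simp
    then show ?thesis by (simp add: weight_def sum.distrib mult.commute)
  qed
  then show ?thesis using sum_sections [OF assms, where g = set_encode] by (simp add: weight_def)
qed

lemma vertex_link_shadow: "vertex_link w (shadow \<F>) = shadow (vertex_link w \<F>)"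
proof
  show "vertex_link w (shadow \<F>) \<subseteq> shadow (vertex_link w \<F>)"
  proof
    fix A assume "A \<in> vertex_link w (shadow \<F>)"
    then obtain D a where "w \<notin> A" "insert w A = D - {a}" "D \<in> \<F>" "a \<in> D"
      by (auto simp: vertex_link_def shadow_def)
    then show "A \<in> shadow (vertex_link w \<F>)"
      unfolding shadow_def vertex_link_def
    proof (intro CollectI exI [of _ "D - {w}"] exI [of _ a] conjI)
      have "w \<in> D" "w \<noteq> a" using \<open>insert w A = D - {a}\<close> by auto
      then show "insert w (D - {w}) \<in> \<F>" "a \<in> D - {w}"
        using \<open>D \<in> \<F>\<close> \<open>a \<in> D\<close> by (auto simp: insert_absorb)
      show "A = D - {w} - {a}" using \<open>insert w A = D - {a}\<close> \<open>w \<notin> A\<close> by auto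
    qed auto
  qed
  show "shadow (vertex_link w \<F>) \<subseteq> vertex_link w (shadow \<F>)"
  proof
    fix A assume "A \<in> shadow (vertex_link w \<F>)"
    then obtain D a where "w \<notin> D" "insert w D \<in> \<F>" "a \<in> D" "A = D - {a}"
      by (auto simp: vertex_link_def shadow_def)
    then show "A \<in> vertex_link w (shadow \<F>)"
      unfolding shadow_def vertex_link_def
      by (intro CollectI conjI exI [of _ "insert w D"] exI [of _ a]) auto
  qed
qed

text \<open>A set without colour \<open>c\<close> arises from a member either without that colour,
  or by deleting the vertex of that colour; the latter sets form the links.\<close>

lemma colour_deletion_shadow:
  assumes "\<F> \<subseteq> rainbow R C k" "\<forall>w\<in>W. w mod R = c" "{w \<in> \<Union>\<F>. w mod R = c} \<subseteq> W"
  shows "colour_deletion R c (shadow \<F>) = shadow (colour_deletion R c \<F>) \<union> (\<Union>w\<in>W. vertex_link w \<F>)"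
proof
  show "colour_deletion R c (shadow \<F>) \<subseteq> shadow (colour_deletion R c \<F>) \<union> (\<Union>w\<in>W. vertex_link w \<F>)"
  proof
    fix A assume "A \<in> colour_deletion R c (shadow \<F>)"
    then obtain D a where D: "\<forall>v\<in>A. v mod R \<noteq> c" "A = D - {a}" "D \<in> \<F>" "a \<in> D"
      by (auto simp: colour_deletion_def shadow_def)
    show "A \<in> shadow (colour_deletion R c \<F>) \<union> (\<Union>w\<in>W. vertex_link w \<F>)"
    proof (cases "a mod R = c")
      case True
      then have "a \<in> W" "A \<in> vertex_link a \<F>" using D assms
          by (auto simp: vertex_link_def insert_absorb)
      then show ?thesis by auto
    next
      case False
      then have "D \<in> colour_deletion R c \<F>" using D by (auto simp: colour_deletion_def)
      then show ?thesis using D by (auto simp: shadow_def)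
    qed
  qed
  have "A \<in> colour_deletion R c (shadow \<F>)" if "w \<in> W" "A \<in> vertex_link w \<F>" for A w
  proof -
    have iA: "insert w A \<in> rainbow R C k" "w \<notin> A" "insert w A \<in> \<F>"
      using that assms by (auto simp: vertex_link_def)
    then have "\<forall>v\<in>A. v mod R \<noteq> c" using rainbowD(4) [OF iA(1)] assms(2) that(1) by blast
    moreover have "A \<in> shadow \<F>" using iA unfolding shadow_def
      by (intro CollectI exI [of _ "insert w A"] exI [of _ w]) auto
    ultimately show ?thesis by (auto simp: colour_deletion_def)
  qed
  then show "shadow (colour_deletion R c \<F>) \<union>
      (\<Union>w\<in>W. vertex_link w \<F>) \<subseteq> colour_deletion R c (shadow \<F>)"
    by (auto simp: colour_deletion_def shadow_def)
qed

text \<open>Inverse to taking sections, as \<open>glue_properties\<close> shows.\<close>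

definition glue :: "nat set set \<Rightarrow> nat set \<Rightarrow> (nat \<Rightarrow> nat set set) \<Rightarrow> nat set set" where
  "glue \<I> W \<J> = \<I> \<union> (\<Union>w\<in>W. insert w ` \<J> w)"

lemma glue_properties:
  assumes "\<I> \<subseteq> rainbow R (C - {c}) (Suc k)" "c \<in> C"
    and "\<forall>w\<in>W. \<J> w \<subseteq> rainbow R (C - {c}) k"
    and "\<forall>w\<in>W. w mod R = c"
  shows "glue \<I> W \<J> \<subseteq> rainbow R C (Suc k)"
    and "colour_deletion R c (glue \<I> W \<J>) = \<I>"
    and "\<And>w. w \<in> W \<Longrightarrow> vertex_link w (glue \<I> W \<J>) = \<J> w"
    and "{w \<in> \<Union>(glue \<I> W \<J>). w mod R = c} \<subseteq> W"
proof -
  have I: "v mod R \<noteq> c" if "A \<in> \<I>" "v \<in> A" for A v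
    using that assms(1) rainbowD(3) by blast
  have J: "v mod R \<noteq> c" if "w \<in> W" "A \<in> \<J> w" "v \<in> A" for A v w
    using that assms(3) rainbowD(3) by blast
  have "insert w A \<in> rainbow R C (Suc k)" if "w \<in> W" "A \<in> \<J> w" for w A
  proof (rule rainbow_insert)
    show "A \<in> rainbow R C k" using that assms(3) rainbow_mono [of "C - {c}" C R k] by auto
    show "w mod R \<in> C" using that assms(2,4) by auto
    show "w mod R \<notin> (\<lambda>v. v mod R) ` A" using J [OF that] assms(4) that(1) by (metis imageE)
  qed
  then show "glue \<I> W \<J> \<subseteq> rainbow R C (Suc k)"
    using assms(1) rainbow_mono [of "C - {c}" C R "Suc k"] by (auto simp: glue_def)
  show "colour_deletion R c (glue \<I> W \<J>) = \<I>" using I assms(4)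
      by (auto simp: colour_deletion_def glue_def)
  show "{w \<in> \<Union>(glue \<I> W \<J>). w mod R = c} \<subseteq> W"
    using I J unfolding glue_def by blast
  show "vertex_link w (glue \<I> W \<J>) = \<J> w" if w: "w \<in> W" for w
  proof
    show "\<J> w \<subseteq> vertex_link w (glue \<I> W \<J>)"
    proof
      fix A assume A: "A \<in> \<J> w"
      then have "w \<notin> A" using J [OF w A] assms(4) w by auto
      then show "A \<in> vertex_link w (glue \<I> W \<J>)" using A w by (auto simp: vertex_link_def glue_def)
    qed
    show "vertex_link w (glue \<I> W \<J>) \<subseteq> \<J> w"
    proof
      fix A assume A: "A \<in> vertex_link w (glue \<I> W \<J>)"
      then have "w \<notin> A" "insert w A \<notin> \<I>" using I [of "insert w A" w] assms(4) w
        by (auto simp: vertex_link_def)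
      then obtain w' A' where w': "w' \<in> W" "A' \<in> \<J> w'" "insert w A = insert w' A'"
        using A by (auto simp: vertex_link_def glue_def)
      have "w = w'"
        using J [OF w'(1,2), of w] assms(4) w w'(3) by (metis insertE insertI1)
      moreover have "w' \<notin> A'" using J [OF w'(1,2), of w'] assms(4) w'(1) by auto
      ultimately show "A \<in> \<J> w" using w' \<open>w \<notin> A\<close> by (metis insert_ident)
    qed
  qed
qed

text \<open>Initial segments form a chain, so a union of them is only as large as the largest one.
  This is the whole gain of compression.\<close>

lemma initial_Union:
  assumes "finite \<K>" "\<K> \<noteq> {}" "\<And>\<I>. \<I> \<in> \<K> \<Longrightarrow> initial R C k \<I>"
  shows "\<Union>\<K> \<in> \<K>"
  using assms
proof (induction \<K> rule: finite_ne_induct)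
  case (insert \<I> \<K>)
  then have "\<Union>\<K> \<in> \<K>" by auto
  then have "\<I> \<subseteq> \<Union>\<K> \<or> \<Union>\<K> \<subseteq> \<I>"
    using insert.prems initial_chain by (metis insertCI nat_le_linear)
  then show ?case using \<open>\<Union>\<K> \<in> \<K>\<close> by (auto simp: Un_absorb1 Un_absorb2)
qed auto

definition shadow_minimal :: "nat \<Rightarrow> nat set \<Rightarrow> bool" where
  "shadow_minimal R C \<longleftrightarrow> (\<forall>k \<F> \<I>. finite \<F> \<and> \<F> \<subseteq> rainbow R C (Suc k) \<and>
     initial R C (Suc k) \<I> \<and> card \<I> = card \<F> \<longrightarrow> card (shadow \<I>) \<le> card (shadow \<F>))"

text \<open>Every section in colour \<open>c\<close> is replaced by the initial segment of the same
  size. The shadow splits accordingly: the shadows of the links do not grow, by the hypothesis on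
  fewer colours, and the part without \<open>c\<close>, formerly a union of unrelated families,
  becomes the union of a chain. The cardinality \<open>Suc (Suc k)\<close> leaves the links at
  positive cardinality, where \<open>shadow_minimal\<close> applies.\<close>

lemma compression:
  assumes C: "C \<subseteq> {..<R}" "c \<in> C" and IH: "shadow_minimal R (C - {c})"
    and \<F>: "finite \<F>" "\<F> \<subseteq> rainbow R C (Suc (Suc k))"
  shows "\<exists>\<G>. finite \<G> \<and> \<G> \<subseteq> rainbow R C (Suc (Suc k)) \<and> card \<G> = card \<F> \<and>
    card (shadow \<G>) \<le> card (shadow \<F>) \<and> weight \<G> \<le> weight \<F> \<and>
    (\<not> (initial R (C - {c}) (Suc (Suc k)) (colour_deletion R c \<F>) \<and>
       (\<forall>w\<in>{w \<in> \<Union>\<F>. w mod R = c}. initial R (C - {c}) (Suc k) (vertex_link w \<F>))) \<longrightarrow>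
     weight \<G> < weight \<F>)"
proof -
  let ?D = "C - {c}"
  define W where "W = {w \<in> \<Union>\<F>. w mod R = c}"
  have Wc: "\<forall>w\<in>W. w mod R = c" by (simp add: W_def)
  have WF: "{w \<in> \<Union>\<F>. w mod R = c} \<subseteq> W" by (simp add: W_def)
  have finF: "finite A" if "A \<in> \<F>" for A using that \<F>(2) rainbow_finite by blast
  have finW: "finite W" using \<F>(1) finF by (auto simp: W_def)
  have s0: "finite (colour_deletion R c \<F>)" "colour_deletion R c \<F> \<subseteq> rainbow R ?D (Suc (Suc k))"
    using \<F> finite_colour_deletion colour_deletion_rainbow by auto
  obtain \<I> where I: "initial R ?D (Suc (Suc k)) \<I>" "card \<I> = card (colour_deletion R c \<F>)"
    "weight \<I> \<le> weight (colour_deletion R c \<F>)"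
    "\<not> initial R ?D (Suc (Suc k)) (colour_deletion R c \<F>) \<Longrightarrow>
        weight \<I> < weight (colour_deletion R c \<F>)"
    using initial_exists [OF s0] by blast
  have s: "finite (vertex_link w \<F>)" "vertex_link w \<F> \<subseteq> rainbow R ?D (Suc k)" if "w \<in> W" for w
    using \<F> finite_vertex_link vertex_link_rainbow [of \<F> R C "Suc k" w] Wc that by auto
  have "\<exists>\<J>. initial R ?D (Suc k) \<J> \<and> card \<J> = card (vertex_link w \<F>) \<and>
    weight \<J> \<le> weight (vertex_link w \<F>) \<and>
    (\<not> initial R ?D (Suc k) (vertex_link w \<F>) \<longrightarrow> weight \<J> < weight (vertex_link w \<F>))" if "w \<in>
        W" for w
    using initial_exists [OF s [OF that]] by blast
  then obtain \<J> where J: "\<And>w. w \<in> W \<Longrightarrow> initial R ?D (Suc k) (\<J> w)"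
    "\<And>w. w \<in> W \<Longrightarrow> card (\<J> w) = card (vertex_link w \<F>)"
    "\<And>w. w \<in> W \<Longrightarrow> weight (\<J> w) \<le> weight (vertex_link w \<F>)"
    "\<And>w. w \<in> W \<Longrightarrow> \<not> initial R ?D (Suc k) (vertex_link w \<F>) \<Longrightarrow> weight (\<J> w) < weight (vertex_link w \<F>)"
    by metis
  define \<G> where "\<G> = glue \<I> W \<J>"
  have Isub: "\<I> \<subseteq> rainbow R ?D (Suc (Suc k))" "finite \<I>" using I(1) by (auto simp: initial_def)
  have Jsub: "\<forall>w\<in>W. \<J> w \<subseteq> rainbow R ?D (Suc k)" "\<forall>w\<in>W. finite (\<J> w)"
    using J(1) by (auto simp: initial_def)
  note gl = glue_properties [where \<I> = \<I> and W = W and \<J> = \<J>, OF Isub(1) C(2) Jsub(1) Wc,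
      folded \<G>_def]
  have finG: "finite \<G>" using Isub Jsub finW by (auto simp: \<G>_def glue_def)
  note secsF = card_sections [OF \<F> finW Wc WF] weight_sections [OF \<F> finW Wc WF]
  note secsG = card_sections [OF finG gl(1) finW Wc gl(4)]
    weight_sections [OF finG gl(1) finW Wc gl(4)]
  have card_eq: "card \<G> = card \<F>"
    using secsF(1) secsG(1) gl(2,3) I(2) J(2) by (simp cong: sum.cong)
  have wG: "weight \<G> = weight \<I> + (\<Sum>w\<in>W. weight (\<J> w) + 2 ^ w * card (vertex_link w \<F>))"
    using secsG(2) gl(2,3) J(2) by (simp cong: sum.cong)
  have le: "weight (\<J> w) + 2 ^ w * card (vertex_link w \<F>) \<le>
      weight (vertex_link w \<F>) + 2 ^ w * card (vertex_link w \<F>)"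
    if "w \<in> W" for w using J(3) [OF that] by simp
  have sle: "(\<Sum>w\<in>W. weight (\<J> w) + 2 ^ w * card (vertex_link w \<F>)) \<le>
      (\<Sum>w\<in>W. weight (vertex_link w \<F>) + 2 ^ w * card (vertex_link w \<F>))"
    by (rule sum_mono) (rule le)
  then have wle: "weight \<G> \<le> weight \<F>" using wG secsF(2) I(3) by simp
  have wless: "weight \<G> < weight \<F>"
    if "\<not> (initial R ?D (Suc (Suc k)) (colour_deletion R c \<F>) \<and>
       (\<forall>w\<in>{w \<in> \<Union>\<F>. w mod R = c}. initial R ?D (Suc k) (vertex_link w \<F>)))"
  proof (cases "initial R ?D (Suc (Suc k)) (colour_deletion R c \<F>)")
    case False
    then show ?thesis using wG secsF(2) I(4) sle by simp
  next
    case True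
    then have "\<exists>w\<in>W. \<not> initial R ?D (Suc k) (vertex_link w \<F>)" using that by (simp add: W_def)
    then obtain w where w: "w \<in> W" "\<not> initial R ?D (Suc k) (vertex_link w \<F>)" by blast
    have "(\<Sum>w\<in>W. weight (\<J> w) + 2 ^ w * card (vertex_link w \<F>)) <
      (\<Sum>w\<in>W. weight (vertex_link w \<F>) + 2 ^ w * card (vertex_link w \<F>))"
      using le J(4) [OF w] w(1) finW by (intro sum_strict_mono_ex1) auto
    then show ?thesis using wG secsF(2) I(3) by simp
  qed
  have Ifin: "finite A" if "A \<in> \<G>" for A using that gl(1) rainbow_finite by blast
  have shsub: "shadow \<H> \<subseteq> rainbow R C (Suc k)" if "\<H> \<subseteq> rainbow R C (Suc (Suc k))" for \<H>
    using that rainbow_remove by (fastforce simp: shadow_def)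
  have shF: "finite (shadow \<F>)" "finite (shadow \<G>)"
    using finite_shadow \<F>(1) finF finG Ifin by auto
  have "card (shadow \<F>) =
      card (colour_deletion R c (shadow \<F>)) + (\<Sum>w\<in>W. card (vertex_link w (shadow \<F>)))"
    using WF by (intro card_sections [OF shF(1) shsub [OF \<F>(2)] finW Wc]) (fastforce simp:
        shadow_def)
  then have cF: "card (shadow \<F>) =
      card (shadow (colour_deletion R c \<F>) \<union> (\<Union>w\<in>W. vertex_link w \<F>)) + (\<Sum>w\<in>W. card (shadow
          (vertex_link w \<F>)))"
    using colour_deletion_shadow [OF \<F>(2) Wc WF] by (simp add: vertex_link_shadow)
  have "card (shadow \<G>) =
      card (colour_deletion R c (shadow \<G>)) + (\<Sum>w\<in>W. card (vertex_link w (shadow \<G>)))"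
    using gl(4) by (intro card_sections [OF shF(2) shsub [OF gl(1)] finW Wc]) (fastforce simp:
        shadow_def)
  then have cG: "card (shadow \<G>) =
      card (shadow \<I> \<union> (\<Union>w\<in>W. \<J> w)) + (\<Sum>w\<in>W. card (shadow (\<J> w)))"
    using colour_deletion_shadow [OF gl(1) Wc gl(4)] gl(2,3)
        by (simp add: vertex_link_shadow cong: sum.cong)
  have C': "?D \<subseteq> {..<R}" using C by auto
  have sh1: "card (shadow (\<J> w)) \<le> card (shadow (vertex_link w \<F>))" if "w \<in> W" for w
    using IH s [OF that] J(1,2) [OF that] unfolding shadow_minimal_def by blast
  have sh0: "card (shadow \<I>) \<le> card (shadow (colour_deletion R c \<F>))"
    using IH s0 I(1,2) unfolding shadow_minimal_def by blast
  let ?K = "insert (shadow \<I>) (\<J> ` W)"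
  have "\<Union>?K \<in> ?K"
    using finW J(1) initial_shadow [OF C' I(1)] by (intro initial_Union) auto
  then have "card (shadow \<I> \<union> (\<Union>w\<in>W. \<J> w)) \<le> card (shadow (colour_deletion R c \<F>) \<union>
      (\<Union>w\<in>W. vertex_link w \<F>))"
  proof -
    have fin: "finite (shadow (colour_deletion R c \<F>) \<union> (\<Union>w\<in>W. vertex_link w \<F>))"
      using s(1) finW finite_shadow [OF s0(1)] finF by (auto simp: colour_deletion_def)
    have "card X \<le> card (shadow (colour_deletion R c \<F>) \<union> (\<Union>w\<in>W. vertex_link w \<F>))" if "X \<in> ?K"
        for X
      using that
    proof
      assume "X = shadow \<I>"
      then have "card X \<le> card (shadow (colour_deletion R c \<F>))" using sh0 by simp
      also have "\<dots> \<le> card (shadow (colour_deletion R c \<F>) \<union> (\<Union>w\<in>W. vertex_link w \<F>))"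
        by (rule card_mono [OF fin]) auto
      finally show ?thesis .
    next
      assume "X \<in> \<J> ` W"
      then obtain w where w: "w \<in> W" "X = \<J> w" by auto
      then have "card X = card (vertex_link w \<F>)" using J(2) by simp
      also have "\<dots> \<le> card (shadow (colour_deletion R c \<F>) \<union> (\<Union>w\<in>W. vertex_link w \<F>))"
        using w by (intro card_mono [OF fin]) auto
      finally show ?thesis .
    qed
    then show ?thesis using \<open>\<Union>?K \<in> ?K\<close> by simp
  qed
  moreover have "(\<Sum>w\<in>W. card (shadow (\<J> w))) \<le> (\<Sum>w\<in>W. card (shadow (vertex_link w \<F>)))"
    by (rule sum_mono) (rule sh1)
  ultimately have "card (shadow \<G>) \<le> card (shadow \<F>)" using cF cG by linarith
  then show ?thesis using finG gl(1) card_eq wle wless by (intro exI [of _ \<G>] conjI impI)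
qed

section \<open>Exchange in a family stable under all compressions\<close>

definition status :: "nat \<Rightarrow> nat \<Rightarrow> nat set \<Rightarrow> nat set" where
  "status R c A = {v \<in> A. v mod R = c}"

lemma status_eq_singleton: "A \<in> rainbow R C k \<Longrightarrow> v \<in> A \<Longrightarrow> status R (v mod R) A = {v}"
  by (auto simp: status_def dest: rainbowD(4))

text \<open>Equal statuses mean that two rainbow sets use the same vertex of colour \<open>c\<close>
  or both avoid this colour; \<open>compressed\<close> thus expresses stability. Let
  \<open>B\<close> be the last member and \<open>A\<close> the first missing set. Stability makes
  them differ in every colour, and either \<open>B\<close> can be exchanged for \<open>A\<close>, or
  a block of sets around \<open>B\<close> for a block around \<open>A\<close>.\<close>

lemma exchange_step:
  assumes C: "C \<subseteq> {..<R}" and \<F>: "finite \<F>" "\<F> \<subseteq> rainbow R C (Suc (Suc j))"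
    and nin: "\<not> initial R C (Suc (Suc j)) \<F>"
    and compressed: "\<And>A B c. A \<in> rainbow R C (Suc (Suc j)) \<Longrightarrow> B \<in> \<F> \<Longrightarrow>
      set_encode A \<le> set_encode B \<Longrightarrow> c \<in> C \<Longrightarrow> status R c A = status R c B \<Longrightarrow> A \<in> \<F>"
  shows "\<exists>\<G>. finite \<G> \<and> \<G> \<subseteq> rainbow R C (Suc (Suc j)) \<and> card \<G> = card \<F> \<and>
    card (shadow \<G>) \<le> card (shadow \<F>) \<and> weight \<G> < weight \<F>"
proof -
  let ?P = "rainbow R C (Suc (Suc j))"
  let ?col = "\<lambda>A. (\<lambda>v. v mod R) ` A"
  have finP: "finite A" if "A \<in> ?P" for A using that rainbow_finite by blast
  obtain A0 B0 where A0: "A0 \<in> ?P" "A0 \<notin> \<F>" "B0 \<in> \<F>" "set_encode A0 \<le> set_encode B0"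
    using nin \<F> by (auto simp: initial_def)
  obtain B where B: "B \<in> \<F>" and last: "\<And>D. D \<in> \<F> \<Longrightarrow> set_encode D \<le> set_encode B"
  proof -
    have "Max (set_encode ` \<F>) \<in> set_encode ` \<F>" using \<F>(1) A0(3) by (intro Max_in) auto
    then obtain B where "B \<in> \<F>" "Max (set_encode ` \<F>) = set_encode B" by auto
    then show thesis using that [of B] \<F>(1) by (metis Max_ge finite_imageI imageI)
  qed
  obtain A where A: "A \<in> ?P" "A \<notin> \<F>" and first: "\<And>D. D \<in> ?P \<Longrightarrow> D \<notin> \<F> \<Longrightarrow> set_encode A \<le> set_encode D"
    using ex_has_least_nat [of "\<lambda>D. D \<in> ?P \<and> D \<notin> \<F>" A0 set_encode] A0 by blast
  have BP: "B \<in> ?P" using B \<F>(2) by blast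
  have AB: "set_encode A < set_encode B"
  proof -
    have "set_encode A \<le> set_encode B" using first [OF A0(1,2)] A0(4) last [OF A0(3)] by linarith
    moreover have "A \<noteq> B" using A B by auto
    ultimately show ?thesis using finP [OF A(1)] finP [OF BP] set_encode_eq [of A B] by simp
  qed
  have diff: "status R c A \<noteq> status R c B" if "c \<in> C" for c
    using compressed [OF A(1) B _ that] A(2) AB by auto
  have disj: "A \<inter> B = {}"
  proof (rule ccontr)
    assume "A \<inter> B \<noteq> {}"
    then obtain v where "v \<in> A" "v \<in> B" by auto
    then show False
      using diff [of "v mod R"] status_eq_singleton [OF A(1)] status_eq_singleton [OF BP]
        rainbowD(3) [OF BP] by auto
  qed
  define b where "b = Max B"
  have "B \<noteq> {}" using rainbow_card [OF BP] by auto
  then have b: "b \<in> B" and bmax: "\<And>v. v \<in> B \<Longrightarrow> v \<le> b" using finP [OF BP] by (auto simp: b_def)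
  have Ab: "v < b" if "v \<in> A" for v
  proof (rule ccontr)
    assume "\<not> v < b"
    moreover have "v \<noteq> b" using that b disj by auto
    ultimately have "set_encode B < set_encode A"
      using that bmax by (intro set_encode_less [OF finP [OF A(1)] that]) (meson le_less_trans
          nat_neq_iff)
    then show False using AB by simp
  qed
  define \<beta> where "\<beta> = b mod R"
  have bD: "D \<in> \<F>" if "D \<in> ?P" "b \<in> D" "set_encode D \<le> set_encode B" for D
    using compressed [OF that(1) B that(3), of \<beta>] status_eq_singleton [OF that(1,2)]
      status_eq_singleton [OF BP b] rainbowD(3) [OF BP b] by (simp add: \<beta>_def)
  have AD: "set_encode A \<le> set_encode D" if "D \<in> ?P" "b \<in> D" for D
    using set_encode_less [OF finP [OF that(1)] that(2), of A] Ab by (simp add: less_imp_le)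
  \<comment> \<open>Such a \<open>D\<close> would lie between \<open>A\<close> and \<open>B\<close>,
    agreeing with \<open>B\<close> in the colour of \<open>b\<close> and with \<open>A\<close> in
    that of \<open>a\<close>; stability would carry membership from \<open>B\<close> to
    \<open>D\<close> and on to \<open>A\<close>. In \<open>mid'\<close> a colour missing from both
    sets replaces the common vertex \<open>a\<close>.\<close>
  have mid: False if D: "D \<in> ?P" "b \<in> D" "set_encode D \<le> set_encode B" "a \<in> A" "a \<in> D" for a D
    using compressed [OF A(1) bD [OF D(1-3)] AD [OF D(1,2)], of "a mod R"]
      status_eq_singleton [OF A(1) D(4)] status_eq_singleton [OF D(1,5)]
      rainbowD(3) [OF A(1) D(4)] A(2) by simp
  have mid': False if D: "D \<in> ?P" "b \<in> D" "set_encode D \<le> set_encode B"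
    "c \<in> C" "c \<notin> ?col A" "c \<notin> ?col D" for c D
  proof -
    have "status R c A = {}" "status R c D = {}" using D by (auto simp: status_def)
    then show False using compressed [OF A(1) bD [OF D(1-3)] AD [OF D(1,2)] D(4)] A(2) by simp
  qed
  \<comment> \<open>\<open>a \<in> N X\<close> iff \<open>X - {a}\<close> is not in the shadow of the rainbow sets preceding \<open>X\<close>.\<close>
  define N where "N X = {a \<in> X. a < R \<and> (\<forall>c\<in>C. c < a \<longrightarrow> c \<in> ?col X)}" for X
  have fsh: "finite (shadow \<F>)" "finite (shadow (\<F> - X))" for X
    using finite_shadow [of \<F>] finite_shadow [of "\<F> - X"] \<F> finP by auto
  have modC: "c mod R = c" if "c \<in> C" for c using that C by auto
  have lower: "insert x (D - {y}) \<in> ?P" "set_encode (insert x (D - {y})) < set_encode D"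
    if "D \<in> ?P" "y \<in> D" "x < y" "x mod R \<in> C" "x mod R \<notin> ?col (D - {y})" for D x y
  proof -
    show "insert x (D - {y}) \<in> ?P" using rainbow_exchange that by blast
    have "x \<notin> D" using that(3,5) by auto
    then show "set_encode (insert x (D - {y})) < set_encode D"
      using set_encode_exchange finP that by blast
  qed
  show ?thesis
  proof (cases "card (N A) \<le> card (N B)")
    case True
    let ?G = "insert A (\<F> - {B})"
    let ?S = "shadow (\<F> - {B})"
    \<comment> \<open>An element of \<open>A\<close> outside \<open>N A\<close> can be exchanged for
      a smaller vertex. The result precedes \<open>A\<close>, hence is a member, and already has the
      set in question in its shadow.\<close>
    have new: "shadow {A} \<subseteq> ?S \<union> (\<lambda>a. A - {a}) ` N A"
    proof
      fix X assume "X \<in> shadow {A}"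
      then obtain a where a: "a \<in> A" "X = A - {a}" by (auto simp: shadow_def)
      show "X \<in> ?S \<union> (\<lambda>a. A - {a}) ` N A"
      proof (cases "a \<in> N A")
        case False
        have "\<exists>x<a. x mod R \<in> C \<and> x mod R \<notin> ?col (A - {a})"
        proof (cases "a < R")
          case True
          then obtain c where "c \<in> C" "c < a" "c \<notin> ?col A" using False a by (auto simp: N_def)
          then show ?thesis using modC by (intro exI [of _ c]) auto
        next
          case False
          have "a mod R \<in> C" using rainbowD(3) [OF A(1) a(1)] .
          moreover have "a mod R \<notin> ?col (A - {a})" using rainbowD(4) [OF A(1) _ a(1)] by auto
          moreover have "a mod R < a" using calculation(1) C False
            by (metis lessThan_iff linorder_not_le order_less_le_trans subsetD)
          ultimately show ?thesis by (intro exI [of _ "a mod R"]) simp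
        qed
        then obtain x where x: "x < a" "x mod R \<in> C" "x mod R \<notin> ?col (A - {a})" by blast
        let ?D = "insert x (A - {a})"
        have D: "?D \<in> ?P" "set_encode ?D < set_encode A" using lower [OF A(1) a(1) x] by auto
        have "?D \<in> \<F>" using first [OF D(1)] D(2) by auto
        moreover have "?D \<noteq> B" using D(2) AB by auto
        moreover have "X = ?D - {x}" using x a by auto
        ultimately have "X \<in> ?S" unfolding shadow_def by blast
        then show ?thesis by simp
      qed (use a in auto)
    qed
    \<comment> \<open>Another member above \<open>B - {x}\<close> would precede \<open>B\<close>, so
      it would add some \<open>d < x\<close>. This \<open>d\<close> is its own colour, and
      \<open>x \<in> N B\<close> says that \<open>B\<close> uses that colour, at a vertex other than
      \<open>x\<close>.\<close>
    have lost: "(\<lambda>x. B - {x}) ` N B \<subseteq> shadow \<F> - ?S"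
    proof
      fix X assume "X \<in> (\<lambda>x. B - {x}) ` N B"
      then obtain x where x: "x \<in> N B" "X = B - {x}" by auto
      then have xB: "x \<in> B" "x < R" by (auto simp: N_def)
      have "X \<in> shadow \<F>" using x xB B by (auto simp: shadow_def)
      moreover have "X \<notin> ?S"
      proof
        assume "X \<in> ?S"
        then obtain D d where D: "D \<in> \<F>" "D \<noteq> B" "d \<in> D" "B - {x} = D - {d}"
          using x(2) by (auto simp: shadow_def)
        have DP: "D \<in> ?P" using D \<F> by auto
        have "d \<noteq> x" using D xB by (metis insert_Diff)
        have "set_encode (D - {d}) + 2 ^ d \<le> set_encode (B - {x}) + 2 ^ x"
          using last [OF D(1)] set_encode_remove [OF finP [OF DP] D(3)]
            set_encode_remove [OF finP [OF BP] xB(1)] by simp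
        then have "(2::nat) ^ d \<le> 2 ^ x" using D(4) by simp
        then have "d < x" using \<open>d \<noteq> x\<close> by simp
        then have dm: "d mod R = d" "d \<in> C" using xB rainbowD(3) [OF DP D(3)] by auto
        then have "d \<in> ?col B" using x(1) \<open>d < x\<close> by (auto simp: N_def)
        then obtain w where w: "w \<in> B" "w mod R = d" by auto
        show False
        proof (cases "w = x")
          case True then show False using w xB \<open>d < x\<close> by simp
        next
          case False
          then have "w \<in> D - {d}" using w D(4) by auto
          then show False using rainbowD(4) [OF DP, of w d] w(2) dm D(3) by auto
        qed
      qed
      ultimately show "X \<in> shadow \<F> - ?S" by simp
    qed
    have finN: "finite (N X)" if "X \<in> ?P" for X using finP [OF that] by (auto simp: N_def)
    have "shadow ?G = ?S \<union> shadow {A}" unfolding shadow_def by blast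
    then have "shadow ?G \<subseteq> ?S \<union> (\<lambda>a. A - {a}) ` N A" using new by blast
    then have "card (shadow ?G) \<le> card (?S \<union> (\<lambda>a. A - {a}) ` N A)"
      using fsh finN [OF A(1)] by (intro card_mono) auto
    also have "\<dots> \<le> card ?S + card (N A)"
      using card_Un_le [of ?S "(\<lambda>a. A - {a}) ` N A"] card_image_le [OF finN [OF A(1)]]
      by (meson add_left_mono le_trans)
    also have "\<dots> \<le> card ?S + card (N B)" using True by simp
    also have "card (N B) = card ((\<lambda>x. B - {x}) ` N B)"
      by (rule card_image [symmetric]) (auto simp: inj_on_def N_def)
    also have "card ?S + \<dots> = card (?S \<union> (\<lambda>x. B - {x}) ` N B)"
      using lost fsh finN [OF BP] by (intro card_Un_disjoint [symmetric]) auto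
    also have "\<dots> \<le> card (shadow \<F>)"
    proof (rule card_mono [OF fsh(1)])
      have "?S \<subseteq> shadow \<F>" unfolding shadow_def by blast
      then show "?S \<union> (\<lambda>x. B - {x}) ` N B \<subseteq> shadow \<F>" using lost by blast
    qed
    finally have "card (shadow ?G) \<le> card (shadow \<F>)" .
    moreover have "weight ?G < weight \<F>" "card ?G = card \<F>"
      using weight_exchange [OF \<F>(1) B A(2) AB] by auto
    ultimately show ?thesis using \<F> A(1) by (intro exI [of _ ?G]) auto
  next
    case False
    have finN: "finite (N A)" "finite (N B)" using finP A(1) BP by (auto simp: N_def)
    \<comment> \<open>If \<open>a\<close> is not \<open>\<beta>\<close>, all elements of
      \<open>B\<close> except \<open>b\<close> are colours below \<open>a\<close>, since a larger
      one could be exchanged for \<open>a\<close> against \<open>mid\<close>. Counting makes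
      \<open>B - {b}\<close> the set of all colours below \<open>a\<close>. Then \<open>N A\<close>
      has at most one element while \<open>N B\<close> contains \<open>B - {b}\<close>, contrary to
      the case assumption.\<close>
    have only: "a = \<beta>" if a: "a \<in> N A" for a
    proof (rule ccontr)
      assume "a \<noteq> \<beta>"
      have aA: "a \<in> A" "a < R" and acol: "\<And>c. c \<in> C \<Longrightarrow> c < a \<Longrightarrow> c \<in> ?col A"
        using a by (auto simp: N_def)
      have aC: "a mod R = a" "a \<in> C" using aA rainbowD(3) [OF A(1) aA(1)] by auto
      have low: "x \<le> a" if "x \<in> B" "x \<noteq> b" "a \<notin> ?col (B - {x})" for x
      proof (rule ccontr)
        assume "\<not> x \<le> a"
        then show False
          using mid [of "insert a (B - {x})" a] lower [OF BP that(1), of a] that aC b aA by auto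
      qed
      have aB: "a \<notin> ?col B"
      proof
        assume "a \<in> ?col B"
        then obtain y where y: "y \<in> B" "y mod R = a" by auto
        have "a \<notin> ?col (B - {y})" using rainbowD(4) [OF BP] y by auto
        moreover have "y \<noteq> b" using y \<open>a \<noteq> \<beta>\<close> by (auto simp: \<beta>_def)
        ultimately have "y \<le> a" using low y(1) by blast
        then have "y = a" using y(2) mod_less_eq_dividend [of y R] by simp
        then show False using y aA disj by auto
      qed
      define L where "L = {c \<in> C. c < a}"
      have BL: "B - {b} \<subseteq> L"
      proof
        fix x assume x: "x \<in> B - {b}"
        then have "x \<le> a" using low aB by auto
        moreover have "x \<noteq> a" using x aA disj by auto
        ultimately show "x \<in> L" using rainbowD(3) [OF BP, of x] x aA by (auto simp: L_def)
      qed
      have finL: "finite L" by (simp add: L_def)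
      have LA: "insert a L \<subseteq> ?col A" using acol aA aC by (force simp: L_def)
      have "a \<notin> L" by (simp add: L_def)
      have cardA: "card (?col A) = Suc (Suc j)" using rainbow_card_colours [OF A(1)] .
      have cardB: "card (B - {b}) = Suc j" using rainbow_card [OF BP] b finP [OF BP] by simp
      have "card (insert a L) \<le> Suc (Suc j)" using card_mono [OF _ LA] finP [OF A(1)] cardA by simp
      then have cardL: "card L = Suc j"
        using \<open>a \<notin> L\<close> finL card_mono [OF finL BL] cardB by simp
      have LB: "L = B - {b}" using card_subset_eq [OF finL BL] cardL cardB by simp
      have colA: "?col A = insert a L"
        using card_subset_eq [OF _ LA] finP [OF A(1)] cardA cardL \<open>a \<notin> L\<close> finL by simp
      have "N A \<subseteq> {a}"
      proof
        fix x assume x: "x \<in> N A"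
        then have "x \<in> A" "x mod R = x" by (auto simp: N_def)
        then have "x \<in> insert a L" using colA by force
        then show "x \<in> {a}" using LB \<open>x \<in> A\<close> disj by auto
      qed
      then have "card (N A) \<le> 1" using card_mono [of "{a}" "N A"] by simp
      moreover have "B - {b} \<subseteq> N B"
      proof
        fix x assume x: "x \<in> B - {b}"
        then have xL: "x \<in> L" using LB by simp
        then have "c \<in> ?col B" if "c \<in> C" "c < x" for c
          using that LB modC by (intro image_eqI [of _ _ c]) (auto simp: L_def)
        then show "x \<in> N B" using x xL aA by (auto simp: N_def L_def)
      qed
      then have "Suc j \<le> card (N B)" using card_mono [OF finN(2)] cardB by metis
      ultimately show False using False by simp
    qed
    then have "card (N A) \<le> 1" using card_mono [of "{\<beta>}" "N A"] by auto
    then have "card (N A) = 1" "card (N B) = 0" using False by auto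
    then have NB: "N B = {}" and "N A \<noteq> {}" using finN by auto
    then have "\<beta> \<in> N A" using only by auto
    then have \<beta>A: "\<beta> \<in> A" "\<beta> < R" by (auto simp: N_def)
    then have \<beta>m: "\<beta> mod R = \<beta>" by simp
    have colA: "?col A = C"
    proof (rule ccontr)
      assume "?col A \<noteq> C"
      moreover have sub: "?col A \<subseteq> C" using rainbowD(3) [OF A(1)] by auto
      ultimately obtain c where c: "c \<in> C" "c \<notin> ?col A" by auto
      have finC: "finite C" using C finite_subset by auto
      have "status R c A = {}" using c by (auto simp: status_def)
      then have "status R c B \<noteq> {}" using diff [OF c(1)] by auto
      then obtain y where y: "y \<in> B" "y mod R = c" by (auto simp: status_def)
      have "c \<noteq> \<beta>" using c(2) \<beta>A \<beta>m by force
      then have "y \<noteq> b" using y by (auto simp: \<beta>_def)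
      have cy: "c \<notin> ?col (B - {y})" using rainbowD(4) [OF BP] y by auto
      have nog: False if g: "g \<in> C" "g \<notin> ?col B" "g < y" for g
      proof (rule mid' [of "insert g (B - {y})" c])
        have "g mod R \<notin> ?col (B - {y})" using g modC by auto
        then show "insert g (B - {y}) \<in> ?P" "set_encode (insert g (B - {y})) \<le> set_encode B"
          using lower [OF BP y(1) g(3)] g modC by (auto intro: less_imp_le)
        show "c \<notin> ?col (insert g (B - {y}))" using cy g y modC by auto
      qed (use b \<open>y \<noteq> b\<close> c in auto)
      have "card (?col B) < card C"
        using rainbow_card_colours [OF A(1)] rainbow_card_colours [OF BP]
          psubset_card_mono [OF finC, of "?col A"] sub \<open>?col A \<noteq> C\<close> by auto
      then have "\<not> C \<subseteq> ?col B" using card_mono [of "?col B" C] finP [OF BP] by auto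
      then obtain g where g: "g \<in> C" "g \<notin> ?col B" by auto
      have "y < R" using nog [OF g] g(1) C
          by (meson lessThan_iff linorder_not_le order_less_le_trans subsetD)
      moreover have "c' \<in> ?col B" if "c' \<in> C" "c' < y" for c' using nog that by blast
      ultimately have "y \<in> N B" using y by (auto simp: N_def)
      then show False using NB by simp
    qed
    have finC: "finite C" using C finite_subset by auto
    have colB: "?col B = C"
      using card_subset_eq [OF finC, of "?col B"] rainbowD(3) [OF BP] rainbow_card_colours [OF BP]
        rainbow_card_colours [OF A(1)] colA by auto
    have "card (B - {b}) = Suc j" using rainbow_card [OF BP] b finP [OF BP] by simp
    then obtain y where y: "y \<in> B" "y \<noteq> b"
        by (metis Diff_iff card.empty ex_in_conv insertCI nat.distinct(1))
    define c where "c = y mod R"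
    have cC: "c \<in> C" using rainbowD(3) [OF BP y(1)] by (simp add: c_def)
    then obtain u where u: "u \<in> A" "u mod R = c" using colA by auto
    have cb: "c \<noteq> \<beta>" using rainbowD(4) [OF BP y(1) b] y(2) by (auto simp: c_def \<beta>_def)
    have cBy: "c \<notin> ?col (B - {y})" using rainbowD(4) [OF BP _ y(1)] by (auto simp: c_def)
    have "u \<noteq> y" using u y disj by auto
    moreover have "\<not> u < y"
      using mid [of "insert u (B - {y})" u] lower [OF BP y(1), of u] u cC cBy b y by auto
    ultimately have yu: "y < u" by simp
    \<comment> \<open>Both sets now use all colours, and exchanging \<open>B\<close> for \<open>A\<close> alone may enlarge the shadow.
      Exchanging the block \<open>V\<close> for \<open>W\<close> adds only \<open>A - {\<beta>}\<close> to the shadow and removes \<open>B - {y}\<close>.\<close>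
    define Y where "Y = {y'. y' mod R = c \<and> y' \<le> y}"
    define Z where "Z = {z. z mod R = \<beta> \<and> z < b}"
    define V where "V = (\<lambda>y'. insert y' (B - {y})) ` Y"
    define W0 where "W0 = (\<lambda>z. insert z (A - {\<beta>})) ` Z"
    have finYZ: "finite Y" "finite Z" by (auto simp: Y_def Z_def)
    have Rpos: "R > 0" using \<beta>A by simp
    \<comment> \<open>From \<open>y < u < b\<close>, with \<open>y\<close> and \<open>u\<close> of
      the same colour, \<open>y\<close> lies in an earlier block of \<open>R\<close> consecutive
      numbers than \<open>b\<close>. Changing the colour to \<open>\<beta>\<close> inside each block
      therefore maps \<open>Y\<close> into \<open>Z\<close>.\<close>
    have "card Y \<le> card Z"
    proof (rule card_inj_on_le)
      let ?f = "\<lambda>y'. (y' div R) * R + \<beta>"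
      show "inj_on ?f Y"
      proof (rule inj_onI)
        fix v w assume vw: "v \<in> Y" "w \<in> Y" "?f v = ?f w"
        then have "v div R = w div R" using Rpos by simp
        moreover have "v mod R = w mod R" using vw by (simp add: Y_def)
        ultimately show "v = w" by (metis div_mult_mod_eq)
      qed
      show "?f ` Y \<subseteq> Z"
      proof
        fix z assume "z \<in> ?f ` Y"
        then obtain y' where y': "y' \<in> Y" "z = ?f y'" by auto
        have "y' div R \<le> y div R" using y' by (simp add: Y_def div_le_mono)
        also have "\<dots> < u div R"
        proof -
          have "y div R \<le> u div R" using yu by (simp add: div_le_mono)
          moreover have "y div R \<noteq> u div R" using yu u(2) c_def
              by (metis div_mult_mod_eq nat_less_le)
          ultimately show ?thesis by simp
        qed
        also have "\<dots> \<le> b div R" using Ab [OF u(1)] by (simp add: div_le_mono)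
        finally have "(y' div R) * R < (b div R) * R" using Rpos by simp
        then have "y' div R * R + b mod R < b div R * R + b mod R" by (rule add_strict_right_mono)
        then have "z < b" unfolding y'(2) \<beta>_def div_mult_mod_eq .
        then show "z \<in> Z" using y'(2) \<beta>m by (simp add: Z_def)
      qed
    qed (rule finYZ)
    moreover have "card V = card Y"
      unfolding V_def
    proof (rule card_image, rule inj_onI)
      fix v w assume vw: "v \<in> Y" "w \<in> Y" "insert v (B - {y}) = insert w (B - {y})"
      have "x \<notin> B - {y}" if "x \<in> Y" for x
        using that cBy image_eqI [of c "\<lambda>v. v mod R" x "B - {y}"] by (auto simp: Y_def)
      then have "v \<notin> B - {y}" "w \<notin> B - {y}" using vw(1,2) by blast+
      then show "v = w" using vw(3) by (metis insertE insertI1)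
    qed
    moreover have zA: "z \<notin> A - {\<beta>}" if "z \<in> Z" for z
      using that rainbowD(4) [OF A(1) _ \<beta>A(1)] \<beta>m by (auto simp: Z_def)
    then have "card W0 = card Z"
      unfolding W0_def
      by (intro card_image inj_onI) (metis insertE insertI1)
    ultimately have "card V \<le> card W0" by simp
    then obtain W where W: "W \<subseteq> W0" "card W = card V" "finite W"
      by (meson obtain_subset_with_card_n)
    have cA\<beta>: "\<beta> \<notin> ?col (A - {\<beta>})" using rainbowD(4) [OF A(1) _ \<beta>A(1)] \<beta>m by auto
    have W0P: "insert z (A - {\<beta>}) \<in> ?P" if "z \<in> Z" for z
      using rainbow_exchange [OF A(1) \<beta>A(1), of z] that cA\<beta> rainbowD(3) [OF A(1) \<beta>A(1)] \<beta>m
      by (auto simp: Z_def)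
    \<comment> \<open>\<open>D\<close> is not earlier than \<open>A\<close> and shares with it the
      vertex \<open>u\<close> of colour \<open>c\<close>, so by stability its membership would give
      that of \<open>A\<close>.\<close>
    have W0F: "D \<notin> \<F>" if D: "D \<in> W0" for D
    proof
      assume DF: "D \<in> \<F>"
      obtain z where z: "z \<in> Z" "D = insert z (A - {\<beta>})" using D by (auto simp: W0_def)
      have DP: "D \<in> ?P" using DF \<F> by auto
      have "\<beta> \<le> z" using z(1) mod_less_eq_dividend [of z R] by (auto simp: Z_def)
      then have "(2::nat) ^ \<beta> \<le> 2 ^ z" by simp
      then have le: "set_encode A \<le> set_encode D"
        using z(2) set_encode_remove [OF finP [OF A(1)] \<beta>A(1)]
          set_encode_add [of "A - {\<beta>}" z] zA [OF z(1)] finP [OF A(1)] by simp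
      have "u \<in> D" using u z cb \<beta>m by auto
      then have "status R c A = status R c D"
        using status_eq_singleton [OF A(1) u(1)] status_eq_singleton [OF DP] u(2) by auto
      then show False using compressed [OF A(1) DF le cC] A(2) by simp
    qed
    have VF: "D \<in> \<F>" "b \<in> D" if D: "D \<in> V" for D
    proof -
      obtain y' where y': "y' \<in> Y" "D = insert y' (B - {y})" using D by (auto simp: V_def)
      show "b \<in> D" using y' y b by auto
      show "D \<in> \<F>"
      proof (cases "y' = y")
        case True then show ?thesis using y' y B by (simp add: insert_absorb)
      next
        case False
        then have "y' < y" using y' by (simp add: Y_def)
        then have "D \<in> ?P" "set_encode D < set_encode B"
          using lower [OF BP y(1), of y'] y' cC cBy by (auto simp: Y_def)
        then show ?thesis using bD \<open>b \<in> D\<close> by simp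
      qed
    qed
    define \<G> where "\<G> = (\<F> - V) \<union> W"
    let ?S = "shadow (\<F> - V)"
    have finV: "finite V" using finYZ by (simp add: V_def)
    have VsubF: "V \<subseteq> \<F>" using VF by auto
    have WF: "W \<inter> \<F> = {}" using W W0F by auto
    have "y \<in> Y" by (simp add: Y_def c_def)
    then have Vne: "V \<noteq> {}" by (auto simp: V_def)
    have "card \<G> = card (\<F> - V) + card W"
      unfolding \<G>_def using \<F>(1) W WF by (intro card_Un_disjoint) auto
    then have cG: "card \<G> = card \<F>"
      using W(2) VsubF finV \<F>(1) card_mono [OF \<F>(1) VsubF] by (simp add: card_Diff_subset)
    \<comment> \<open>The members of \<open>V\<close> contain \<open>b\<close>, whereas those of
      \<open>W\<close> consist of vertices below \<open>b\<close> and have encodings less than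
      \<open>2 ^ b\<close>.\<close>
    have wG: "weight \<G> < weight \<F>"
    proof -
      have "weight W < (\<Sum>D\<in>W. 2 ^ b)"
        unfolding weight_def
      proof (rule sum_strict_mono)
        fix D assume "D \<in> W"
        then obtain z where "z \<in> Z" "D = insert z (A - {\<beta>})" using W by (auto simp: W0_def)
        then show "set_encode D < 2 ^ b" using Ab
            by (intro set_encode_less_power) (auto simp: Z_def)
      qed (use W(2,3) Vne finV in auto)
      also have "\<dots> = (\<Sum>D\<in>V. 2 ^ b)" using W(2) by simp
      also have "\<dots> \<le> weight V"
        unfolding weight_def
      proof (rule sum_mono)
        fix D assume "D \<in> V"
        then show "2 ^ b \<le> set_encode D" using VF [of D] finP \<F>(2)
            by (intro power_le_set_encode) auto
      qed
      finally have "weight W < weight V" .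
      moreover have "weight \<F> = weight (\<F> - V) + weight V"
        unfolding weight_def using VsubF \<F>(1) by (simp add: sum.subset_diff)
      moreover have "weight \<G> = weight (\<F> - V) + weight W"
        unfolding weight_def \<G>_def using \<F>(1) W WF by (intro sum.union_disjoint) auto
      ultimately show ?thesis by simp
    qed
    have newG: "shadow \<G> \<subseteq> insert (A - {\<beta>}) ?S"
    proof
      fix X assume "X \<in> shadow \<G>"
      then obtain D d where D: "D \<in> \<G>" "d \<in> D" "X = D - {d}" by (auto simp: shadow_def)
      show "X \<in> insert (A - {\<beta>}) ?S"
      proof (cases "D \<in> \<F> - V")
        case True then show ?thesis using D by (auto simp: shadow_def)
      next
        case False
        then have "D \<in> W0" using D W by (auto simp: \<G>_def)
        then obtain z where z: "z \<in> Z" "D = insert z (A - {\<beta>})" by (auto simp: W0_def)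
        show ?thesis
        proof (cases "d = z")
          case True then show ?thesis using z D zA [OF z(1)] by auto
        next
          case False
          then have d: "d \<in> A" "d \<noteq> \<beta>" using z D by auto
          have DP: "D \<in> ?P" using W0P z by simp
          have "d mod R \<in> C" using rainbowD(3) [OF A(1) d(1)] .
          then obtain x where x: "x \<in> B" "x mod R = d mod R" using colB by (metis image_iff)
          have "d mod R \<noteq> \<beta>" using rainbowD(4) [OF A(1) d(1) \<beta>A(1)] d(2) \<beta>m by auto
          then have "x \<noteq> b" using x by (auto simp: \<beta>_def)
          have dm: "d mod R \<notin> ?col (D - {d})" using rainbowD(4) [OF DP _ D(2)] by auto
          \<comment> \<open>The deleted \<open>d\<close> is replaced by the vertex of
            \<open>B\<close> of the same colour. The result avoids \<open>b\<close>, precedes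
            \<open>B\<close> and agrees with it in this colour, hence is a member outside
            \<open>V\<close>.\<close>
          let ?E = "insert x (D - {d})"
          have E: "?E \<in> ?P" using rainbow_exchange [OF DP D(2), of x] x \<open>d mod R \<in> C\<close> dm by simp
          have "v < b" if "v \<in> ?E" for v
            using that z Ab bmax [OF x(1)] \<open>x \<noteq> b\<close> by (auto simp: Z_def)
          then have Eb: "set_encode ?E < set_encode B" "b \<notin> ?E"
            using set_encode_less [OF finP [OF BP] b] by blast+
          have "status R (x mod R) ?E = status R (x mod R) B"
            using status_eq_singleton [OF E, of x] status_eq_singleton [OF BP x(1)] by simp
          then have "?E \<in> \<F>" using compressed [OF E B _ rainbowD(3) [OF BP x(1)]] Eb by simp
          moreover have "?E \<notin> V" using VF(2) Eb(2) by blast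
          moreover have "x \<notin> D - {d}"
            using dm x(2) image_eqI [of "d mod R" "\<lambda>v. v mod R" x "D - {d}"] by auto
          then have "X = ?E - {x}" using D(3) by auto
          ultimately have "X \<in> ?S" unfolding shadow_def by blast
          then show ?thesis by simp
        qed
      qed
    qed
    have "B - {y} \<in> shadow \<F>" using B y by (auto simp: shadow_def)
    \<comment> \<open>All colours of \<open>C\<close> occur in \<open>B\<close>, so only a vertex of
      colour \<open>c\<close> can be added to \<open>B - {y}\<close>, and it is at most
      \<open>y\<close> because \<open>B\<close> is the last member. All such sets belong to
      \<open>V\<close>.\<close>
    moreover have "B - {y} \<notin> ?S"
    proof
      assume "B - {y} \<in> ?S"
      then obtain D d where D: "D \<in> \<F>" "D \<notin> V" "d \<in> D" "B - {y} = D - {d}"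
        by (auto simp: shadow_def)
      have DP: "D \<in> ?P" using D \<F> by auto
      have "set_encode (D - {d}) + 2 ^ d \<le> set_encode (B - {y}) + 2 ^ y"
        using last [OF D(1)] set_encode_remove [OF finP [OF DP] D(3)]
          set_encode_remove [OF finP [OF BP] y(1)] by simp
      then have "(2::nat) ^ d \<le> 2 ^ y" using D(4) by simp
      then have dy: "d \<le> y" by simp
      have "d mod R \<notin> ?col (B - {y})" unfolding D(4) using rainbowD(4) [OF DP _ D(3)] by auto
      moreover have "d mod R \<in> ?col B" using rainbowD(3) [OF DP D(3)] colB by simp
      then obtain w where w: "w \<in> B" "w mod R = d mod R" by auto
      ultimately have "w = y" using image_eqI [of "d mod R" "\<lambda>v. v mod R" w "B - {y}"] by auto
      then have "d mod R = c" using w(2) by (simp add: c_def)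
      then have "d \<in> Y" using dy by (simp add: Y_def)
      moreover have "D = insert d (B - {y})" using D by auto
      ultimately show False using D(2) by (auto simp: V_def)
    qed
    ultimately have "card (insert (B - {y}) ?S) \<le> card (shadow \<F>)"
      using fsh by (intro card_mono) (auto simp: shadow_def)
    then have "Suc (card ?S) \<le> card (shadow \<F>)" using \<open>B - {y} \<notin> ?S\<close> fsh by simp
    moreover have "card (shadow \<G>) \<le> card (insert (A - {\<beta>}) ?S)"
      using newG fsh by (intro card_mono) auto
    moreover have "card (insert (A - {\<beta>}) ?S) \<le> Suc (card ?S)" by (rule card_insert_le_m1) auto
    ultimately have "card (shadow \<G>) \<le> card (shadow \<F>)" by linarith
    moreover have "finite \<G>" "\<G> \<subseteq> ?P"
      using \<F> W W0P by (auto simp: \<G>_def W0_def)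
    ultimately show ?thesis using cG wG by blast
  qed
qed

text \<open>The outer induction on the number of colours serves \<open>compression\<close>, the
  inner one is on the weight. A family with a section that is not initial is compressed; if all
  sections are initial, the family meets the stability hypothesis of \<open>exchange_step\<close>.
  Families of singletons are treated apart, as their shadows are at most
  \<open>{{}}\<close>.\<close>

theorem coloured_Kruskal_Katona:
  assumes "C \<subseteq> {..<R}"
  shows "shadow_minimal R C"
  using assms
proof (induction "card C" arbitrary: C rule: less_induct)
  case less
  note C_prems = less.prems and C_hyps = less.hyps
  have finC: "finite C" using less.prems finite_subset by auto
  have ex: "\<exists>\<I>. initial R C (Suc k) \<I> \<and> card \<I> = card \<F> \<and> card (shadow \<I>) \<le> card (shadow \<F>)"
    if "finite \<F>" "\<F> \<subseteq> rainbow R C (Suc k)" for k \<F>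
    using that
  proof (induction "weight \<F>" arbitrary: \<F> rule: less_induct)
    case (less \<F>)
    note W_prems = less.prems and W_hyps = less.hyps
    show ?case
    proof (cases "initial R C (Suc k) \<F>")
      case False
      have "\<exists>\<G>. finite \<G> \<and> \<G> \<subseteq> rainbow R C (Suc k) \<and> card \<G> = card \<F> \<and>
        card (shadow \<G>) \<le> card (shadow \<F>) \<and> weight \<G> < weight \<F>"
      proof (cases k)
        case 0
        obtain \<I> where I: "initial R C (Suc 0) \<I>" "card \<I> = card \<F>" "weight \<I> < weight \<F>"
          using initial_exists [OF W_prems] False 0 by auto
        then have Isub: "finite \<I>" "\<I> \<subseteq> rainbow R C (Suc 0)" by (auto simp: initial_def)
        have empty: "shadow \<H> \<subseteq> {{}}" if "\<H> \<subseteq> rainbow R C (Suc 0)" for \<H>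
          using rainbow_remove [of _ R C 0] that rainbow_0 by (auto simp: shadow_def)
        have "\<F> \<noteq> {}" using False by (auto simp: initial_def)
        then obtain A where "A \<in> \<F>" by auto
        moreover have "card A = Suc 0" using rainbow_card calculation W_prems(2) 0 by blast
        then obtain a where "a \<in> A" by fastforce
        ultimately have "shadow \<F> \<noteq> {}" by (auto simp: shadow_def)
        then have "shadow \<F> = {{}}" using empty [of \<F>] W_prems(2) 0 by auto
        then have "card (shadow \<I>) \<le> card (shadow \<F>)"
          using empty [OF Isub(2)] card_mono [of "{{}}" "shadow \<I>"] by simp
        then show ?thesis using Isub I 0 by blast
      next
        case (Suc j)
        show ?thesis
        proof (cases "\<forall>c\<in>C. initial R (C - {c}) (Suc (Suc j)) (colour_deletion R c \<F>) \<and>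
            (\<forall>w\<in>{w \<in> \<Union>\<F>. w mod R = c}. initial R (C - {c}) (Suc j) (vertex_link w \<F>))")
          case False
          then obtain c where c: "c \<in> C"
            "\<not> (initial R (C - {c}) (Suc (Suc j)) (colour_deletion R c \<F>) \<and>
            (\<forall>w\<in>{w \<in> \<Union>\<F>. w mod R = c}. initial R (C - {c}) (Suc j) (vertex_link w \<F>)))" by blast
          have "shadow_minimal R (C - {c})"
            using C_hyps [of "C - {c}"] C_prems c(1) finC
            by (metis Diff_subset card_Diff1_less subset_trans)
          from compression [OF \<open>C \<subseteq> {..<R}\<close> c(1) this W_prems(1), of j] W_prems(2) c(2) Suc
          show ?thesis by blast
        next
          case True
          show ?thesis
            unfolding Suc
          proof (rule exchange_step [OF \<open>C \<subseteq> {..<R}\<close> W_prems(1)])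
            show "\<F> \<subseteq> rainbow R C (Suc (Suc j))" "\<not> initial R C (Suc (Suc j)) \<F>"
              using W_prems(2) False Suc by auto
            fix A B c
            assume A: "A \<in> rainbow R C (Suc (Suc j))" and B: "B \<in> \<F>" and
              le: "set_encode A \<le> set_encode B" and c: "c \<in> C" and eq: "status R c A = status R c B"
            have BP: "B \<in> rainbow R C (Suc (Suc j))" using B W_prems(2) Suc by auto
            show "A \<in> \<F>"
            proof (cases "status R c B = {}")
              case True
              have "A \<in> rainbow R (C - {c}) (Suc (Suc j))"
                using A eq True by (auto simp: status_def rainbow_def)
              moreover have "B \<in> colour_deletion R c \<F>" using B True
                  by (auto simp: status_def colour_deletion_def)
              moreover have "initial R (C - {c}) (Suc (Suc j)) (colour_deletion R c \<F>)"
                using \<open>\<forall>c\<in>C. _\<close> c by blast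
              ultimately have "A \<in> colour_deletion R c \<F>" using le unfolding initial_def by blast
              then show ?thesis by (simp add: colour_deletion_def)
            next
              case False
              then obtain w where w: "w \<in> B" "w mod R = c" by (auto simp: status_def)
              then have wA: "w \<in> A" using eq by (auto simp: status_def)
              have "A - {w} \<in> rainbow R (C - {c}) (Suc j)"
                using rainbow_remove_colour [OF A wA] w by simp
              moreover have "B - {w} \<in> vertex_link w \<F>" using B w
                  by (simp add: vertex_link_def insert_absorb)
              moreover have "initial R (C - {c}) (Suc j) (vertex_link w \<F>)"
                using \<open>\<forall>c\<in>C. _\<close> c B w by blast
              moreover have "set_encode (A - {w}) \<le> set_encode (B - {w})"
                using le set_encode_remove [OF rainbow_finite [OF A] wA]
                  set_encode_remove [OF rainbow_finite [OF BP] w(1)] by simp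
              ultimately have "A - {w} \<in> vertex_link w \<F>" unfolding initial_def by blast
              then show ?thesis using wA by (simp add: vertex_link_def insert_absorb)
            qed
          qed
        qed
      qed
      then obtain \<G> where G: "finite \<G>" "\<G> \<subseteq> rainbow R C (Suc k)" "card \<G> = card \<F>"
        "card (shadow \<G>) \<le> card (shadow \<F>)" "weight \<G> < weight \<F>" by blast
      then obtain \<I> where "initial R C (Suc k) \<I>" "card \<I> = card \<G>"
        "card (shadow \<I>) \<le> card (shadow \<G>)"
        using W_hyps [of \<G>] by blast
      then show ?thesis using G by (intro exI [of _ \<I>]) auto
    qed auto
  qed
  show ?case
    unfolding shadow_minimal_def
  proof (intro allI impI, elim conjE)
    fix k and \<F> \<I> :: "nat set set"
    assume a: "finite \<F>" "\<F> \<subseteq> rainbow R C (Suc k)" "initial R C (Suc k) \<I>" "card \<I> = card \<F>"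
    then obtain \<J> where J: "initial R C (Suc k) \<J>" "card \<J> = card \<F>"
      "card (shadow \<J>) \<le> card (shadow \<F>)" using ex by blast
    then have "\<I> = \<J>" using initial_chain [OF a(3) J(1)] initial_chain [OF J(1) a(3)] a(4) by auto
    then show "card (shadow \<I>) \<le> card (shadow \<F>)" using J by simp
  qed
qed

subsection \<open>Clique vectors of graphs\<close>

definition cliques :: "('a \<Rightarrow> 'a \<Rightarrow> bool) \<Rightarrow> 'a set \<Rightarrow> 'a set set" where
  "cliques E X = {\<sigma>. \<sigma> \<subseteq> X \<and> (\<forall>u\<in>\<sigma>. \<forall>v\<in>\<sigma>. u \<noteq> v \<longrightarrow> E u v)}"

definition clique_num :: "('a \<Rightarrow> 'a \<Rightarrow> bool) \<Rightarrow> 'a set \<Rightarrow> nat \<Rightarrow> nat" where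
  "clique_num E X k = card {\<sigma> \<in> cliques E X. card \<sigma> = k}"

lemma cliques_mono: "X \<subseteq> Y \<Longrightarrow> cliques E X \<subseteq> cliques E Y"
  by (auto simp: cliques_def)

lemma finite_cliques: "finite X \<Longrightarrow> finite (cliques E X)"
  by (rule finite_subset [of _ "Pow X"]) (auto simp: cliques_def)

lemma clique_num_mono: "finite Y \<Longrightarrow> X \<subseteq> Y \<Longrightarrow> clique_num E X k \<le> clique_num E Y k"
  unfolding clique_num_def using cliques_mono [of X Y E] finite_cliques [of Y E]
  by (intro card_mono) auto

lemma clique_num_0: "finite X \<Longrightarrow> clique_num E X 0 = 1"
proof -
  assume "finite X"
  then have "{\<sigma> \<in> cliques E X. card \<sigma> = 0} = {{}}"
    by (auto simp: cliques_def dest: finite_subset)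
  then show ?thesis by (simp add: clique_num_def)
qed

lemma cliques_insert:
  assumes "v \<notin> X" "symp E"
  shows "cliques E (insert v X) = cliques E X \<union> insert v ` cliques E {w \<in> X. E v w}"
proof
  show "cliques E (insert v X) \<subseteq> cliques E X \<union> insert v ` cliques E {w \<in> X. E v w}"
  proof
    fix \<sigma> assume \<sigma>: "\<sigma> \<in> cliques E (insert v X)"
    show "\<sigma> \<in> cliques E X \<union> insert v ` cliques E {w \<in> X. E v w}"
    proof (cases "v \<in> \<sigma>")
      case True
      then have "\<sigma> - {v} \<in> cliques E {w \<in> X. E v w}" "\<sigma> = insert v (\<sigma> - {v})"
        using \<sigma> by (auto simp: cliques_def)
      then show ?thesis by blast
    qed (use \<sigma> in \<open>auto simp: cliques_def\<close>)
  qed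
  show "cliques E X \<union> insert v ` cliques E {w \<in> X. E v w} \<subseteq> cliques E (insert v X)"
    using sympD [OF assms(2)] by (auto simp: cliques_def)
qed

lemma clique_num_insert:
  assumes "finite X" "v \<notin> X" "symp E"
  shows "clique_num E (insert v X) (Suc k) = clique_num E X (Suc k) + clique_num E {w \<in> X. E v w} k"
proof -
  let ?A = "{\<sigma> \<in> cliques E X. card \<sigma> = Suc k}" and ?L = "{\<sigma> \<in> cliques E {w \<in> X. E v w}. card \<sigma> = k}"
  have fin: "finite \<sigma>" "v \<notin> \<sigma>" if "\<sigma> \<in> cliques E X" for \<sigma>
    using that assms finite_subset by (auto simp: cliques_def)
  have L: "\<sigma> \<in> cliques E X" if "\<sigma> \<in> cliques E {w \<in> X. E v w}" for \<sigma>
    using that cliques_mono [of "{w \<in> X. E v w}" X E] by auto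
  have "{\<sigma> \<in> cliques E (insert v X). card \<sigma> = Suc k} = ?A \<union> insert v ` ?L"
    unfolding cliques_insert [OF assms(2,3)] using fin L by auto
  moreover have "?A \<inter> insert v ` ?L = {}" using fin(2) by auto
  moreover have "card (insert v ` ?L) = card ?L"
    using fin L by (intro card_image inj_onI) (metis (mono_tags, lifting) insert_ident
        mem_Collect_eq)
  ultimately show ?thesis
    using assms(1) finite_cliques [of X E] finite_cliques [of "{w \<in> X. E v w}" E]
    by (simp add: clique_num_def card_Un_disjoint)
qed

text \<open>A fixed choice of \<open>k\<close> colours is translated by multiples of
  \<open>R\<close>. Hence initial segments of every cardinality exist.\<close>

lemma infinite_rainbow:
  assumes "C \<subseteq> {..<R}" "0 < k" "k \<le> card C"
  shows "infinite (rainbow R C k)"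
proof -
  obtain K where K: "K \<subseteq> C" "card K = k" "finite K"
    using obtain_subset_with_card_n [OF assms(3)] by auto
  have KR: "c < R" if "c \<in> K" for c using that K assms(1) by auto
  let ?f = "\<lambda>i::nat. (\<lambda>c. c + R * i) ` K"
  have "?f i \<in> rainbow R C k" for i
  proof (rule rainbowI)
    show "card (?f i) = k" using K by (subst card_image) (auto simp: inj_on_def)
    have m: "(c + R * i) mod R = c" if "c \<in> K" for c using KR [OF that] by simp
    show "v mod R \<in> C" if "v \<in> ?f i" for v using that m K(1) by auto
    show "v = w" if "v \<in> ?f i" "w \<in> ?f i" "v mod R = w mod R" for v w using that m by auto
  qed (use K in simp)
  moreover have "inj ?f"
  proof (rule injI)
    fix i i' assume eq: "?f i = ?f i'"
    obtain c where c: "c \<in> K" using K assms(2) by fastforce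
    then have "c + R * i \<in> ?f i'" using eq by blast
    then obtain d where d: "d \<in> K" "c + R * i = d + R * i'" by auto
    then have "(c + R * i) div R = (d + R * i') div R" by simp
    then show "i = i'" using KR [OF c] KR [OF d(1)] by simp
  qed
  ultimately show ?thesis
    using finite_subset [of "range ?f" "rainbow R C k"] finite_imageD [of ?f UNIV] by blast
qed

lemma initial_exists_card:
  assumes "C \<subseteq> {..<R}" "0 < k" "k \<le> card C \<or> n = 0"
  shows "\<exists>\<I>. initial R C k \<I> \<and> card \<I> = n"
proof (cases "n = 0")
  case True
  then show ?thesis by (intro exI [of _ "{}"]) (auto simp: initial_def)
next
  case False
  then have "infinite (rainbow R C k)" using infinite_rainbow assms by blast
  then obtain \<F> where "finite \<F>" "card \<F> = n" "\<F> \<subseteq> rainbow R C k"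
    using infinite_arbitrarily_large by blast
  then show ?thesis using initial_exists by metis
qed

lemma clique_num_eq_0:
  assumes "\<And>\<sigma>. \<sigma> \<in> cliques E X \<Longrightarrow> card \<sigma> < k"
  shows "clique_num E X k = 0"
proof -
  have "{\<sigma> \<in> cliques E X. card \<sigma> = k} = {}" using assms by auto
  then show ?thesis unfolding clique_num_def by (simp only: card.empty)
qed

lemma card_shadow_Suc_0:
  assumes "\<I> \<subseteq> rainbow R C (Suc 0)"
  shows "card (shadow \<I>) \<le> 1"
proof -
  have "shadow \<I> \<subseteq> {{}}"
    using rainbow_remove [of _ R C 0] assms rainbow_0 by (auto simp: shadow_def)
  then show ?thesis using card_mono [of "{{}}" "shadow \<I>"] by simp
qed

text \<open>Let \<open>v0\<close> be a vertex whose neighbourhood has the most \<open>k\<close>-cliques. Every clique lies in this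
  neighbourhood or contains a first vertex outside of it, so the links of the outside vertices,
  replaced by initial segments, can be glued with one common extra colour to the initial segments
  of the neighbourhood. The choice of \<open>v0\<close> makes these links fit.\<close>

theorem card_shadow_le_clique_num:
  assumes "finite X" "symp E" "C \<subseteq> {..<R}" "\<forall>\<sigma>\<in>cliques E X. card \<sigma> \<le> card C"
    and "initial R C (Suc k) \<I>" "card \<I> = clique_num E X (Suc k)"
  shows "card (shadow \<I>) \<le> clique_num E X k"
  using assms
proof (induction "card C" arbitrary: C X k \<I> rule: less_induct)
  case less
  note hyps = less.hyps
  have Isub: "finite \<I>" "\<I> \<subseteq> rainbow R C (Suc k)" using less.prems(5) by (auto simp: initial_def)
  show ?case
  proof (cases k)
    case 0
    then show ?thesis using card_shadow_Suc_0 Isub(2) clique_num_0 [OF less.prems(1)] by auto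
  next
    case (Suc m)
    show ?thesis
    proof (cases "clique_num E X (Suc k) = 0")
      case True
      then have "\<I> = {}" using less.prems(6) Isub(1) by simp
      then show ?thesis by (simp add: shadow_def)
    next
      case False
      then have "{\<sigma> \<in> cliques E X. card \<sigma> = Suc k} \<noteq> {}"
        unfolding clique_num_def by (metis card.empty)
      then obtain \<sigma> where \<sigma>: "\<sigma> \<in> cliques E X" "card \<sigma> = Suc k" by blast
      then have "X \<noteq> {}" by (auto simp: cliques_def)
      have "C \<noteq> {}" using less.prems(4) \<sigma> by auto
      then obtain \<gamma> where \<gamma>: "\<gamma> \<in> C" by auto
      let ?C = "C - {\<gamma>}"
      have finC: "finite C" using less.prems(3) finite_subset by auto
      have cardC: "card ?C < card C" "Suc (card ?C) = card C"
        using \<gamma> finC card_gt_0_iff [of C] by (auto simp: card_Diff_singleton)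
      have C': "?C \<subseteq> {..<R}" using less.prems(3) by auto
      define N where "N v = {w \<in> X. w \<noteq> v \<and> E v w}" for v
      have NX: "N v \<subseteq> X" for v by (auto simp: N_def)
      have finN: "finite (N v)" for v using NX less.prems(1) finite_subset by blast
      have link: "\<forall>\<sigma>\<in>cliques E (N v). card \<sigma> \<le> card ?C" if v: "v \<in> X" for v
      proof
        fix \<sigma> assume \<sigma>: "\<sigma> \<in> cliques E (N v)"
        have "insert v \<sigma> \<in> cliques E X"
          using v \<sigma> sympD [OF less.prems(2)] by (auto simp: cliques_def N_def)
        moreover have "v \<notin> \<sigma>" "finite \<sigma>"
          using \<sigma> finN [of v] finite_subset by (auto simp: cliques_def N_def)
        ultimately show "card \<sigma> \<le> card ?C" using less.prems(4) cardC by fastforce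
      qed
      obtain v0 where v0: "v0 \<in> X"
        and vmax: "\<And>v. v \<in> X \<Longrightarrow> clique_num E (N v) k \<le> clique_num E (N v0) k"
      proof -
        have "Max ((\<lambda>v. clique_num E (N v) k) ` X) \<in> (\<lambda>v. clique_num E (N v) k) ` X"
          using less.prems(1) \<open>X \<noteq> {}\<close> by (intro Max_in) auto
        then obtain v0 where "v0 \<in> X"
          "Max ((\<lambda>v. clique_num E (N v) k) ` X) = clique_num E (N v0) k" by auto
        then show thesis using that [of v0] less.prems(1) by (metis Max_ge finite_imageI imageI)
      qed
      let ?N0 = "N v0"
      define a where "a = clique_num E ?N0 k"
      have seg: "\<exists>\<J>. initial R ?C (Suc l) \<J> \<and> card \<J> = clique_num E Y (Suc l)"
        if "\<forall>\<sigma>\<in>cliques E Y. card \<sigma> \<le> card ?C" for Y l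
      proof (rule initial_exists_card [OF C'])
        show "Suc l \<le> card ?C \<or> clique_num E Y (Suc l) = 0"
          using clique_num_eq_0 [of E Y "Suc l"] that by (meson le_less_trans not_le)
      qed simp
      \<comment> \<open>The vertices outside the neighbourhood, among them \<open>v0\<close>, are
        added one at a time. Each is represented by a fresh vertex \<open>w\<close> of colour
        \<open>\<gamma>\<close>, and \<open>\<J> w\<close> has as many sets as there are
        \<open>k\<close>-cliques among the neighbours already present.\<close>
      have glued: "\<exists>W \<J>. finite W \<and> (\<forall>w\<in>W. w mod R = \<gamma> \<and> initial R ?C k (\<J> w) \<and> card (\<J> w) \<le> a) \<and>
          clique_num E (?N0 \<union> Y) (Suc k) = clique_num E ?N0 (Suc k) + (\<Sum>w\<in>W. card (\<J> w)) \<and>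
          clique_num E (?N0 \<union> Y) k \<ge> a + (\<Sum>w\<in>W. card (shadow (\<J> w)))"
        if "finite Y" "Y \<subseteq> X - ?N0" for Y
        using that
      proof (induction Y rule: finite_induct)
        case empty
        show ?case by (intro exI [of _ "{}"]) (auto simp: a_def)
      next
        case (insert v Y)
        then obtain W \<J> where W: "finite W"
            "\<forall>w\<in>W. w mod R = \<gamma> \<and> initial R ?C k (\<J> w) \<and> card (\<J> w) \<le> a"
          "clique_num E (?N0 \<union> Y) (Suc k) = clique_num E ?N0 (Suc k) + (\<Sum>w\<in>W. card (\<J> w))"
          "clique_num E (?N0 \<union> Y) k \<ge> a + (\<Sum>w\<in>W. card (shadow (\<J> w)))" by blast
        let ?L = "{w \<in> ?N0 \<union> Y. E v w}"
        have v: "v \<in> X" "v \<notin> ?N0 \<union> Y" and YX: "Y \<subseteq> X" using insert by auto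
        have LN: "?L \<subseteq> N v" using v YX NX [of v0] by (auto simp: N_def)
        have finL: "finite ?L" using LN finN finite_subset by blast
        have Lcl: "\<forall>\<sigma>\<in>cliques E ?L. card \<sigma> \<le> card ?C"
          using link [OF v(1)] cliques_mono [OF LN] by blast
        obtain \<K> where K: "initial R ?C k \<K>" "card \<K> = clique_num E ?L k"
          using seg [of ?L m] Lcl Suc by auto
        have Ka: "card \<K> \<le> a"
          using K(2) clique_num_mono [OF finN LN, where E = E and k = k] vmax [OF v(1)]
              unfolding a_def by linarith
        have Ksh: "card (shadow \<K>) \<le> clique_num E ?L m"
          using hyps [OF cardC(1) finL less.prems(2) C' Lcl, where k = m and \<I> = \<K>] K Suc by simp
        have "infinite {w. w mod R = \<gamma>}"
        proof -
          have "inj (\<lambda>i. \<gamma> + R * i)" "range (\<lambda>i. \<gamma> + R * i) \<subseteq> {w. w mod R = \<gamma>}"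
            using \<gamma> less.prems(3) by (auto simp: inj_def)
          then show ?thesis by (metis finite_subset infinite_UNIV_nat finite_imageD)
        qed
        then have "\<not> {w. w mod R = \<gamma>} \<subseteq> W" using W(1) finite_subset by blast
        then obtain w0 where w0: "w0 mod R = \<gamma>" "w0 \<notin> W" by blast
        let ?J = "\<J>(w0 := \<K>)"
        have same: "(\<Sum>w\<in>insert w0 W. g (?J w)) = g \<K> + (\<Sum>w\<in>W. g (\<J> w))" for g :: "nat set set \<Rightarrow> nat"
        proof -
          have "(\<Sum>w\<in>W. g (?J w)) = (\<Sum>w\<in>W. g (\<J> w))" using w0(2) by (intro sum.cong) auto
          then show ?thesis using W(1) w0(2) by simp
        qed
        have ins: "clique_num E (?N0 \<union> insert v Y) (Suc l) = clique_num E (?N0 \<union>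
            Y) (Suc l) + clique_num E ?L l" for l
          using clique_num_insert [of "?N0 \<union> Y" v E l] v insert.hyps(1) finN less.prems(2) by simp
        show ?case
        proof (intro exI conjI)
          show "finite (insert w0 W)" using W(1) by simp
          show "\<forall>w\<in>insert w0 W. w mod R = \<gamma> \<and> initial R ?C k (?J w) \<and> card (?J w) \<le> a"
            using W(2) w0 K(1) Ka by auto
          show "clique_num E (?N0 \<union> insert v Y) (Suc k) =
              clique_num E ?N0 (Suc k) + (\<Sum>w\<in>insert w0 W. card (?J w))"
            using same [of card] W(3) K(2) ins [of k] by simp
          show "clique_num E (?N0 \<union> insert v Y) k \<ge> a + (\<Sum>w\<in>insert w0 W. card (shadow (?J w)))"
            using same [of "\<lambda>x. card (shadow x)"] W(4) Ksh ins [of m] Suc by simp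
        qed
      qed
      have XN: "?N0 \<union> (X - ?N0) = X" using NX by auto
      obtain W \<J> where W: "finite W"
        "\<forall>w\<in>W. w mod R = \<gamma> \<and> initial R ?C k (\<J> w) \<and> card (\<J> w) \<le> a"
        "clique_num E X (Suc k) = clique_num E ?N0 (Suc k) + (\<Sum>w\<in>W. card (\<J> w))"
        "clique_num E X k \<ge> a + (\<Sum>w\<in>W. card (shadow (\<J> w)))"
        using glued [of "X - ?N0"] less.prems(1) XN by auto
      obtain \<I>0 where I0: "initial R ?C (Suc k) \<I>0" "card \<I>0 = clique_num E ?N0 (Suc k)"
        using seg [of ?N0 k] link [OF v0] by blast
      have I0sh: "card (shadow \<I>0) \<le> a"
        using hyps [OF cardC(1) finN less.prems(2) C' link [OF v0], where k = k and \<I> = \<I>0] I0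
            by (simp add: a_def)
      have Wc: "\<forall>w\<in>W. w mod R = \<gamma>" using W(2) by auto
      have I0sub: "\<I>0 \<subseteq> rainbow R ?C (Suc k)" "finite \<I>0" using I0(1) by (auto simp: initial_def)
      have Jsub: "\<forall>w\<in>W. \<J> w \<subseteq> rainbow R ?C k" "\<forall>w\<in>W. finite (\<J> w)"
        using W(2) by (auto simp: initial_def)
      define \<F> where "\<F> = glue \<I>0 W \<J>"
      note gl = glue_properties [where \<I> = \<I>0 and W = W and \<J> = \<J>, OF I0sub(1) \<gamma> Jsub(1) Wc,
          folded \<F>_def]
      have finF: "finite \<F>" using I0sub Jsub W(1) by (auto simp: \<F>_def glue_def)
      have "card \<F> = card \<I>0 + (\<Sum>w\<in>W. card (\<J> w))"
        using card_sections [OF finF gl(1) W(1) Wc gl(4)] gl(2,3) by (simp cong: sum.cong)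
      then have "card \<I> = card \<F>" using less.prems(6) I0(2) W(3) by simp
      then have "card (shadow \<I>) \<le> card (shadow \<F>)"
        using coloured_Kruskal_Katona [OF less.prems(3)] finF gl(1) less.prems(5)
        unfolding shadow_minimal_def by blast
      also have "card (shadow \<F>) \<le> clique_num E X k"
      proof -
        have shF: "finite (shadow \<F>)" using finite_shadow [OF finF] gl(1) rainbow_finite by blast
        have shsub: "shadow \<F> \<subseteq> rainbow R C k"
          using gl(1) rainbow_remove by (fastforce simp: shadow_def)
        have shW: "{w \<in> \<Union>(shadow \<F>). w mod R = \<gamma>} \<subseteq> W"
          using gl(4) by (fastforce simp: shadow_def)
        have "card (shadow \<F>) =
            card (colour_deletion R \<gamma> (shadow \<F>)) + (\<Sum>w\<in>W. card (vertex_link w (shadow \<F>)))"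
          by (rule card_sections [OF shF shsub W(1) Wc shW])
        then have eq: "card (shadow \<F>) =
            card (shadow \<I>0 \<union> (\<Union>w\<in>W. \<J> w)) + (\<Sum>w\<in>W. card (shadow (\<J> w)))"
          using colour_deletion_shadow [OF gl(1) Wc gl(4)] gl(2,3)
              by (simp add: vertex_link_shadow cong: sum.cong)
        \<comment> \<open>The part of the shadow without colour \<open>\<gamma>\<close> is the union
          of a chain of initial segments, each with at most \<open>a\<close> sets, so it has at most
          \<open>a\<close> sets itself.\<close>
        let ?K = "insert (shadow \<I>0) (\<J> ` W)"
        have "\<Union>?K \<in> ?K"
          using W(1,2) initial_shadow [OF C' I0(1)] by (intro initial_Union) auto
        then have "card (\<Union>?K) \<le> a" using I0sh W(2) by auto
        then show ?thesis using eq W(4) by simp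
      qed
      finally show ?thesis .
    qed
  qed
qed

lemma asc_cliques: "finite X \<Longrightarrow> asc (cliques E X)"
  unfolding asc_def using finite_cliques [of X E] by (auto simp: cliques_def dest: finite_subset)

lemma card_le_rank: "asc \<Delta> \<Longrightarrow> \<sigma> \<in> \<Delta> \<Longrightarrow> card \<sigma> \<le> rank_complex \<Delta>"
  by (auto simp: rank_complex_def asc_def)

lemma rank_complex_attained: "asc \<Delta> \<Longrightarrow> \<exists>\<sigma>\<in>\<Delta>. card \<sigma> = rank_complex \<Delta>"
proof -
  assume "asc \<Delta>"
  then have "rank_complex \<Delta> \<in> card ` \<Delta>" unfolding rank_complex_def
      by (intro Max_in) (auto simp: asc_def)
  then show ?thesis by auto
qed

text \<open>In each cardinality take the initial segment, in \<open>r\<close> colours, with as many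
  sets as there are cliques. By \<open>card_shadow_le_clique_num\<close> its shadow is no larger
  than the segment one level below, hence contained in it, so the union of all levels is closed
  under subsets.\<close>

theorem balanced_complex_of_cliques:
  assumes "finite X" "symp E"
  shows "\<exists>\<Delta> :: nat set set. balanced_complex \<Delta> \<and> f_poly \<Delta> = f_poly (cliques E X)"
proof -
  define r where "r = rank_complex (cliques E X)"
  have le_r: "\<forall>\<sigma>\<in>cliques E X. card \<sigma> \<le> card {..<r}"
    using card_le_rank [OF asc_cliques [OF assms(1)]] by (simp add: r_def)
  have "\<exists>\<I>. initial r {..<r} k \<I> \<and> card \<I> = clique_num E X k" for k
  proof (cases k)
    case 0
    then show ?thesis using clique_num_0 [OF assms(1)]
      by (intro exI [of _ "{{}}"]) (auto simp: initial_def rainbow_0)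
  next
    case (Suc l)
    then show ?thesis
      using clique_num_eq_0 [of E X k] le_r
      by (intro initial_exists_card) (auto, meson le_less_trans not_less_eq_eq not_le)
  qed
  then obtain S where S: "\<And>k. initial r {..<r} k (S k)" "\<And>k. card (S k) = clique_num E X k"
    by metis
  have Ssub: "S k \<subseteq> rainbow r {..<r} k" "finite (S k)" for k using S(1) by (auto simp: initial_def)
  have sh: "shadow (S (Suc k)) \<subseteq> S k" for k
  proof (rule initial_chain [OF initial_shadow [OF subset_refl S(1)] S(1)])
    show "card (shadow (S (Suc k))) \<le> card (S k)"
      using card_shadow_le_clique_num [OF assms subset_refl le_r S(1) S(2)] by (simp add: S(2))
  qed
  have S0: "S 0 = {{}}"
  proof -
    have "S 0 \<noteq> {}" using S(2) [of 0] clique_num_0 [OF assms(1), of E] by auto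
    then show ?thesis using Ssub(1) [of 0] by (auto simp: rainbow_0)
  qed
  define \<Delta> where "\<Delta> = (\<Union>k\<le>r. S k)"
  have level: "\<sigma> \<in> S k \<longleftrightarrow> \<sigma> \<in> \<Delta> \<and> card \<sigma> = k" if "k \<le> r" for \<sigma> k
    using that rainbow_card Ssub(1) by (fastforce simp: \<Delta>_def)
  have down: "\<tau> \<in> \<Delta>" if "\<sigma> \<in> \<Delta>" "\<tau> \<subseteq> \<sigma>" for \<sigma> \<tau>
  proof -
    have fin: "finite \<sigma>" if "\<sigma> \<in> \<Delta>" for \<sigma> using that Ssub(1) rainbow_finite
        by (fastforce simp: \<Delta>_def)
    show ?thesis using that
    proof (induction "card (\<sigma> - \<tau>)" arbitrary: \<sigma>)
      case 0
      then have "\<sigma> = \<tau>" using fin [of \<sigma>] by auto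
      then show ?case using 0 by simp
    next
      case (Suc n)
      then obtain x where x: "x \<in> \<sigma>" "x \<notin> \<tau>"
          by (metis Diff_iff all_not_in_conv card.empty nat.distinct(1))
      obtain k where k: "k \<le> r" "\<sigma> \<in> S k" using Suc.prems by (auto simp: \<Delta>_def)
      then obtain l where l: "k = Suc l" using x S0 by (cases k) auto
      then have "\<sigma> - {x} \<in> shadow (S (Suc l))" using k x by (auto simp: shadow_def)
      then have "\<sigma> - {x} \<in> S l" using sh by blast
      then have "\<sigma> - {x} \<in> \<Delta>" using k l by (auto simp: \<Delta>_def)
      moreover have "card (\<sigma> - {x} - \<tau>) = n"
      proof -
        have "\<sigma> - {x} - \<tau> = (\<sigma> - \<tau>) - {x}" by auto
        then show ?thesis using Suc.hyps(2) x fin [OF Suc.prems(1)] by simp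
      qed
      ultimately show ?case using Suc.hyps(1) [of "\<sigma> - {x}"] Suc.prems x by auto
    qed
  qed
  have asc: "asc \<Delta>"
    unfolding asc_def
  proof (intro conjI ballI allI impI)
    show "finite \<Delta>" using Ssub(2) by (auto simp: \<Delta>_def)
    show "{} \<in> \<Delta>" using S0 by (auto simp: \<Delta>_def)
    show "finite \<sigma>" if "\<sigma> \<in> \<Delta>" for \<sigma> using that Ssub(1) rainbow_finite by (fastforce simp: \<Delta>_def)
  qed (rule down)
  have fnum: "f_num \<Delta> k = f_num (cliques E X) k" if "k \<le> r" for k
  proof -
    have "{\<sigma> \<in> \<Delta>. card \<sigma> = k} = S k" using level [OF that] by auto
    then show ?thesis using S(2) [of k] by (simp add: f_num_def clique_num_def)
  qed
  have rank: "rank_complex \<Delta> = r"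
  proof (rule antisym)
    obtain \<sigma> where "\<sigma> \<in> \<Delta>" "card \<sigma> = rank_complex \<Delta>" using rank_complex_attained [OF asc] by auto
    then show "rank_complex \<Delta> \<le> r" using Ssub(1) rainbow_card by (fastforce simp: \<Delta>_def)
    obtain \<sigma> where \<sigma>: "\<sigma> \<in> cliques E X" "card \<sigma> = r"
      using rank_complex_attained [OF asc_cliques [OF assms(1)]] by (auto simp: r_def)
    then have "f_num (cliques E X) r \<noteq> 0"
      using finite_cliques [OF assms(1)] by (auto simp: f_num_def)
    then have "{\<sigma> \<in> \<Delta>. card \<sigma> = r} \<noteq> {}" using fnum [of r]
        by (metis f_num_def card.empty order_refl)
    then obtain \<tau> where "\<tau> \<in> \<Delta>" "card \<tau> = r" by blast
    then show "r \<le> rank_complex \<Delta>" using card_le_rank [OF asc] by blast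
  qed
  have "f_poly \<Delta> = f_poly (cliques E X)"
    unfolding f_poly_def rank r_def [symmetric] using fnum by (intro sum.cong) auto
  moreover have "balanced_complex \<Delta>"
    unfolding balanced_complex_def rank
  proof (intro conjI exI [of _ "\<lambda>v. v mod r"] ballI allI impI)
    show "asc \<Delta>" by (rule asc)
    show "v mod r < r" if "v \<in> \<Union>\<Delta>" for v
      using that Ssub(1) rainbowD(3) by (fastforce simp: \<Delta>_def)
    show "u mod r \<noteq> v mod r" if "u \<noteq> v \<and> {u, v} \<in> \<Delta>" for u v
    proof -
      have "\<exists>k. {u, v} \<in> rainbow r {..<r} k" using that Ssub(1) by (fastforce simp: \<Delta>_def)
      then obtain k where "{u, v} \<in> rainbow r {..<r} k" by blast
      then show ?thesis using that rainbowD(4) [of "{u, v}" r "{..<r}" k u v] by auto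
    qed
  qed
  ultimately show ?thesis by blast
qed

subsection \<open>Clique polynomials\<close>

text \<open>The f-polynomial of the clique complex, as a real function because it will be evaluated
  at the quotient \<open>u * (1 + u) / (1 + 2 * u) ^ 2\<close>.\<close>

definition clique_poly :: "('a \<Rightarrow> 'a \<Rightarrow> bool) \<Rightarrow> 'a set \<Rightarrow> real \<Rightarrow> real" where
  "clique_poly E X u = (\<Sum>\<sigma>\<in>cliques E X. u ^ card \<sigma>)"

lemma clique_poly_empty [simp]: "clique_poly E {} u = 1"
proof -
  have "cliques E {} = {{}}" by (auto simp: cliques_def)
  then show ?thesis by (simp add: clique_poly_def)
qed

lemma clique_poly_insert:
  assumes "finite X" "v \<notin> X" "symp E"
  shows "clique_poly E (insert v X) u = clique_poly E X u + u * clique_poly E {w \<in> X. E v w} u"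
proof -
  let ?L = "cliques E {w \<in> X. E v w}"
  have fin: "finite \<sigma>" "v \<notin> \<sigma>" if "\<sigma> \<in> cliques E X" for \<sigma>
    using that assms finite_subset by (auto simp: cliques_def)
  have L: "\<sigma> \<in> cliques E X" if "\<sigma> \<in> ?L" for \<sigma>
    using that cliques_mono [of "{w \<in> X. E v w}" X E] by auto
  have inj: "inj_on (insert v) ?L"
    using fin(2) L by (intro inj_onI) (metis insert_ident)
  have "clique_poly E (insert v X) u = clique_poly E X u + (\<Sum>\<sigma>\<in>insert v ` ?L. u ^ card \<sigma>)"
    unfolding clique_poly_def cliques_insert [OF assms(2,3)]
    using fin finite_cliques [OF assms(1)] finite_cliques [of "{w \<in> X. E v w}" E] assms(1)
    by (intro sum.union_disjoint) auto
  also have "(\<Sum>\<sigma>\<in>insert v ` ?L. u ^ card \<sigma>) = (\<Sum>\<sigma>\<in>?L. u * u ^ card \<sigma>)"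
    unfolding sum.reindex [OF inj] using fin L by (intro sum.cong) auto
  finally show ?thesis by (simp add: clique_poly_def sum_distrib_left)
qed

lemma cliques_cong:
  assumes "\<And>x y. x \<in> X \<Longrightarrow> y \<in> X \<Longrightarrow> x \<noteq> y \<Longrightarrow> E x y = E' x y"
  shows "cliques E X = cliques E' X"
  using assms unfolding cliques_def by blast

lemma clique_poly_cong:
  assumes "\<And>x y. x \<in> X \<Longrightarrow> y \<in> X \<Longrightarrow> x \<noteq> y \<Longrightarrow> E x y = E' x y"
  shows "clique_poly E X u = clique_poly E' X u"
proof -
  have "cliques E X = cliques E' X" by (rule cliques_cong) (rule assms)
  then show ?thesis by (simp add: clique_poly_def)
qed

lemma clique_poly_image:
  assumes inj: "inj_on f X"
    and E: "\<And>x y. x \<in> X \<Longrightarrow> y \<in> X \<Longrightarrow> x \<noteq> y \<Longrightarrow> E' (f x) (f y) = E x y"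
  shows "clique_poly E' (f ` X) u = clique_poly E X u"
proof -
  have sub: "\<sigma> \<in> (`) f ` cliques E X" if \<sigma>: "\<sigma> \<in> cliques E' (f ` X)" for \<sigma>
  proof (rule image_eqI)
    show "\<sigma> = f ` (X \<inter> f -` \<sigma>)" using \<sigma> by (auto simp: cliques_def)
    have "E u v" if uv: "u \<in> X" "f u \<in> \<sigma>" "v \<in> X" "f v \<in> \<sigma>" "u \<noteq> v" for u v
    proof -
      have "f u \<noteq> f v" using inj_onD [OF inj] uv by blast
      then have "E' (f u) (f v)" using \<sigma> uv unfolding cliques_def by blast
      then show ?thesis using E uv by blast
    qed
    then show "X \<inter> f -` \<sigma> \<in> cliques E X" unfolding cliques_def by blast
  qed
  have sup: "f ` \<sigma> \<in> cliques E' (f ` X)" if \<sigma>: "\<sigma> \<in> cliques E X" for \<sigma>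
  proof -
    have "E' (f u) (f v)" if uv: "u \<in> \<sigma>" "v \<in> \<sigma>" "f u \<noteq> f v" for u v
    proof -
      have "u \<noteq> v" using uv(3) by auto
      moreover have "u \<in> X" "v \<in> X" using uv \<sigma> unfolding cliques_def by auto
      moreover have "E u v" using uv(1,2) \<sigma> \<open>u \<noteq> v\<close> unfolding cliques_def by blast
      ultimately show ?thesis using E by simp
    qed
    then have "\<forall>x\<in>f ` \<sigma>. \<forall>y\<in>f ` \<sigma>. x \<noteq> y \<longrightarrow> E' x y" by simp
    moreover have "f ` \<sigma> \<subseteq> f ` X" using \<sigma> by (auto simp: cliques_def)
    ultimately show ?thesis by (simp add: cliques_def)
  qed
  have eq: "cliques E' (f ` X) = (`) f ` cliques E X"
    using sub sup by (intro equalityI subsetI image_subsetI) auto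
  have inj2: "inj_on ((`) f) (cliques E X)"
    using inj_on_image_Pow [OF inj] by (rule inj_on_subset) (auto simp: cliques_def)
  have "card (f ` \<sigma>) = card \<sigma>" if "\<sigma> \<in> cliques E X" for \<sigma>
    using that inj by (intro card_image) (auto simp: cliques_def intro: inj_on_subset)
  then show ?thesis unfolding clique_poly_def eq sum.reindex [OF inj2] by simp
qed

lemma clique_poly_join:
  assumes "finite X" "finite Y" "X \<inter> Y = {}" "symp E" "\<And>x y. x \<in> X \<Longrightarrow> y \<in> Y \<Longrightarrow> E x y"
  shows "clique_poly E (X \<union> Y) u = clique_poly E X u * clique_poly E Y u"
  using assms(2,3,5)
proof (induction "card Y" arbitrary: Y rule: less_induct)
  case less
  show ?case
  proof (cases "Y = {}")
    case False
    then obtain v where v: "v \<in> Y" by auto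
    let ?Y = "Y - {v}" and ?N = "{w \<in> Y - {v}. E v w}"
    have Y: "insert v ?Y = Y" using v by auto
    have c: "card ?Y < card Y" using v less.prems(1) by (rule card_Diff1_less [rotated])
    have "card ?N \<le> card ?Y" using less.prems(1) by (intro card_mono) auto
    then have c2: "card ?N < card Y" using c by simp
    have "{w \<in> X \<union> ?Y. E v w} = X \<union> ?N" using less.prems(3) v sympD [OF assms(4)] by auto
    then have "clique_poly E (X \<union> Y) u = clique_poly E (X \<union> ?Y) u + u * clique_poly E (X \<union> ?N) u"
    proof -
      have "v \<notin> X \<union> ?Y" "insert v (X \<union> ?Y) = X \<union> Y" using v less.prems(2) by auto
      then show ?thesis
        using \<open>{w \<in> X \<union> ?Y. E v w} = X \<union> ?N\<close> clique_poly_insert [of "X \<union> ?Y" v E u] assms(1,4) less.prems(1)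
        by simp
    qed
    also have "\<dots> = clique_poly E X u * (clique_poly E ?Y u + u * clique_poly E ?N u)"
    proof -
      have "X \<inter> ?Y = {}" "X \<inter> ?N = {}" using less.prems(2) by auto
      then show ?thesis
        using less.hyps [OF c] less.hyps [OF c2] less.prems(1,3) by (simp add: algebra_simps)
    qed
    also have "clique_poly E ?Y u + u * clique_poly E ?N u = clique_poly E Y u"
      using clique_poly_insert [of ?Y v E u] Y less.prems(1) assms(4) by simp
    finally show ?thesis .
  qed simp
qed

text \<open>Subdividing the edge loses the faces through \<open>{a, c}\<close>, that is
  \<open>u ^ 2\<close> times its link, and gains those through \<open>z\<close>, that is
  \<open>u * (1 + 2 * u)\<close> times the link, because the link of \<open>z\<close> is the
  suspension of the old link by \<open>a\<close> and \<open>c\<close>. The difference is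
  \<open>u * (1 + u)\<close>.\<close>

lemma clique_poly_subdivide:
  assumes fin: "finite V" and V: "a \<in> V" "c \<in> V" "a \<noteq> c" "z \<notin> V" and sym: "symp E" "symp E'"
    and ac: "E a c"
    and old: "\<And>v w. v \<in> V \<Longrightarrow> w \<in> V \<Longrightarrow> v \<noteq> w \<Longrightarrow> E' v w \<longleftrightarrow> E v w \<and> {v, w} \<noteq> {a, c}"
    and new: "\<And>v. v \<in> V \<Longrightarrow> E' z v \<longleftrightarrow> v = a \<or> v = c \<or> (E v a \<and> E v c)"
  shows "clique_poly E' (insert z V) u =
    clique_poly E V u + u * (1 + u) * clique_poly E {v \<in> V - {a, c}. E v a \<and> E v c} u"
proof -
  let ?W = "V - {a, c}"
  let ?L = "{v \<in> ?W. E v a \<and> E v c}" and ?A = "{v \<in> ?W. E a v}" and ?C = "{v \<in> ?W. E c v}"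
  let ?P = "\<lambda>X. clique_poly E X u" and ?Q = "\<lambda>X. clique_poly E' X u"
  have finW: "finite ?W" using fin by simp
  have same: "?Q X = ?P X" if "X \<subseteq> ?W" for X
    using that old by (intro clique_poly_cong) (auto simp: doubleton_eq_iff)
  have sE: "E x y \<longleftrightarrow> E y x" for x y using sympD [OF sym(1)] by blast
  have sE': "E' x y \<longleftrightarrow> E' y x" for x y using sympD [OF sym(2)] by blast
  have P1: "?P V = ?P (insert c ?W) + u * ?P (insert c ?A)"
  proof -
    have "insert a (insert c ?W) = V" "{w \<in> insert c ?W. E a w} = insert c ?A" using V ac by auto
    then show ?thesis using clique_poly_insert [of "insert c ?W" a E u] V finW sym(1) by simp
  qed
  have P2: "?P (insert c ?W) = ?P ?W + u * ?P ?C"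
    using clique_poly_insert [OF finW _ sym(1), of c] by simp
  have P3: "?P (insert c ?A) = ?P ?A + u * ?P ?L"
  proof -
    have "{w \<in> ?A. E c w} = ?L" using sE by auto
    then show ?thesis using clique_poly_insert [of ?A c E u] finW sym(1) by simp
  qed
  have Ea: "E' a w \<longleftrightarrow> E a w" "E' c w \<longleftrightarrow> E c w" if "w \<in> ?W" for w
    using old [of a w] old [of c w] V that by (auto simp: doubleton_eq_iff)
  have Eac: "\<not> E' a c" "\<not> E' c a" using old [of a c] old [of c a] V by (auto simp: insert_commute)
  have Q1: "?Q V = ?Q (insert c ?W) + u * ?P ?A"
  proof -
    have "insert a (insert c ?W) = V" "{w \<in> insert c ?W. E' a w} = ?A" using V Eac Ea by auto
    then show ?thesis using clique_poly_insert [of "insert c ?W" a E' u] V finW sym(2) same [of ?A]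
        by auto
  qed
  have Q2: "?Q (insert c ?W) = ?P ?W + u * ?P ?C"
  proof -
    have "{w \<in> ?W. E' c w} = ?C" using Ea by auto
    then show ?thesis
      using clique_poly_insert [OF finW _ sym(2), of c] same [of ?W] same [of ?C] by auto
  qed
  have Q3: "?Q (insert z V) = ?Q V + u * ?Q (insert a (insert c ?L))"
  proof -
    have "{v \<in> V. E' z v} = insert a (insert c ?L)" using V new by auto
    then show ?thesis using clique_poly_insert [OF fin V(4) sym(2)] by simp
  qed
  have "E' c w" "E' a w" if "w \<in> ?L" for w using that Ea [of w] sE by auto
  then have "{w \<in> ?L. E' c w} = ?L" "{w \<in> insert c ?L. E' a w} = ?L" using Eac by blast+
  then have Q4: "?Q (insert a (insert c ?L)) = ?P ?L + u * ?P ?L + u * ?P ?L"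
    using clique_poly_insert [of "insert c ?L" a E' u] clique_poly_insert [of ?L c E' u] V(3) finW
      sym(2) same [of ?L, OF Collect_restrict] by simp
  show ?thesis unfolding Q3 Q4 Q1 Q2 P1 P2 P3 by (simp add: algebra_simps)
qed

subsection \<open>Flag building sets\<close>

text \<open>Decomposability of all members is the combinatorial form of flagness; under this condition
  nestedness is a condition on pairs of members, \<open>compat\<close> below.\<close>

definition decomposable :: "'a set set \<Rightarrow> bool" where
  "decomposable B \<longleftrightarrow> (\<forall>I\<in>B. (\<exists>i. I = {i}) \<or> (\<exists>J\<in>B. \<exists>K\<in>B. J \<inter> K = {} \<and> J \<union> K = I))"

definition flag_building :: "'a set \<Rightarrow> 'a set set \<Rightarrow> bool" where
  "flag_building S B \<longleftrightarrow> building_set S B \<and> decomposable B"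

definition maximals :: "'a set set \<Rightarrow> 'a set set" where
  "maximals B = {I \<in> B. \<not> (\<exists>J\<in>B. I \<subset> J)}"

text \<open>The vertices of the complex of nested sets. They give the facets of the nestohedron,
  while maximal members give equations valid on all of it.\<close>

definition nonmax :: "'a set set \<Rightarrow> 'a set set" where
  "nonmax B = {I \<in> B. \<exists>J\<in>B. I \<subset> J}"

definition compat :: "'a set set \<Rightarrow> 'a set \<Rightarrow> 'a set \<Rightarrow> bool" where
  "compat B I J \<longleftrightarrow> I \<subseteq> J \<or> J \<subseteq> I \<or> (I \<inter> J = {} \<and> I \<union> J \<notin> B)"

definition restriction :: "'a set \<Rightarrow> 'a set set \<Rightarrow> 'a set set" where
  "restriction Z B = {J \<in> B. J \<subseteq> Z}"

definition contraction :: "'a set \<Rightarrow> 'a set set \<Rightarrow> 'a set set" where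
  "contraction Z B = {J - Z |J. J \<in> B \<and> \<not> J \<subseteq> Z}"

text \<open>In the flag case this turns out to be the rank of the complex of nested sets; one is
  lost for each maximal member.\<close>

definition bdim :: "'a set \<Rightarrow> 'a set set \<Rightarrow> nat" where
  "bdim S B = card S - card (maximals B)"

lemma symp_compat: "symp (compat B)"
  by (auto simp: symp_def compat_def Int_commute Un_commute)

lemma building_setD:
  assumes "building_set S B"
  shows "finite S" "\<And>I. I \<in> B \<Longrightarrow> I \<noteq> {}" "\<And>I. I \<in> B \<Longrightarrow> I \<subseteq> S" "\<And>i. i \<in> S \<Longrightarrow> {i} \<in> B"
    and building_union: "\<And>I J. I \<in> B \<Longrightarrow> J \<in> B \<Longrightarrow> I \<inter> J \<noteq> {} \<Longrightarrow> I \<union> J \<in> B"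
    and finite_building: "finite B"
proof -
  show "finite B" using assms finite_subset [of B "Pow S"] by (auto simp: building_set_def)
qed (use assms in \<open>auto simp: building_set_def\<close>)

lemma building_finite: "building_set S B \<Longrightarrow> I \<in> B \<Longrightarrow> finite I"
  using building_setD(1,3) finite_subset by metis

lemma exists_maximal_superset:
  assumes "building_set S B" "I \<in> B"
  shows "\<exists>M\<in>maximals B. I \<subseteq> M"
proof -
  let ?A = "{J \<in> B. I \<subseteq> J}"
  have A: "finite ?A" "?A \<noteq> {}" using assms finite_building [OF assms(1)] by auto
  from finite_has_maximal [OF A] obtain M where M: "M \<in> ?A" "\<forall>J\<in>?A. M \<subseteq> J \<longrightarrow> M = J"
    by (rule bexE)
  have "\<not> M \<subset> J" if "J \<in> B" for J using M that by blast
  then have "M \<in> maximals B" using M(1) by (auto simp: maximals_def)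
  then show ?thesis using M(1) by blast
qed

lemma maximals_disjoint:
  assumes "building_set S B" "I \<in> maximals B" "J \<in> B" "I \<inter> J \<noteq> {}"
  shows "J \<subseteq> I"
proof -
  have "I \<in> B" "\<not> (\<exists>J\<in>B. I \<subset> J)" using assms(2) by (auto simp: maximals_def)
  moreover have "I \<union> J \<in> B" using building_union [OF assms(1) \<open>I \<in> B\<close> assms(3,4)] .
  ultimately show ?thesis by blast
qed

lemma card_maximals_le:
  assumes "building_set S B"
  shows "card (maximals B) \<le> card S"
proof (rule card_inj_on_le)
  let ?f = "\<lambda>I. SOME x. x \<in> I"
  have f: "?f I \<in> I" if "I \<in> maximals B" for I
    using that building_setD(2) [OF assms] by (auto simp: maximals_def some_in_eq)
  show "inj_on ?f (maximals B)"
  proof (rule inj_onI)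
    fix I J assume IJ: "I \<in> maximals B" "J \<in> maximals B" "?f I = ?f J"
    then have "I \<inter> J \<noteq> {}" using f [OF IJ(1)] f [OF IJ(2)] by auto
    then show "I = J"
      using maximals_disjoint [OF assms IJ(1), of J] maximals_disjoint [OF assms IJ(2), of I]
          IJ(1,2)
      by (auto simp: maximals_def Int_commute)
  qed
  show "?f ` maximals B \<subseteq> S"
    using f building_setD(3) [OF assms] by (fastforce simp: maximals_def)
qed (rule building_setD(1) [OF assms])

lemma finite_nonmax: "building_set S B \<Longrightarrow> finite (nonmax B)"
  by (rule finite_subset [OF _ finite_building]) (auto simp: nonmax_def)

lemma flag_buildingD:
  assumes "flag_building S B"
  shows "building_set S B"
    and "\<And>I. I \<in> B \<Longrightarrow> \<not> (\<exists>i. I = {i}) \<Longrightarrow> \<exists>J\<in>B. \<exists>K\<in>B. J \<inter> K = {} \<and> J \<union> K = I"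
  using assms unfolding flag_building_def decomposable_def by blast+

text \<open>Decomposability with one part forced to contain \<open>J\<close>. Let \<open>M\<close>
  be maximal among the proper members between \<open>J\<close> and \<open>X\<close>. A member inside
  \<open>X\<close> that meets \<open>M\<close> without lying in it completes \<open>M\<close> to
  \<open>X\<close>. Starting from \<open>X\<close>, such members are split; one part always still
  completes \<open>M\<close>, until it is disjoint from \<open>M\<close> and thus equal to
  \<open>X - M\<close>.\<close>

lemma exists_complement:
  assumes fb: "flag_building S B" and J: "J \<in> B" "X \<in> B" "J \<subset> X"
  shows "\<exists>J'\<in>B. J \<subseteq> J' \<and> J' \<subset> X \<and> X - J' \<in> B"
proof -
  note b = flag_buildingD(1) [OF fb]
  have ne: "I \<noteq> {}" if "I \<in> B" for I using building_setD(2) [OF b that] .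
  let ?A = "{K \<in> B. J \<subseteq> K \<and> K \<subset> X}"
  have A: "finite ?A" "?A \<noteq> {}" using J finite_building [OF b] by auto
  from finite_has_maximal [OF A] obtain M where M: "M \<in> ?A" "\<forall>K\<in>?A. M \<subseteq> K \<longrightarrow> M = K"
    by (rule bexE)
  have tri: "T \<inter> M = {} \<or> T \<subseteq> M \<or> T \<union> M = X" if T: "T \<in> B" "T \<subseteq> X" for T
  proof (rule ccontr)
    assume n: "\<not> ?thesis"
    have MA: "M \<in> B" "J \<subseteq> M" "M \<subset> X" using M(1) by auto
    have "T \<union> M \<in> B" using building_union [OF b T(1) MA(1)] n by blast
    then have "T \<union> M \<in> ?A" using n MA T by blast
    then have "M = T \<union> M" using M(2) by blast
    then show False using n by blast
  qed
  have "X - M \<in> B" if "T \<in> B" "T \<union> M = X" for T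
    using that
  proof (induction "card T" arbitrary: T rule: less_induct)
    case less
    show ?case
    proof (cases "T \<inter> M = {}")
      case True
      then have "X - M = T" using less.prems by auto
      then show ?thesis using less.prems by simp
    next
      case False
      have "\<not> T \<subseteq> M" using less.prems M(1) by auto
      then have "\<not> (\<exists>i. T = {i})" using False by auto
      then obtain P Q where PQ: "P \<in> B" "Q \<in> B" "P \<inter> Q = {}" "P \<union> Q = T"
        using flag_buildingD(2) [OF fb less.prems(1)] by auto
      have "P \<subset> T" "Q \<subset> T" using PQ ne [OF PQ(1)] ne [OF PQ(2)] by auto
      then have lt: "card P < card T" "card Q < card T"
        using building_finite [OF b less.prems(1)] by (simp_all add: psubset_card_mono)
      have PX: "P \<subseteq> X" "Q \<subseteq> X" using PQ less.prems by auto
      have "P \<union> M = X \<or> Q \<union> M = X"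
        using tri [OF PQ(1) PX(1)] tri [OF PQ(2) PX(2)] False \<open>\<not> T \<subseteq> M\<close> PQ(4) less.prems(2) by blast
      then show ?thesis using less.hyps lt PQ by blast
    qed
  qed
  from this [of X] have "X - M \<in> B" using J M by auto
  then show ?thesis using M(1) by blast
qed

text \<open>The source of pairwise behaviour in flag building sets. Splitting \<open>U\<close> leads
  to a member whose two halves lie in two different sets among \<open>P\<close>, \<open>Q\<close>,
  \<open>T\<close>, and these are connected through that member.\<close>

lemma union_of_two:
  assumes fb: "flag_building S B" and PQT: "P \<in> B" "Q \<in> B" "T \<in> B"
    and U: "U \<in> B" "U \<subseteq> P \<union> Q \<union> T" "\<not> U \<subseteq> P" "\<not> U \<subseteq> Q" "\<not> U \<subseteq> T"
  shows "P \<union> Q \<in> B \<or> P \<union> T \<in> B \<or> Q \<union> T \<in> B"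
  using U
proof (induction "card U" arbitrary: U rule: less_induct)
  case less
  note b = flag_buildingD(1) [OF fb]
  have "\<not> (\<exists>i. U = {i})" using less.prems by auto
  then obtain V W where VW: "V \<in> B" "W \<in> B" "V \<inter> W = {}" "V \<union> W = U"
    using flag_buildingD(2) [OF fb less.prems(1)] by auto
  note ne = building_setD(2) [OF b VW(1)] building_setD(2) [OF b VW(2)]
  have "V \<subset> U" "W \<subset> U" using VW ne by auto
  then have lt: "card V < card U" "card W < card U"
    using building_finite [OF b less.prems(1)] by (simp_all add: psubset_card_mono)
  have two: "X1 \<union> X2 \<in> B" if X: "V \<subseteq> X1" "W \<subseteq> X2" "X1 \<in> B" "X2 \<in> B" for X1 X2
  proof -
    have "X1 \<union> U \<in> B" using building_union [OF b X(3) less.prems(1)] X VW ne by auto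
    then have "X1 \<union> U \<union> X2 \<in> B" using building_union [OF b _ X(4)] X VW ne by auto
    moreover have "X1 \<union> U \<union> X2 = X1 \<union> X2" using X VW by auto
    ultimately show ?thesis by simp
  qed
  show ?case
  proof (cases "(V \<subseteq> P \<or> V \<subseteq> Q \<or> V \<subseteq> T) \<and> (W \<subseteq> P \<or> W \<subseteq> Q \<or> W \<subseteq> T)")
    case True
    then show ?thesis using two PQT less.prems(3-5) VW(4) by (smt (verit) Un_commute Un_least)
  next
    case False
    then show ?thesis using less.hyps lt VW less.prems(2) by (metis Un_subset_iff)
  qed
qed

section \<open>Restriction and contraction\<close>

lemma restriction_flag:
  assumes "flag_building S B" "Z \<subseteq> S"
  shows "flag_building Z (restriction Z B)"
proof -
  note b = flag_buildingD(1) [OF assms(1)]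
  have "building_set Z (restriction Z B)"
    using b assms(2) finite_subset [of Z S] unfolding building_set_def restriction_def by auto
  moreover have "decomposable (restriction Z B)"
    unfolding decomposable_def
  proof (intro ballI)
    fix I assume I: "I \<in> restriction Z B"
    show "(\<exists>i. I = {i}) \<or> (\<exists>J\<in>restriction Z B. \<exists>K\<in>restriction Z B. J \<inter> K = {} \<and> J \<union> K = I)"
    proof (cases "\<exists>i. I = {i}")
      case False
      then obtain J K where "J \<in> B" "K \<in> B" "J \<inter> K = {}" "J \<union> K = I"
        using flag_buildingD(2) [OF assms(1) _ False] I unfolding restriction_def by blast
      then have "J \<in> restriction Z B" "K \<in> restriction Z B" using I by (auto simp: restriction_def)
      then show ?thesis using \<open>J \<inter> K = {}\<close> \<open>J \<union> K = I\<close> by blast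
    qed simp
  qed
  ultimately show ?thesis by (simp add: flag_building_def)
qed

text \<open>If one part of a decomposition of \<open>I'\<close> lies inside \<open>Z\<close>, the
  other part has the same trace as \<open>I'\<close> outside \<open>Z\<close>, and the argument is
  repeated with it.\<close>

lemma contraction_flag:
  assumes "flag_building S B"
  shows "flag_building (S - Z) (contraction Z B)"
proof -
  note b = flag_buildingD(1) [OF assms(1)]
  have "building_set (S - Z) (contraction Z B)"
    unfolding building_set_def
  proof (intro conjI ballI impI)
    show "finite (S - Z)" using building_setD(1) [OF b] by simp
    show "I \<noteq> {}" "I \<subseteq> S - Z" if "I \<in> contraction Z B" for I
      using that building_setD(3) [OF b] by (auto simp: contraction_def)
    show "I \<union> J \<in> contraction Z B"
      if IJ: "I \<in> contraction Z B" "J \<in> contraction Z B" "I \<inter> J \<noteq> {}" for I J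
    proof -
      obtain I' J' where I': "I' \<in> B" "\<not> I' \<subseteq> Z" "I = I' - Z" "J' \<in> B" "J = J' - Z"
        using IJ by (auto simp: contraction_def)
      then have "I' \<union> J' \<in> B" using building_union [OF b, of I' J'] IJ(3) by auto
      moreover have "I \<union> J = (I' \<union> J') - Z" "\<not> I' \<union> J' \<subseteq> Z" using I' by auto
      ultimately show ?thesis unfolding contraction_def by blast
    qed
    show "{i} \<in> contraction Z B" if "i \<in> S - Z" for i
      using that building_setD(4) [OF b, of i] unfolding contraction_def
          by (intro CollectI exI [of _ "{i}"]) auto
  qed
  moreover have "decomposable (contraction Z B)"
    unfolding decomposable_def
  proof (intro ballI)
    fix I assume "I \<in> contraction Z B"
    then obtain I' where I': "I' \<in> B" "\<not> I' \<subseteq> Z" "I = I' - Z" by (auto simp: contraction_def)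
    then show "(\<exists>i. I = {i}) \<or> (\<exists>J\<in>contraction Z B. \<exists>K\<in>contraction Z B. J \<inter> K = {} \<and> J \<union> K = I)"
    proof (induction "card I'" arbitrary: I' rule: less_induct)
      case less
      show ?case
      proof (cases "\<exists>i. I' = {i}")
        case True
        then show ?thesis using less.prems by auto
      next
        case False
        then obtain J K where JK: "J \<in> B" "K \<in> B" "J \<inter> K = {}" "J \<union> K = I'"
          using flag_buildingD(2) [OF assms(1) less.prems(1)] by auto
        have "J \<subset> I'" "K \<subset> I'" using JK building_setD(2) [OF b JK(1)] building_setD(2) [OF b JK(2)]
            by auto
        then have lt: "card J < card I'" "card K < card I'"
          using building_finite [OF b less.prems(1)] by (simp_all add: psubset_card_mono)
        consider "J \<subseteq> Z" | "K \<subseteq> Z" | "\<not> J \<subseteq> Z" "\<not> K \<subseteq> Z" by auto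
        then show ?thesis
        proof cases
          case 1
          then have "I = K - Z" "\<not> K \<subseteq> Z" using JK less.prems by auto
          then show ?thesis using less.hyps [OF lt(2)] JK by blast
        next
          case 2
          then have "I = J - Z" "\<not> J \<subseteq> Z" using JK less.prems by auto
          then show ?thesis using less.hyps [OF lt(1)] JK by blast
        next
          case 3
          then have "J - Z \<in> contraction Z B" "K - Z \<in> contraction Z B"
            using JK by (auto simp: contraction_def)
          moreover have "(J - Z) \<inter> (K - Z) = {}" "(J - Z) \<union> (K - Z) = I" using JK less.prems by auto
          ultimately show ?thesis by blast
        qed
      qed
    qed
  qed
  ultimately show ?thesis by (simp add: flag_building_def)
qed

section \<open>Effect of adding one set to a flag building set\<close>

lemma compat_mono: "compat B' I J \<Longrightarrow> B \<subseteq> B' \<Longrightarrow> compat B I J"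
  by (auto simp: compat_def)

text \<open>A member inside \<open>Z\<close> that meets both \<open>A\<close> and \<open>C\<close>
  would connect them and put \<open>Z\<close> into \<open>B\<close>. A member that meets
  \<open>Z\<close> without lying in it has a union with \<open>Z\<close> in
  \<open>insert Z B\<close>, and this union differs from \<open>Z\<close>.\<close>

lemma insert_decomposition:
  assumes fb: "flag_building S B" "flag_building S (insert Z B)" and Z: "Z \<notin> B"
  obtains A C where "A \<in> B" "C \<in> B" "A \<inter> C = {}" "A \<union> C = Z" "A \<noteq> {}" "C \<noteq> {}"
    "\<And>I. I \<in> B \<Longrightarrow> I \<subseteq> Z \<Longrightarrow> I \<subseteq> A \<or> I \<subseteq> C"
    "\<And>I. I \<in> B \<Longrightarrow> I \<inter> Z \<noteq> {} \<Longrightarrow> \<not> I \<subseteq> Z \<Longrightarrow> I \<union> Z \<in> B"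
proof -
  note b = flag_buildingD(1) [OF fb(1)] and b' = flag_buildingD(1) [OF fb(2)]
  have "Z \<subseteq> S" using building_setD(3) [OF b'] by auto
  then have "\<not> (\<exists>i. Z = {i})" using Z building_setD(4) [OF b] by auto
  then obtain A C where AC: "A \<in> insert Z B" "C \<in> insert Z B" "A \<inter> C = {}" "A \<union> C = Z"
    using flag_buildingD(2) [OF fb(2), of Z] by blast
  have ne: "A \<noteq> {}" "C \<noteq> {}" using AC building_setD(2) [OF b'] by auto
  then have AC': "A \<in> B" "C \<in> B" using AC by auto
  have below: "I \<subseteq> A \<or> I \<subseteq> C" if I: "I \<in> B" "I \<subseteq> Z" for I
  proof (rule ccontr)
    assume n: "\<not> ?thesis"
    then have "I \<inter> A \<noteq> {}" "I \<inter> C \<noteq> {}" using I AC by auto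
    then have "I \<union> A \<union> C \<in> B"
      using building_union [OF b building_union [OF b I(1) AC'(1)] AC'(2)] by auto
    moreover have "I \<union> A \<union> C = Z" using I AC by auto
    ultimately show False using Z by simp
  qed
  have above: "I \<union> Z \<in> B" if I: "I \<in> B" "I \<inter> Z \<noteq> {}" "\<not> I \<subseteq> Z" for I
    using building_union [OF b', of I Z] I by auto
  show thesis by (rule that [OF AC' AC(3,4) ne below above])
qed

text \<open>Traces outside \<open>Z\<close> identify the part of the link of \<open>Z\<close> not
  inside \<open>Z\<close> with the complex of the contraction. A set \<open>K\<close> of the
  contraction lifts to \<open>K \<union> Z\<close> if that is a member, and to itself otherwise.
  Decomposability matters for two sets disjoint from \<open>Z\<close>: by
  \<open>union_of_two\<close> their union cannot become a member merely by passing through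
  \<open>Z\<close>.\<close>

lemma nonmax_contraction:
  assumes fb: "flag_building S B" and Z: "Z \<in> B"
  defines "L \<equiv> {I \<in> nonmax B. \<not> I \<subseteq> Z \<and> compat B Z I}"
  shows "(\<lambda>I. I - Z) ` L = nonmax (contraction Z B)" "inj_on (\<lambda>I. I - Z) L"
    and "\<And>I J. I \<in> L \<Longrightarrow> J \<in> L \<Longrightarrow> compat (contraction Z B) (I - Z) (J - Z) = compat B I J"
proof -
  note b = flag_buildingD(1) [OF fb]
  let ?K = "contraction Z B"
  have Zne: "Z \<noteq> {}" using building_setD(2) [OF b Z] .
  have meet: "J \<union> Z \<in> B" if "J \<in> B" "J \<inter> Z \<noteq> {}" for J
    using building_union [OF b that(1) Z that(2)] .
  have L: "I \<in> L \<longleftrightarrow> I \<in> nonmax B \<and> (Z \<subset> I \<or> I \<inter> Z = {} \<and> I \<union> Z \<notin> B)" for I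
    using building_setD(2) [OF b, of I] unfolding L_def compat_def nonmax_def
    by (auto simp: Un_commute Int_commute)
  have LB: "I \<in> B" if "I \<in> L" for I using that by (auto simp: L_def nonmax_def)
  have Kiff: "K \<in> ?K \<longleftrightarrow> K \<noteq> {} \<and> K \<inter> Z = {} \<and> (K \<in> B \<or> K \<union> Z \<in> B)" for K
  proof
    assume "K \<in> ?K"
    then obtain J where J: "J \<in> B" "\<not> J \<subseteq> Z" "K = J - Z" by (auto simp: contraction_def)
    have "K \<in> B \<or> K \<union> Z \<in> B"
    proof (cases "J \<inter> Z = {}")
      case True
      then have "K = J" using J by auto
      then show ?thesis using J by simp
    next
      case False
      then show ?thesis using meet [OF J(1)] J(3) by (simp add: Un_commute)
    qed
    then show "K \<noteq> {} \<and> K \<inter> Z = {} \<and> (K \<in> B \<or> K \<union> Z \<in> B)" using J by auto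
  next
    assume K: "K \<noteq> {} \<and> K \<inter> Z = {} \<and> (K \<in> B \<or> K \<union> Z \<in> B)"
    then have "K = K - Z" "K = (K \<union> Z) - Z" "\<not> K \<subseteq> Z" "\<not> K \<union> Z \<subseteq> Z" by auto
    then show "K \<in> ?K" using K unfolding contraction_def by blast
  qed
  show "inj_on (\<lambda>I. I - Z) L"
  proof (rule inj_onI)
    fix I J assume IJ: "I \<in> L" "J \<in> L" "I - Z = J - Z"
    show "I = J"
    proof (cases "Z \<subset> I")
      case True
      then have "I = J \<union> Z" using IJ(3) by auto
      then have "J \<union> Z \<in> B" using LB [OF IJ(1)] by simp
      then have "Z \<subset> J" using IJ(2) L [of J] by blast
      then show ?thesis using True IJ(3) by auto
    next
      case False
      then have I: "I \<inter> Z = {}" "I \<union> Z \<notin> B" using IJ(1) L [of I] by blast+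
      then have "J \<union> Z \<notin> B" using IJ(3) by (metis Un_Diff_cancel2)
      then have "\<not> Z \<subset> J" using LB [OF IJ(2)] by (metis psubset_imp_subset sup.absorb1)
      then show ?thesis using I IJ L [of J] by blast
    qed
  qed
  show "(\<lambda>I. I - Z) ` L = nonmax ?K"
  proof
    show "(\<lambda>I. I - Z) ` L \<subseteq> nonmax ?K"
    proof
      fix K assume "K \<in> (\<lambda>I. I - Z) ` L"
      then obtain I where I: "I \<in> L" "K = I - Z" by auto
      then obtain J where J: "J \<in> B" "I \<subset> J" by (auto simp: L_def nonmax_def)
      have nsub: "\<not> I \<subseteq> Z" using I by (auto simp: L_def)
      then have "K \<in> ?K" "J - Z \<in> ?K" using I J LB by (auto simp: contraction_def)
      moreover have "K \<subset> J - Z"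
      proof (cases "Z \<subset> I")
        case False
        then have dis: "I \<inter> Z = {}" "I \<union> Z \<notin> B" using I L by blast+
        have "J - Z \<noteq> I"
        proof
          assume eq: "J - Z = I"
          then have "J \<inter> Z \<noteq> {}" using J by auto
          then have "J \<union> Z \<in> B" using meet J by blast
          moreover have "J \<union> Z = I \<union> Z" using eq by auto
          ultimately show False using dis by simp
        qed
        then show ?thesis using dis J I(2) by auto
      qed (use I J in auto)
      ultimately show "K \<in> nonmax ?K" by (auto simp: nonmax_def)
    qed
    show "nonmax ?K \<subseteq> (\<lambda>I. I - Z) ` L"
    proof
      fix K assume "K \<in> nonmax ?K"
      then obtain K' where K: "K \<in> ?K" "K' \<in> ?K" "K \<subset> K'" by (auto simp: nonmax_def)
      then obtain J' where J': "J' \<in> B" "K' = J' - Z" by (auto simp: contraction_def)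
      show "K \<in> (\<lambda>I. I - Z) ` L"
      proof (cases "K \<union> Z \<in> B")
        case True
        have "K \<union> Z \<union> J' \<in> B" using building_union [OF b True J'(1)] K J' Kiff by auto
        moreover have "K \<union> Z \<subset> K \<union> Z \<union> J'" using K J' Kiff by auto
        ultimately have "K \<union> Z \<in> nonmax B" using True unfolding nonmax_def by blast
        moreover have "Z \<subset> K \<union> Z" using K(1) Kiff by auto
        ultimately have "K \<union> Z \<in> L" using L by blast
        moreover have "K = (K \<union> Z) - Z" using K(1) Kiff by auto
        ultimately show ?thesis by blast
      next
        case False
        then have KB: "K \<in> B" "K \<inter> Z = {}" using K(1) Kiff by auto
        then have "K \<in> nonmax B" using J' K unfolding nonmax_def by blast
        then have "K \<in> L" using L KB False by blast
        moreover have "K = K - Z" using KB by auto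
        ultimately show ?thesis by blast
      qed
    qed
  qed
  have one: "compat ?K (I - Z) (J - Z) = compat B I J"
    if IJ: "I \<in> L" "J \<in> L" "Z \<subset> I \<or> \<not> Z \<subset> J" for I J
  proof (cases "Z \<subset> I")
    case True
    show ?thesis
    proof (cases "Z \<subset> J")
      case True
      have "(I - Z) \<union> (J - Z) \<in> ?K" if "(I - Z) \<inter> (J - Z) = {}"
      proof -
        have "I \<union> J \<in> B" using building_union [OF b LB [OF IJ(1)] LB [OF IJ(2)]] True \<open>Z \<subset> I\<close> Zne by auto
        moreover have "((I - Z) \<union> (J - Z)) \<union> Z = I \<union> J" using True \<open>Z \<subset> I\<close> by auto
        ultimately show ?thesis using Kiff \<open>Z \<subset> I\<close> by auto
      qed
      moreover have "I \<inter> J \<noteq> {}" using True \<open>Z \<subset> I\<close> Zne by auto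
      ultimately show ?thesis using True \<open>Z \<subset> I\<close> unfolding compat_def by blast
    next
      case False
      then have J: "J \<inter> Z = {}" "J \<union> Z \<notin> B" using IJ(2) L by blast+
      have Jne: "J \<noteq> {}" using building_setD(2) [OF b LB [OF IJ(2)]] .
      have JZ: "J - Z = J" using J by auto
      have no: "\<not> I - Z \<subseteq> J"
      proof
        assume sub: "I - Z \<subseteq> J"
        have "I \<inter> J \<noteq> {}" using sub \<open>Z \<subset> I\<close> by auto
        then have "I \<union> J \<in> B" using building_union [OF b LB [OF IJ(1)] LB [OF IJ(2)]] by simp
        moreover have "I \<union> J = J \<union> Z" using sub \<open>Z \<subset> I\<close> by auto
        ultimately show False using J by simp
      qed
      have key: "I - Z \<union> J \<in> ?K \<longleftrightarrow> I \<union> J \<in> B"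
      proof
        assume "I \<union> J \<in> B"
        moreover have "I - Z \<union> J \<union> Z = I \<union> J" using \<open>Z \<subset> I\<close> by auto
        ultimately show "I - Z \<union> J \<in> ?K" using Kiff J Jne by auto
      next
        assume "I - Z \<union> J \<in> ?K"
        then have "I - Z \<union> J \<in> B \<or> I - Z \<union> J \<union> Z \<in> B" using Kiff by blast
        moreover have "I - Z \<union> J \<union> I \<in> B" if "I - Z \<union> J \<in> B"
          using building_union [OF b that LB [OF IJ(1)]] \<open>Z \<subset> I\<close> by auto
        moreover have "I - Z \<union> J \<union> I = I \<union> J" "I - Z \<union> J \<union> Z = I \<union> J" using \<open>Z \<subset> I\<close> by auto
        ultimately show "I \<union> J \<in> B" by auto
      qed
      have eqs: "(I - Z) \<inter> J = I \<inter> J" "J \<subseteq> I - Z \<longleftrightarrow> J \<subseteq> I" using J by auto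
      have "\<not> I \<subseteq> J" using no by auto
      then show ?thesis using no unfolding compat_def JZ eqs key by simp
    qed
  next
    case False
    then have "\<not> Z \<subset> J" using IJ(3) by simp
    then have J: "J \<inter> Z = {}" "J \<union> Z \<notin> B" and I: "I \<inter> Z = {}" "I \<union> Z \<notin> B"
      using False IJ L by blast+
    have eq: "I - Z = I" "J - Z = J" using I J by auto
    have "I \<union> J \<in> ?K \<longleftrightarrow> I \<union> J \<in> B" if "I \<inter> J = {}"
    proof
      assume "I \<union> J \<in> B"
      then show "I \<union> J \<in> ?K" using Kiff I J building_setD(2) [OF b, of "I \<union> J"] by auto
    next
      assume "I \<union> J \<in> ?K"
      then have "I \<union> J \<in> B \<or> I \<union> J \<union> Z \<in> B" using Kiff by blast
      moreover have "I \<union> J \<in> B \<or> I \<union> Z \<in> B \<or> J \<union> Z \<in> B" if U: "I \<union> J \<union> Z \<in> B"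
      proof (rule union_of_two [OF fb LB [OF IJ(1)] LB [OF IJ(2)] Z U subset_refl])
        have "I \<noteq> {}" "J \<noteq> {}" using building_setD(2) [OF b] LB IJ by blast+
        then show "\<not> I \<union> J \<union> Z \<subseteq> I" "\<not> I \<union> J \<union> Z \<subseteq> J" "\<not> I \<union> J \<union> Z \<subseteq> Z"
          using I J Zne by blast+
      qed
      ultimately show "I \<union> J \<in> B" using I J by auto
    qed
    then show ?thesis unfolding compat_def eq by auto
  qed
  show "compat ?K (I - Z) (J - Z) = compat B I J" if IJ: "I \<in> L" "J \<in> L" for I J
  proof (cases "Z \<subset> I \<or> \<not> Z \<subset> J")
    case False
    then have "compat ?K (J - Z) (I - Z) = compat B J I" using one IJ by blast
    moreover have "compat D X Y = compat D Y X" for D :: "'a set set" and X Y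
      using symp_compat sympD by metis
    ultimately show ?thesis by metis
  qed (use one IJ in blast)
qed

text \<open>Adding \<open>Z\<close> subdivides the edge \<open>{A, C}\<close>. The link of this edge
  consists of the sets compatible with \<open>Z\<close> other than \<open>A\<close> and
  \<open>C\<close>. Those inside \<open>Z\<close> form the complex of the restriction, whose maximal
  members are \<open>A\<close> and \<open>C\<close>; the remaining ones form that of the
  contraction; and any set of the first kind is compatible with any of the second.\<close>

theorem clique_poly_essential_step:
  assumes fb: "flag_building S B" "flag_building S (insert Z B)" and Z: "Z \<notin> B"
    and M: "M \<in> B" "Z \<subset> M"
  shows "clique_poly (compat (insert Z B)) (nonmax (insert Z B)) u =
    clique_poly (compat B) (nonmax B) u + u * (1 + u) *
      clique_poly (compat (restriction Z B)) (nonmax (restriction Z B)) u *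
      clique_poly (compat (contraction Z B)) (nonmax (contraction Z B)) u"
proof -
  let ?B = "insert Z B" and ?V = "nonmax B"
  note b = flag_buildingD(1) [OF fb(1)] and b' = flag_buildingD(1) [OF fb(2)]
  obtain A C where AC: "A \<in> B" "C \<in> B" "A \<inter> C = {}" "A \<union> C = Z" "A \<noteq> {}" "C \<noteq> {}"
    and below: "\<And>I. I \<in> B \<Longrightarrow> I \<subseteq> Z \<Longrightarrow> I \<subseteq> A \<or> I \<subseteq> C"
    and above: "\<And>I. I \<in> B \<Longrightarrow> I \<inter> Z \<noteq> {} \<Longrightarrow> \<not> I \<subseteq> Z \<Longrightarrow> I \<union> Z \<in> B"
    using insert_decomposition [OF fb Z] by blast
  have ne: "I \<noteq> {}" if "I \<in> B" for I using building_setD(2) [OF b that] .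
  have V': "nonmax ?B = insert Z ?V"
  proof
    show "insert Z ?V \<subseteq> nonmax ?B" using M by (auto simp: nonmax_def)
    show "nonmax ?B \<subseteq> insert Z ?V"
    proof
      fix I assume "I \<in> nonmax ?B"
      then obtain J where "I \<in> ?B" "J \<in> ?B" "I \<subset> J" by (auto simp: nonmax_def)
      then show "I \<in> insert Z ?V" using M by (cases "J = Z") (auto simp: nonmax_def)
    qed
  qed
  have ACV: "A \<in> ?V" "C \<in> ?V" "A \<noteq> C" "Z \<notin> ?V" using AC M Z by (auto simp: nonmax_def)
  have VB: "I \<in> B" if "I \<in> ?V" for I using that by (auto simp: nonmax_def)
  have AC_only: "{I, J} = {A, C}" if IJ: "I \<in> B" "J \<in> B" "I \<inter> J = {}" "I \<union> J = Z" for I J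
  proof -
    have "I \<subseteq> A \<or> I \<subseteq> C" "J \<subseteq> A \<or> J \<subseteq> C" using below IJ by auto
    moreover have "\<not> (I \<subseteq> A \<and> J \<subseteq> A)" "\<not> (I \<subseteq> C \<and> J \<subseteq> C)" using IJ(4) AC by blast+
    ultimately consider "I \<subseteq> A" "J \<subseteq> C" | "I \<subseteq> C" "J \<subseteq> A" by blast
    then show ?thesis
    proof cases
      case 1
      then have "I = A" "J = C" using IJ(4) AC(3,4) by blast+
      then show ?thesis by simp
    next
      case 2
      then have "I = C" "J = A" using IJ(4) AC(3,4) by blast+
      then show ?thesis by auto
    qed
  qed
  have symm: "compat D I J \<longleftrightarrow> compat D J I" for D :: "'a set set" and I J
    using symp_compat sympD by metis
  \<comment> \<open>\<open>{A, C}\<close> is the only pair of disjoint members with union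
    \<open>Z\<close>, so it is the only pair whose compatibility is lost.\<close>
  have old: "compat ?B I J \<longleftrightarrow> compat B I J \<and> {I, J} \<noteq> {A, C}" if "I \<in> ?V" "J \<in> ?V" for I J
  proof
    assume c: "compat ?B I J"
    then have "compat B I J" by (rule compat_mono) auto
    moreover have "\<not> compat ?B A C" using AC by (auto simp: compat_def)
    then have "\<not> compat ?B C A" using symm by blast
    with \<open>\<not> compat ?B A C\<close> have "{I, J} \<noteq> {A, C}" using c by (auto simp: doubleton_eq_iff)
    ultimately show "compat B I J \<and> {I, J} \<noteq> {A, C}" by simp
  next
    assume c: "compat B I J \<and> {I, J} \<noteq> {A, C}"
    then have "I \<inter> J = {} \<Longrightarrow> I \<union> J \<noteq> Z" using AC_only VB that by blast
    then show "compat ?B I J" using c by (auto simp: compat_def)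
  qed
  have new: "compat ?B Z I \<longleftrightarrow> I = A \<or> I = C \<or> (compat B I A \<and> compat B I C)" if I: "I \<in> ?V" for I
  proof
    assume c: "compat ?B Z I"
    have IZ: "I \<noteq> Z" using VB [OF I] Z by auto
    consider "I \<subseteq> A" | "I \<subseteq> C" | "Z \<subset> I" | "I \<inter> Z = {}" "I \<union> Z \<notin> B"
      using c below [OF VB [OF I]] IZ by (auto simp: compat_def Un_commute Int_commute)
    then show "I = A \<or> I = C \<or> (compat B I A \<and> compat B I C)"
    proof cases
      case 1
      have "I \<union> C \<notin> B" if "I \<noteq> A"
        using below [of "I \<union> C"] 1 AC that ne [OF VB [OF I]] by blast
      then show ?thesis using 1 AC by (auto simp: compat_def)
    next
      case 2
      have "I \<union> A \<notin> B" if "I \<noteq> C"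
        using below [of "I \<union> A"] 2 AC that ne [OF VB [OF I]] by blast
      then show ?thesis using 2 AC by (auto simp: compat_def)
    next
      case 3
      then show ?thesis using AC by (auto simp: compat_def)
    next
      case 4
      have "I \<union> X \<notin> B" if X: "X \<subseteq> Z" "X \<noteq> {}" for X
      proof
        assume "I \<union> X \<in> B"
        then have "I \<union> X \<union> Z \<in> B" using above [of "I \<union> X"] X 4 ne [OF VB [OF I]] by auto
        moreover have "I \<union> X \<union> Z = I \<union> Z" using X by auto
        ultimately show False using 4 by simp
      qed
      then have "I \<union> A \<notin> B" "I \<union> C \<notin> B" using AC by auto
      then show ?thesis using 4 AC by (auto simp: compat_def)
    qed
  next
    assume "I = A \<or> I = C \<or> (compat B I A \<and> compat B I C)"
    then consider "I \<subseteq> Z" | "compat B I A" "compat B I C" "\<not> I \<subseteq> Z" using AC by auto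
    then show "compat ?B Z I"
    proof cases
      case 2
      \<comment> \<open>If \<open>I\<close> properly contains one part of \<open>Z\<close>, then
        \<open>I \<union> Z\<close> is a member and equals the union of \<open>I\<close> with the
        other part; compatibility with that part then forces \<open>I\<close> to contain it
        too.\<close>
      have half: "Z \<subset> I" if XY: "X \<subset> I" "compat B I Y" "X \<in> B" "Y \<in> B" "X \<union> Y = Z" "Y \<noteq> {}" for X Y
      proof (rule ccontr)
        assume n: "\<not> Z \<subset> I"
        have "I \<union> Z \<in> B" using above [OF VB [OF I]] XY ne [OF XY(3)] 2 by blast
        moreover have "I \<union> Z = I \<union> Y" using XY by auto
        ultimately have "I \<subseteq> Y \<or> Y \<subseteq> I" using XY(2) by (auto simp: compat_def)
        then show False using n XY 2 by auto
      qed
      have "\<not> I \<subseteq> A" "\<not> I \<subseteq> C" using 2 AC by auto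
      show ?thesis
      proof (cases "A \<subseteq> I \<or> C \<subseteq> I")
        case True
        then have "A \<subset> I \<or> C \<subset> I" using \<open>\<not> I \<subseteq> A\<close> \<open>\<not> I \<subseteq> C\<close> by auto
        then have "Z \<subset> I" using half [of A C] half [of C A] 2 AC by (auto simp: Un_commute)
        then show ?thesis by (auto simp: compat_def)
      next
        case False
        then have dis: "I \<inter> A = {}" "I \<union> A \<notin> B" "I \<inter> C = {}" "I \<union> C \<notin> B"
          using 2 \<open>\<not> I \<subseteq> A\<close> \<open>\<not> I \<subseteq> C\<close> by (auto simp: compat_def)
        have "I \<union> Z \<notin> B"
        proof
          assume U: "I \<union> Z \<in> B"
          have "I \<union> A \<in> B \<or> I \<union> C \<in> B \<or> A \<union> C \<in> B"
          proof (rule union_of_two [OF fb(1) VB [OF I] AC(1,2) U])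
            show "I \<union> Z \<subseteq> I \<union> A \<union> C" "\<not> I \<union> Z \<subseteq> I" "\<not> I \<union> Z \<subseteq> A" "\<not> I \<union> Z \<subseteq> C"
              using AC dis ne [OF VB [OF I]] by blast+
          qed
          then show False using dis AC Z by simp
        qed
        moreover have "Z \<union> I \<noteq> Z" using 2(3) by auto
        ultimately show ?thesis using dis AC by (auto simp: compat_def Un_commute)
      qed
    qed (auto simp: compat_def)
  qed
  have acB: "compat B A C" using AC Z by (auto simp: compat_def)
  define L where "L = {I \<in> ?V - {A, C}. compat B I A \<and> compat B I C}"
  have main: "clique_poly (compat ?B) (nonmax ?B) u =
      clique_poly (compat B) ?V u + u * (1 + u) * clique_poly (compat B) L u"
    unfolding V' L_def
    by (rule clique_poly_subdivide [OF finite_nonmax [OF b] ACV symp_compat symp_compat acB])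
      (erule (1) old, erule new)
  have Leq: "L = {I \<in> ?V - {A, C}. compat ?B Z I}" using new by (auto simp: L_def)
  define L1 where "L1 = {I \<in> L. I \<subseteq> Z}"
  define L2 where "L2 = {I \<in> L. \<not> I \<subseteq> Z}"
  have L12: "L = L1 \<union> L2" "L1 \<inter> L2 = {}" by (auto simp: L1_def L2_def)
  have finL: "finite L1" "finite L2"
    using finite_nonmax [OF b] finite_subset [of _ ?V] by (auto simp: L1_def L2_def L_def)
  have between: "compat B I J" if "I \<in> L1" "J \<in> L2" for I J
  proof -
    have IJ: "I \<in> B" "I \<subseteq> Z" "J \<in> B" "\<not> J \<subseteq> Z" "compat ?B Z J"
      using that VB by (auto simp: L1_def L2_def Leq)
    show ?thesis
    proof (cases "Z \<subseteq> J")
      case True then show ?thesis using IJ by (auto simp: compat_def)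
    next
      case False
      then have J: "Z \<inter> J = {}" "Z \<union> J \<notin> B" using IJ by (auto simp: compat_def)
      have "I \<union> J \<notin> B"
      proof
        assume U: "I \<union> J \<in> B"
        have "I \<union> J \<union> Z \<in> B" using above [OF U] IJ ne [OF IJ(1)] by auto
        moreover have "I \<union> J \<union> Z = Z \<union> J" using IJ by auto
        ultimately show False using J by simp
      qed
      then show ?thesis using J IJ by (auto simp: compat_def)
    qed
  qed
  have "clique_poly (compat B) L u = clique_poly (compat B) L1 u * clique_poly (compat B) L2 u"
    unfolding L12(1) by (rule clique_poly_join [OF finL L12(2) symp_compat between])
  moreover have "clique_poly (compat B) L1 u =
      clique_poly (compat (restriction Z B)) (nonmax (restriction Z B)) u"
  proof -
    have "L1 = nonmax (restriction Z B)"
    proof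
      show "L1 \<subseteq> nonmax (restriction Z B)"
      proof
        fix I assume "I \<in> L1"
        then have I: "I \<in> B" "I \<subseteq> Z" "I \<noteq> A" "I \<noteq> C" using VB by (auto simp: L1_def L_def)
        then have "I \<subset> A \<or> I \<subset> C" using below [OF I(1,2)] by blast
        moreover have "A \<in> restriction Z B" "C \<in> restriction Z B" "I \<in> restriction Z B"
          using AC I by (auto simp: restriction_def)
        ultimately show "I \<in> nonmax (restriction Z B)" unfolding nonmax_def by blast
      qed
      show "nonmax (restriction Z B) \<subseteq> L1"
      proof
        fix I assume "I \<in> nonmax (restriction Z B)"
        then obtain J where IJ: "I \<in> B" "J \<in> B" "I \<subseteq> Z" "J \<subseteq> Z" "I \<subset> J"
          by (auto simp: nonmax_def restriction_def)
        then have "I \<in> ?V" "I \<noteq> A" "I \<noteq> C" using below [OF IJ(2,4)] AC by (auto simp: nonmax_def)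
        moreover have "compat ?B Z I" using IJ by (auto simp: compat_def)
        ultimately show "I \<in> L1" using IJ(3) by (simp add: L1_def Leq)
      qed
    qed
    moreover have "clique_poly (compat B) L1 u = clique_poly (compat (restriction Z B)) L1 u"
      by (rule clique_poly_cong) (auto simp: compat_def restriction_def L1_def)
    ultimately show ?thesis by simp
  qed
  moreover have "clique_poly (compat B) L2 u =
      clique_poly (compat (contraction Z B)) (nonmax (contraction Z B)) u"
  proof -
    have L2: "{I \<in> nonmax ?B. \<not> I \<subseteq> Z \<and> compat ?B Z I} = L2"
      unfolding V' L2_def Leq using AC by auto
    have con: "contraction Z ?B = contraction Z B" by (auto simp: contraction_def)
    note nc = nonmax_contraction [OF fb(2) insertI1, unfolded L2 con]
    have "clique_poly (compat (contraction Z B)) ((\<lambda>I. I - Z) ` L2) u =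
        clique_poly (compat ?B) L2 u"
      by (rule clique_poly_image [OF nc(2)]) (erule (1) nc(3))
    moreover have "clique_poly (compat ?B) L2 u = clique_poly (compat B) L2 u"
    proof (rule clique_poly_cong)
      fix I J assume "I \<in> L2" "J \<in> L2"
      then show "compat ?B I J = compat B I J"
        using old [of I J] by (auto simp: L2_def L_def doubleton_eq_iff)
    qed
    ultimately show ?thesis using nc(1) by simp
  qed
  ultimately show ?thesis using main by simp
qed

text \<open>The restriction has exactly the maximal members \<open>A\<close> and \<open>C\<close>.
  Contraction preserves the number of maximal members, since they are disjoint and none of them lies
  inside \<open>Z\<close>.\<close>

lemma bdim_essential_step:
  assumes fb: "flag_building S B" "flag_building S (insert Z B)" and Z: "Z \<notin> B"
    and M: "M \<in> B" "Z \<subset> M"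
  shows "bdim S (insert Z B) = bdim S B"
    and "bdim Z (restriction Z B) + bdim (S - Z) (contraction Z B) + 2 = bdim S B"
proof -
  note b = flag_buildingD(1) [OF fb(1)] and b' = flag_buildingD(1) [OF fb(2)]
  obtain A C where AC: "A \<in> B" "C \<in> B" "A \<inter> C = {}" "A \<union> C = Z" "A \<noteq> {}" "C \<noteq> {}"
    and below: "\<And>I. I \<in> B \<Longrightarrow> I \<subseteq> Z \<Longrightarrow> I \<subseteq> A \<or> I \<subseteq> C"
    using insert_decomposition [OF fb Z] by metis
  have ZS: "Z \<subseteq> S" using building_setD(3) [OF b'] by auto
  have finS: "finite S" by (rule building_setD(1) [OF b])
  have "maximals (insert Z B) = maximals B" using M Z by (auto simp: maximals_def)
  then show "bdim S (insert Z B) = bdim S B" by (simp add: bdim_def)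
  have "maximals (restriction Z B) = {A, C}"
  proof
    show "maximals (restriction Z B) \<subseteq> {A, C}"
    proof
      fix I assume I: "I \<in> maximals (restriction Z B)"
      then have "I \<subseteq> A \<or> I \<subseteq> C" using below [of I] by (auto simp: maximals_def restriction_def)
      moreover have "A \<in> restriction Z B" "C \<in> restriction Z B" using AC
          by (auto simp: restriction_def)
      ultimately show "I \<in> {A, C}" using I unfolding maximals_def by blast
    qed
    show "{A, C} \<subseteq> maximals (restriction Z B)"
    proof -
      have "\<not> A \<subset> J" "\<not> C \<subset> J" if "J \<in> B" "J \<subseteq> Z" for J using below [OF that] AC by blast+
      then show ?thesis using AC by (auto simp: maximals_def restriction_def)
    qed
  qed
  moreover have "A \<noteq> C" using AC by auto
  ultimately have "card (maximals (restriction Z B)) = 2" by simp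
  moreover have "2 \<le> card Z"
  proof -
    have "finite A" "finite C" using AC building_finite [OF b] by auto
    then have "0 < card A" "0 < card C" "card Z = card A + card C"
      using AC by (auto simp: card_gt_0_iff card_Un_disjoint)
    then show ?thesis by simp
  qed
  ultimately have r: "bdim Z (restriction Z B) + 2 = card Z" by (simp add: bdim_def)
  obtain M0 where M0: "M0 \<in> maximals B" "M \<subseteq> M0" using exists_maximal_superset [OF b M(1)] by auto
  have comp: "I = M0 \<or> I \<inter> Z = {}" if "I \<in> maximals B" for I
  proof (rule ccontr)
    assume n: "\<not> ?thesis"
    then have "I \<inter> M0 \<noteq> {}" using M M0 by auto
    then show False
      using n maximals_disjoint [OF b that, of M0] maximals_disjoint [OF b M0(1), of I] that M0(1)
      by (auto simp: maximals_def Int_commute)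
  qed
  have notsub: "\<not> I \<subseteq> Z" if "I \<in> maximals B" for I
    using comp [OF that] M M0 building_setD(2) [OF b, of I] that by (auto simp: maximals_def)
  have meet: "I = J" if "I \<in> maximals B" "J \<in> maximals B" "I \<inter> J \<noteq> {}" for I J
    using maximals_disjoint [OF b that(1), of J] maximals_disjoint [OF b that(2), of I] that
    by (auto simp: maximals_def Int_commute)
  have "maximals (contraction Z B) = (\<lambda>I. I - Z) ` maximals B"
  proof
    show "maximals (contraction Z B) \<subseteq> (\<lambda>I. I - Z) ` maximals B"
    proof
      fix K assume K: "K \<in> maximals (contraction Z B)"
      then obtain J where J: "J \<in> B" "K = J - Z" by (auto simp: maximals_def contraction_def)
      obtain I where I: "I \<in> maximals B" "J \<subseteq> I" using exists_maximal_superset [OF b J(1)] by auto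
      then have "I - Z \<in> contraction Z B"
        using notsub [OF I(1)] unfolding contraction_def maximals_def by blast
      then have "\<not> K \<subset> I - Z" using K by (auto simp: maximals_def)
      then have "K = I - Z" using J I(2) by blast
      then show "K \<in> (\<lambda>I. I - Z) ` maximals B" using I by blast
    qed
    show "(\<lambda>I. I - Z) ` maximals B \<subseteq> maximals (contraction Z B)"
    proof
      fix K assume "K \<in> (\<lambda>I. I - Z) ` maximals B"
      then obtain I where I: "I \<in> maximals B" "K = I - Z" by auto
      then have "I \<in> B" by (simp add: maximals_def)
      then have KK: "K \<in> contraction Z B" using notsub [OF I(1)] I(2) unfolding contraction_def
          by blast
      have "\<not> K \<subset> K'" if K': "K' \<in> contraction Z B" for K'
      proof
        assume lt: "K \<subset> K'"
        obtain J where J: "J \<in> B" "K' = J - Z" using K' by (auto simp: contraction_def)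
        obtain I' where I': "I' \<in> maximals B" "J \<subseteq> I'" using exists_maximal_superset [OF b J(1)]
            by auto
        have "I \<inter> I' \<noteq> {}" using notsub [OF I(1)] I(2) lt J I' by auto
        then have "I = I'" using meet I I' by auto
        then show False using lt I J I' by auto
      qed
      then show "K \<in> maximals (contraction Z B)" using KK by (auto simp: maximals_def)
    qed
  qed
  moreover have "inj_on (\<lambda>I. I - Z) (maximals B)"
  proof (rule inj_onI)
    fix I J assume IJ: "I \<in> maximals B" "J \<in> maximals B" "I - Z = J - Z"
    then have "I \<inter> J \<noteq> {}" using notsub [OF IJ(1)] by blast
    then show "I = J" using meet IJ by blast
  qed
  ultimately have cc: "card (maximals (contraction Z B)) = card (maximals B)"
      by (simp add: card_image)
  have "card (maximals (contraction Z B)) \<le> card (S - Z)"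
    using card_maximals_le flag_buildingD(1) [OF contraction_flag [OF fb(1)]] by blast
  then show "bdim Z (restriction Z B) + bdim (S - Z) (contraction Z B) + 2 = bdim S B"
    using r cc ZS finS card_mono [OF finS ZS] by (simp add: bdim_def card_Diff_subset finite_subset)
qed

text \<open>\<open>A\<close> and \<open>C\<close> were maximal members. They become two new
  vertices, incompatible with each other and compatible with all old vertices: the complex is
  suspended.\<close>

theorem clique_poly_merge_step:
  assumes fb: "flag_building S B" "flag_building S (insert Z B)" and Z: "Z \<notin> B"
    and M: "\<not> (\<exists>M\<in>B. Z \<subset> M)"
  shows "clique_poly (compat (insert Z B)) (nonmax (insert Z B)) u =
      (1 + 2 * u) * clique_poly (compat B) (nonmax B) u"
    and "bdim S (insert Z B) = Suc (bdim S B)"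
proof -
  let ?B = "insert Z B" and ?V = "nonmax B"
  note b = flag_buildingD(1) [OF fb(1)] and b' = flag_buildingD(1) [OF fb(2)]
  obtain A C where AC: "A \<in> B" "C \<in> B" "A \<inter> C = {}" "A \<union> C = Z" "A \<noteq> {}" "C \<noteq> {}"
    and below: "\<And>I. I \<in> B \<Longrightarrow> I \<subseteq> Z \<Longrightarrow> I \<subseteq> A \<or> I \<subseteq> C"
    and above: "\<And>I. I \<in> B \<Longrightarrow> I \<inter> Z \<noteq> {} \<Longrightarrow> \<not> I \<subseteq> Z \<Longrightarrow> I \<union> Z \<in> B"
    using insert_decomposition [OF fb Z] by blast
  have ne: "I \<noteq> {}" if "I \<in> B" for I using building_setD(2) [OF b that] .
  have dich: "I \<subseteq> A \<or> I \<subseteq> C \<or> I \<inter> Z = {}" if I: "I \<in> B" for I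
  proof (rule ccontr)
    assume n: "\<not> ?thesis"
    then have "\<not> I \<subseteq> Z" using below [OF I] by blast
    then have "I \<union> Z \<in> B" using above [OF I] n by blast
    moreover have "Z \<subset> I \<union> Z" using \<open>\<not> I \<subseteq> Z\<close> by blast
    ultimately show False using M by blast
  qed
  have ACmax: "A \<in> maximals B" "C \<in> maximals B"
    using AC dich unfolding maximals_def by blast+
  have VB: "I \<in> B" if "I \<in> ?V" for I using that by (auto simp: nonmax_def)
  have notV: "A \<notin> ?V" "C \<notin> ?V" "A \<noteq> C" using ACmax AC by (auto simp: maximals_def nonmax_def)
  have V': "nonmax ?B = insert A (insert C ?V)"
  proof
    show "insert A (insert C ?V) \<subseteq> nonmax ?B" using AC by (auto simp: nonmax_def)
    show "nonmax ?B \<subseteq> insert A (insert C ?V)"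
    proof
      fix I assume "I \<in> nonmax ?B"
      then obtain J where J: "I \<in> B" "J \<in> ?B" "I \<subset> J" using M by (auto simp: nonmax_def)
      show "I \<in> insert A (insert C ?V)"
      proof (cases "J = Z")
        case True
        then show ?thesis using below [OF J(1)] J AC by (auto simp: nonmax_def)
      next
        case False
        then show ?thesis using J by (auto simp: nonmax_def)
      qed
    qed
  qed
  have vsZ: "I \<union> J \<noteq> Z" if "I \<in> ?V" "J \<in> insert A (insert C ?V)" for I J
  proof
    assume eq: "I \<union> J = Z"
    have I: "I \<subset> A \<or> I \<subset> C" using that(1) below [OF VB [OF that(1)]] notV eq by auto
    have "J \<in> B" using that(2) VB AC by auto
    then have "J \<subseteq> A \<or> J \<subseteq> C" using below eq by auto
    moreover have "A \<subseteq> I \<union> J" "C \<subseteq> I \<union> J" using eq AC by auto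
    ultimately show False using I AC by blast
  qed
  have cAC: "compat ?B X I" if X: "X = A \<or> X = C" and I: "I \<in> ?V" for X I
  proof -
    have XM: "X \<in> maximals B" using X ACmax by auto
    show ?thesis
    proof (cases "X \<inter> I = {}")
      case True
      have "X \<union> I \<notin> B"
      proof
        assume "X \<union> I \<in> B"
        moreover have "X \<subset> X \<union> I" using True ne [OF VB [OF I]] by auto
        ultimately show False using XM unfolding maximals_def by blast
      qed
      moreover have "X \<union> I \<noteq> Z" using vsZ [OF I, of X] X by (auto simp: Un_commute)
      ultimately show ?thesis using True by (auto simp: compat_def)
    next
      case False
      then show ?thesis using maximals_disjoint [OF b XM VB [OF I]] by (auto simp: compat_def)
    qed
  qed
  have nAC: "\<not> compat ?B A C" using AC by (auto simp: compat_def)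
  have same: "clique_poly (compat ?B) ?V u = clique_poly (compat B) ?V u"
    using vsZ by (intro clique_poly_cong) (auto simp: compat_def)
  have "{I \<in> insert C ?V. compat ?B A I} = ?V" using nAC cAC notV by auto
  moreover have "{I \<in> ?V. compat ?B C I} = ?V" using cAC by auto
  ultimately have "clique_poly (compat ?B) (nonmax ?B) u =
      clique_poly (compat ?B) ?V u + u * clique_poly (compat ?B) ?V u + u * clique_poly (compat ?B)
          ?V u"
    unfolding V'
    using clique_poly_insert [of "insert C ?V" A "compat ?B" u]
      clique_poly_insert [of ?V C "compat ?B" u] notV finite_nonmax [OF b] symp_compat [of ?B]
          by simp
  then show "clique_poly (compat ?B) (nonmax ?B) u = (1 + 2 * u) * clique_poly (compat B) ?V u"
    using same by (simp add: algebra_simps)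
  have "maximals ?B = insert Z (maximals B - {A, C})"
  proof
    show "maximals ?B \<subseteq> insert Z (maximals B - {A, C})" using AC by (auto simp: maximals_def)
    show "insert Z (maximals B - {A, C}) \<subseteq> maximals ?B"
    proof
      fix I assume I: "I \<in> insert Z (maximals B - {A, C})"
      show "I \<in> maximals ?B"
      proof (cases "I = Z")
        case True then show ?thesis using M by (auto simp: maximals_def)
      next
        case False
        then have IM: "I \<in> maximals B" "I \<noteq> A" "I \<noteq> C" "I \<in> B" using I by (auto simp: maximals_def)
        have "\<not> I \<subset> Z" using below [OF IM(4)] IM AC by (auto simp: maximals_def)
        then show ?thesis using IM by (auto simp: maximals_def)
      qed
    qed
  qed
  moreover have "Z \<notin> maximals B - {A, C}" using Z by (auto simp: maximals_def)
  moreover have finM: "finite (maximals B)"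
    using finite_subset [OF _ finite_building [OF b]] by (auto simp: maximals_def)
  moreover have "card (maximals B - {A, C}) = card (maximals B) - 2"
    using ACmax notV(3) finM by (simp add: card_Diff_subset)
  moreover have "2 \<le> card (maximals B)"
    using card_mono [OF finM, of "{A, C}"] ACmax notV(3) by simp
  ultimately have "Suc (card (maximals ?B)) = card (maximals B)" by simp
  then show "bdim S ?B = Suc (bdim S B)"
    using card_maximals_le [OF b] by (simp add: bdim_def)
qed

subsection \<open>Filtrations by flag building sets\<close>

text \<open>Idle steps are allowed, so that restriction and contraction keep the numbering of the
  stages and the vertices of their graphs are vertices of the original one.\<close>

definition filtration :: "'a set \<Rightarrow> nat \<Rightarrow> (nat \<Rightarrow> 'a set set) \<Rightarrow> bool" where
  "filtration S k F \<longleftrightarrow> F 0 = (\<lambda>x. {x}) ` S \<and> (\<forall>i\<le>k. flag_building S (F i)) \<and>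
     (\<forall>i<k. F (Suc i) = F i \<or> (\<exists>Z. Z \<notin> F i \<and> F (Suc i) = insert Z (F i)))"

text \<open>Meaningful only at a step that adds a set.\<close>

definition newset :: "(nat \<Rightarrow> 'a set set) \<Rightarrow> nat \<Rightarrow> 'a set" where
  "newset F i = the_elem (F (Suc i) - F i)"

text \<open>The stages at which the dual complex gets subdivided, rather than suspended.\<close>

definition essential :: "(nat \<Rightarrow> 'a set set) \<Rightarrow> nat \<Rightarrow> bool" where
  "essential F i \<longleftrightarrow> F (Suc i) \<noteq> F i \<and> (\<exists>J\<in>F i. newset F i \<subset> J)"

definition linked :: "(nat \<Rightarrow> 'a set set) \<Rightarrow> nat \<Rightarrow> nat \<Rightarrow> bool" where
  "linked F i j \<longleftrightarrow> essential (\<lambda>l. restriction (newset F j) (F l)) i \<or>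
     essential (\<lambda>l. contraction (newset F j) (F l)) i"

definition gamma_edge :: "(nat \<Rightarrow> 'a set set) \<Rightarrow> nat \<Rightarrow> nat \<Rightarrow> bool" where
  "gamma_edge F i j \<longleftrightarrow> (i < j \<and> linked F i j) \<or> (j < i \<and> linked F j i)"

definition gamma_verts :: "(nat \<Rightarrow> 'a set set) \<Rightarrow> nat \<Rightarrow> nat set" where
  "gamma_verts F k = {i. i < k \<and> essential F i}"

lemma symp_gamma_edge: "symp (gamma_edge F)"
  by (auto simp: symp_def gamma_edge_def)

lemma newset_insert: "Z \<notin> F i \<Longrightarrow> F (Suc i) = insert Z (F i) \<Longrightarrow> newset F i = Z"
  by (simp add: newset_def insert_Diff_if)

lemma filtration_step:
  "filtration S k F \<Longrightarrow> i < k \<Longrightarrow> F (Suc i) = F i \<or> (\<exists>Z. Z \<notin> F i \<and> F (Suc i) = insert Z (F i))"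
  by (simp add: filtration_def)

lemma newset_mem:
  assumes "filtration S k F" "i < k" "F (Suc i) \<noteq> F i"
  shows "newset F i \<notin> F i" "F (Suc i) = insert (newset F i) (F i)"
proof -
  obtain Z where "Z \<notin> F i" "F (Suc i) = insert Z (F i)"
    using filtration_step [OF assms(1,2)] assms(3) by blast
  then show "newset F i \<notin> F i" "F (Suc i) = insert (newset F i) (F i)"
    using newset_insert by metis+
qed

lemma filtration_mono:
  assumes "filtration S k F" "i \<le> j" "j \<le> k"
  shows "F i \<subseteq> F j"
  using assms(2,3)
proof (induction j rule: dec_induct)
  case (step n)
  then have "F n \<subseteq> F (Suc n)" using filtration_step [OF assms(1), of n] by auto
  then show ?case using step by auto
qed simp

lemma filtration_building: "filtration S k F \<Longrightarrow> i \<le> k \<Longrightarrow> building_set S (F i)"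
  by (auto simp: filtration_def flag_building_def)

lemma filtration_le: "filtration S k F \<Longrightarrow> l \<le> k \<Longrightarrow> filtration S l F"
  by (auto simp: filtration_def)

lemma filtration_restriction:
  assumes F: "filtration S k F" and "Z \<subseteq> S"
  shows "filtration Z k (\<lambda>i. restriction Z (F i))"
  unfolding filtration_def
proof (intro conjI allI impI)
  show "restriction Z (F 0) = (\<lambda>x. {x}) ` Z"
    using F assms(2) by (auto simp: filtration_def restriction_def)
  show "flag_building Z (restriction Z (F i))" if "i \<le> k" for i
    using F assms(2) that by (auto simp: filtration_def intro: restriction_flag)
  fix i assume "i < k"
  then consider "F (Suc i) = F i" | X where "X \<notin> F i" "F (Suc i) = insert X (F i)"
    using filtration_step [OF F] by blast
  then show "restriction Z (F (Suc i)) = restriction Z (F i) \<or>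
      (\<exists>X. X \<notin> restriction Z (F i) \<and> restriction Z (F (Suc i)) = insert X (restriction Z (F i)))"
  proof cases
    case (2 X)
    show ?thesis
    proof (cases "X \<subseteq> Z")
      case True
      then have "restriction Z (F (Suc i)) = insert X (restriction Z (F i))"
        using 2 by (auto simp: restriction_def)
      then show ?thesis using 2(1) by (auto simp: restriction_def)
    next
      case False
      then show ?thesis using 2 by (auto simp: restriction_def)
    qed
  qed simp
qed

lemma contraction_insert:
  "contraction Z (insert X B) =
      (if X \<subseteq> Z then contraction Z B else insert (X - Z) (contraction Z B))"
  by (auto simp: contraction_def)

lemma filtration_contraction:
  assumes F: "filtration S k F"
  shows "filtration (S - Z) k (\<lambda>i. contraction Z (F i))"
  unfolding filtration_def
proof (intro conjI allI impI)
  have "{x} \<in> contraction Z (F 0)" if "x \<in> S - Z" for x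
    using F that unfolding filtration_def contraction_def by (intro CollectI exI [of _ "{x}"]) auto
  moreover have "I \<in> (\<lambda>x. {x}) ` (S - Z)" if "I \<in> contraction Z (F 0)" for I
    using F that by (auto simp: filtration_def contraction_def)
  ultimately show "contraction Z (F 0) = (\<lambda>x. {x}) ` (S - Z)" by blast
  show "flag_building (S - Z) (contraction Z (F i))" if "i \<le> k" for i
    using F that by (auto simp: filtration_def intro: contraction_flag)
  fix i assume "i < k"
  then consider "F (Suc i) = F i" | X where "X \<notin> F i" "F (Suc i) = insert X (F i)"
    using filtration_step [OF F] by blast
  then show "contraction Z (F (Suc i)) = contraction Z (F i) \<or>
      (\<exists>X. X \<notin> contraction Z (F i) \<and> contraction Z (F (Suc i)) = insert X (contraction Z (F i)))"
  proof cases
    case (2 X)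
    then show ?thesis
      by (cases "X - Z \<in> contraction Z (F i)") (auto simp: contraction_insert insert_absorb)
  qed simp
qed

section \<open>Essential stages under restriction and contraction\<close>

lemma essential_iff:
  assumes "F (Suc i) = insert X (F i)"
  shows "essential F i \<longleftrightarrow> X \<notin> F i \<and> (\<exists>J\<in>F i. X \<subset> J)"
proof (cases "X \<in> F i")
  case True
  then have "F (Suc i) = F i" using assms by auto
  then show ?thesis using True by (simp add: essential_def)
next
  case False
  then show ?thesis using assms newset_insert [of X F i] by (auto simp: essential_def)
qed

lemma essential_restriction_iff:
  assumes "F (Suc i) = insert X (F i)" "X \<notin> F i"
  shows "essential (\<lambda>l. restriction Y (F l)) i \<longleftrightarrow> X \<subseteq> Y \<and> (\<exists>J\<in>F i. X \<subset> J \<and> J \<subseteq> Y)"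
proof (cases "X \<subseteq> Y")
  case True
  then have "restriction Y (F (Suc i)) = insert X (restriction Y (F i))"
    using assms by (auto simp: restriction_def)
  then show ?thesis
    using essential_iff [of "\<lambda>l. restriction Y (F l)" i X] True assms(2)
    by (auto simp: restriction_def)
next
  case False
  then have "restriction Y (F (Suc i)) = restriction Y (F i)"
    using assms by (auto simp: restriction_def)
  then show ?thesis using False by (simp add: essential_def)
qed

lemma essential_contraction_iff:
  assumes "F (Suc i) = insert X (F i)" "X \<notin> F i"
  shows "essential (\<lambda>l. contraction Y (F l)) i \<longleftrightarrow>
    \<not> X \<subseteq> Y \<and> (\<forall>J\<in>F i. J - Y \<noteq> X - Y) \<and> (\<exists>J\<in>F i. X - Y \<subset> J - Y)"
proof (cases "X \<subseteq> Y")
  case True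
  then have "contraction Y (F (Suc i)) = contraction Y (F i)"
    using assms by (simp add: contraction_insert)
  then show ?thesis using True by (simp add: essential_def)
next
  case False
  then have "contraction Y (F (Suc i)) = insert (X - Y) (contraction Y (F i))"
    using assms by (simp add: contraction_insert)
  then have "essential (\<lambda>l. contraction Y (F l)) i \<longleftrightarrow>
      X - Y \<notin> contraction Y (F i) \<and> (\<exists>J\<in>contraction Y (F i). X - Y \<subset> J)"
    using essential_iff [of "\<lambda>l. contraction Y (F l)" i "X - Y"] by simp
  moreover have "X - Y \<notin> contraction Y (F i) \<longleftrightarrow> (\<forall>J\<in>F i. J - Y \<noteq> X - Y)"
    using False by (auto simp: contraction_def)
  moreover have "(\<exists>J\<in>contraction Y (F i). X - Y \<subset> J) \<longleftrightarrow> (\<exists>J\<in>F i. X - Y \<subset> J - Y)"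
    by (auto simp: contraction_def)
  ultimately show ?thesis using False by simp
qed

lemma essentialD:
  assumes F: "filtration S k F" and i: "i < k" and e: "essential F i"
  shows "newset F i \<notin> F i" "F (Suc i) = insert (newset F i) (F i)"
    "\<exists>J\<in>F i. newset F i \<subset> J"
  using newset_mem [OF F i] e by (auto simp: essential_def)

lemma essential_restrictionD:
  assumes F: "filtration S k F" and i: "i < k" and e: "essential (\<lambda>l. restriction Y (F l)) i"
  shows "essential F i" "newset (\<lambda>l. restriction Y (F l)) i = newset F i" "newset F i \<subseteq> Y"
    "\<exists>J\<in>F i. newset F i \<subset> J \<and> J \<subseteq> Y"
proof -
  have ne: "F (Suc i) \<noteq> F i" using e by (auto simp: essential_def)
  note X = newset_mem [OF F i ne]
  have iff: "newset F i \<subseteq> Y" "\<exists>J\<in>F i. newset F i \<subset> J \<and> J \<subseteq> Y"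
    using e essential_restriction_iff [OF X(2,1)] by blast+
  then show "newset F i \<subseteq> Y" "\<exists>J\<in>F i. newset F i \<subset> J \<and> J \<subseteq> Y" .
  show "essential F i" using iff ne unfolding essential_def by blast
  have "restriction Y (F (Suc i)) = insert (newset F i) (restriction Y (F i))"
    using X iff(1) by (auto simp: restriction_def)
  then show "newset (\<lambda>l. restriction Y (F l)) i = newset F i"
    using X(1) by (intro newset_insert) (auto simp: restriction_def)
qed

text \<open>The contraction only supplies a member that exceeds the new set outside
  \<open>Y\<close>. Its union with the new set is a member at stage \<open>Suc i\<close>, strictly
  above the new set and hence already present in \<open>F i\<close>.\<close>

lemma essential_contractionD:
  assumes F: "filtration S k F" and i: "i < k" and e: "essential (\<lambda>l. contraction Y (F l)) i"
  shows "essential F i" "newset (\<lambda>l. contraction Y (F l)) i = newset F i - Y" "\<not> newset F i \<subseteq> Y"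
    "\<forall>J\<in>F i. J - Y \<noteq> newset F i - Y"
proof -
  have ne: "F (Suc i) \<noteq> F i" using e by (auto simp: essential_def)
  note X = newset_mem [OF F i ne]
  have iff: "\<not> newset F i \<subseteq> Y" "\<forall>J\<in>F i. J - Y \<noteq> newset F i - Y" "\<exists>J\<in>F i. newset F i - Y \<subset> J - Y"
    using e essential_contraction_iff [OF X(2,1)] by blast+
  then show "\<not> newset F i \<subseteq> Y" "\<forall>J\<in>F i. J - Y \<noteq> newset F i - Y" by blast+
  obtain J where J: "J \<in> F i" "newset F i - Y \<subset> J - Y" using iff(3) by blast
  have "newset F i \<union> J \<in> F (Suc i)"
    using filtration_building [OF F, of "Suc i"] i X(2) J iff(1)
    by (intro building_union [of S]) auto
  moreover have "newset F i \<subset> newset F i \<union> J" using J by auto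
  ultimately have "newset F i \<union> J \<in> F i" using X(2) by auto
  then show "essential F i"
    using ne \<open>newset F i \<subset> newset F i \<union> J\<close> unfolding essential_def by blast
  have "contraction Y (F (Suc i)) = insert (newset F i - Y) (contraction Y (F i))"
    using X(2) iff(1) by (simp add: contraction_insert)
  moreover have "newset F i - Y \<notin> contraction Y (F i)" using iff(2) by (auto simp: contraction_def)
  ultimately show "newset (\<lambda>l. contraction Y (F l)) i = newset F i - Y" by (intro newset_insert)
qed

text \<open>A member strictly above the new set stays at least as large outside \<open>Y\<close>,
  and strictly larger if the trace of the new set is new.\<close>

lemma essential_contraction:
  assumes F: "filtration S k F" and i: "i < k" and e: "essential F i"
  shows "essential (\<lambda>l. contraction Y (F l)) i \<longleftrightarrow>
    \<not> newset F i \<subseteq> Y \<and> (\<forall>J\<in>F i. J - Y \<noteq> newset F i - Y)"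
proof -
  note X = essentialD [OF F i e]
  obtain J where J: "J \<in> F i" "newset F i \<subset> J" using X(3) by blast
  have *: "\<exists>J\<in>F i. newset F i - Y \<subset> J - Y" if "\<forall>J\<in>F i. J - Y \<noteq> newset F i - Y"
  proof
    show "newset F i - Y \<subset> J - Y"
    proof
      show "newset F i - Y \<noteq> J - Y" using bspec [OF that J(1)] by (rule not_sym)
    qed (use J(2) in blast)
  qed (rule J(1))
  show ?thesis unfolding essential_contraction_iff [OF X(2,1)] using * by argo
qed

section \<open>Invariance of adjacency between stages\<close>

lemma linked_iff:
  assumes F: "filtration S k F" and i: "i < k" and e: "essential F i"
  shows "linked F i j \<longleftrightarrow>
    (newset F i \<subseteq> newset F j \<and> (\<exists>J\<in>F i. newset F i \<subset> J \<and> J \<subseteq> newset F j)) \<or>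
    (\<not> newset F i \<subseteq> newset F j \<and> (\<forall>J\<in>F i. J - newset F j \<noteq> newset F i - newset F j))"
  unfolding linked_def essential_restriction_iff [OF essentialD(2,1) [OF F i e]]
    essential_contraction [OF F i e] ..

text \<open>Both new sets lie inside \<open>Z\<close>, and so does every member that decides one of
  the alternatives of \<open>linked_iff\<close>.\<close>

lemma linked_restriction:
  assumes F: "filtration S k F" and ij: "i < j" "j < k" and Z: "Z \<subseteq> S"
    and ei: "essential (\<lambda>l. restriction Z (F l)) i" and ej: "essential (\<lambda>l. restriction Z (F l)) j"
  shows "linked (\<lambda>l. restriction Z (F l)) i j \<longleftrightarrow> linked F i j"
proof -
  let ?R = "\<lambda>l. restriction Z (F l)"
  have ik: "i < k" using ij by simp
  note I = essential_restrictionD [OF F ik ei] and J = essential_restrictionD [OF F ij(2) ej]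
  let ?X = "newset F i" and ?Y = "newset F j"
  have outer: "(\<forall>J\<in>?R i. J - ?Y \<noteq> ?X - ?Y) \<longleftrightarrow> (\<forall>J\<in>F i. J - ?Y \<noteq> ?X - ?Y)"
  proof
    assume a: "\<forall>J\<in>?R i. J - ?Y \<noteq> ?X - ?Y"
    show "\<forall>J\<in>F i. J - ?Y \<noteq> ?X - ?Y"
    proof (intro ballI notI)
      fix K assume K: "K \<in> F i" "K - ?Y = ?X - ?Y"
      then have "K \<subseteq> Z" using I(3) J(3) by auto
      then have "K \<in> ?R i" using K by (simp add: restriction_def)
      then show False using a K(2) by blast
    qed
  qed (simp add: restriction_def)
  have inner: "(\<exists>J\<in>?R i. ?X \<subset> J \<and> J \<subseteq> ?Y) \<longleftrightarrow> (\<exists>J\<in>F i. ?X \<subset> J \<and> J \<subseteq> ?Y)"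
    using J(3) unfolding restriction_def by blast
  show ?thesis
    unfolding linked_iff [OF filtration_restriction [OF F Z] ik ei] linked_iff [OF F ik I(1)]
      I(2) J(2) outer inner ..
qed

text \<open>Otherwise the union of \<open>T\<close> with the set added at stage \<open>j\<close>
  would be an older member with the same trace outside \<open>Z\<close>, and stage \<open>j\<close>
  would add nothing to the contraction.\<close>

lemma new_contraction_absorbs:
  assumes F: "filtration S k F" and j: "j < k" and ej: "essential (\<lambda>l. contraction Z (F l)) j"
    and T: "T \<in> F j" "T \<subseteq> newset F j \<union> Z" "T \<inter> newset F j \<noteq> {}"
  shows "T \<subseteq> newset F j"
proof (rule ccontr)
  let ?Y = "newset F j"
  assume n: "\<not> T \<subseteq> ?Y"
  note J = essential_contractionD [OF F j ej]
  note Y = essentialD [OF F j J(1)]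
  have "T \<union> ?Y \<in> F (Suc j)"
    using filtration_building [OF F, of "Suc j"] j Y(2) T by (intro building_union [of S]) auto
  then have "T \<union> ?Y \<in> F j" using n Y(2) by auto
  moreover have "(T \<union> ?Y) - Z = ?Y - Z" using T by auto
  ultimately show False using J(4) by blast
qed

text \<open>The alternatives of \<open>linked_iff\<close> are compared one by one. By
  \<open>new_contraction_absorbs\<close>, inclusion in the later set \<open>?Y\<close> can be tested
  outside \<open>Z\<close>. The delicate point is a member that agrees with \<open>?X\<close>
  outside \<open>?Y \<union> Z\<close>: there must then be one that agrees with \<open>?X\<close>
  outside \<open>?Y\<close> alone.\<close>

lemma linked_contraction:
  assumes F: "filtration S k F" and ij: "i < j" "j < k"
    and ei: "essential (\<lambda>l. contraction Z (F l)) i" and ej: "essential (\<lambda>l. contraction Z (F l)) j"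
  shows "linked (\<lambda>l. contraction Z (F l)) i j \<longleftrightarrow> linked F i j"
proof -
  let ?C = "\<lambda>l. contraction Z (F l)"
  have ik: "i < k" using ij by simp
  note I = essential_contractionD [OF F ik ei] and J = essential_contractionD [OF F ij(2) ej]
  let ?X = "newset F i" and ?Y = "newset F j"
  note X = essentialD [OF F ik I(1)] and Y = essentialD [OF F ij(2) J(1)]
  have sub: "F (Suc i) \<subseteq> F j" using filtration_mono [OF F, of "Suc i" j] ij by simp
  have absorb: "T \<subseteq> ?Y" if "T \<in> F (Suc i)" "T \<subseteq> ?Y \<union> Z" "T \<inter> ?Y \<noteq> {}" for T
    using new_contraction_absorbs [OF F ij(2) ej] that sub by blast
  have fb: "flag_building S (F (Suc i))" using F ij by (auto simp: filtration_def)
  note b = flag_buildingD(1) [OF fb]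
  have bi: "building_set S (F i)" using filtration_building [OF F] ik by simp
  have XF: "?X \<in> F (Suc i)" and Fi: "F i \<subseteq> F (Suc i)" using X(2) by auto
  have sub_iff: "?X - Z \<subseteq> ?Y - Z \<longleftrightarrow> ?X \<subseteq> ?Y"
  proof
    assume "?X - Z \<subseteq> ?Y - Z"
    then show "?X \<subseteq> ?Y" using absorb [OF XF] I(3) by blast
  qed auto
  have inner: "(\<exists>J\<in>?C i. ?X - Z \<subset> J \<and> J \<subseteq> ?Y - Z) \<longleftrightarrow> (\<exists>J\<in>F i. ?X \<subset> J \<and> J \<subseteq> ?Y)"
    if XY: "?X \<subseteq> ?Y"
  proof
    assume "\<exists>J\<in>F i. ?X \<subset> J \<and> J \<subseteq> ?Y"
    then obtain K where K: "K \<in> F i" "?X \<subset> K" "K \<subseteq> ?Y" by blast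
    then have "K - Z \<in> ?C i" using I(3) by (auto simp: contraction_def)
    moreover have "K - Z \<noteq> ?X - Z" using I(4) K by blast
    ultimately show "\<exists>J\<in>?C i. ?X - Z \<subset> J \<and> J \<subseteq> ?Y - Z"
      using K by (intro bexI [of _ "K - Z"]) auto
  next
    assume "\<exists>J\<in>?C i. ?X - Z \<subset> J \<and> J \<subseteq> ?Y - Z"
    then obtain K where K: "K \<in> F i" "?X - Z \<subset> K - Z" "K - Z \<subseteq> ?Y - Z"
      by (auto simp: contraction_def)
    have KX: "K \<union> ?X \<in> F (Suc i)" using building_union [OF b _ XF, of K] Fi K I(3) by blast
    moreover have lt: "?X \<subset> K \<union> ?X" using K by auto
    ultimately have "K \<union> ?X \<in> F i" using X(2) by auto
    moreover have "K \<union> ?X \<subseteq> ?Y" using absorb [OF KX] K XY I(3) by blast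
    ultimately show "\<exists>J\<in>F i. ?X \<subset> J \<and> J \<subseteq> ?Y" using lt by blast
  qed
  have outer: "(\<forall>J\<in>?C i. J - (?Y - Z) \<noteq> (?X - Z) - (?Y - Z)) \<longleftrightarrow> (\<forall>J\<in>F i. J - ?Y \<noteq> ?X - ?Y)"
    if XY: "\<not> ?X \<subseteq> ?Y"
  proof -
    have "(\<exists>J\<in>?C i. J - (?Y - Z) = (?X - Z) - (?Y - Z)) \<longleftrightarrow> (\<exists>J\<in>F i. J - ?Y = ?X - ?Y)"
    proof
      assume "\<exists>J\<in>F i. J - ?Y = ?X - ?Y"
      then obtain K where K: "K \<in> F i" "K - ?Y = ?X - ?Y" by blast
      have "\<not> ?X - Z \<subseteq> ?Y - Z" using XY sub_iff by blast
      then have "\<not> K \<subseteq> Z" using K by blast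
      then have "K - Z \<in> ?C i" using K by (auto simp: contraction_def)
      moreover have "(K - Z) - (?Y - Z) = (?X - Z) - (?Y - Z)" using K(2) by blast
      ultimately show "\<exists>J\<in>?C i. J - (?Y - Z) = (?X - Z) - (?Y - Z)" by blast
    next
      assume "\<exists>J\<in>?C i. J - (?Y - Z) = (?X - Z) - (?Y - Z)"
      then obtain K where K: "K \<in> F i" "(K - Z) - (?Y - Z) = (?X - Z) - (?Y - Z)"
        by (auto simp: contraction_def)
      have KYZ: "K - (?Y \<union> Z) = ?X - (?Y \<union> Z)" using K(2) by blast
      have XYZ: "\<not> ?X \<subseteq> ?Y \<union> Z" using XY sub_iff by blast
      show "\<exists>J\<in>F i. J - ?Y = ?X - ?Y"
      proof (rule ccontr)
        assume none: "\<not> ?thesis"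
        \<comment> \<open>By absorption \<open>D\<close> lies in \<open>?Y\<close> or in
          \<open>Z\<close>. So \<open>E\<close> differs from \<open>?X\<close> only inside
          \<open>?Y\<close>, against \<open>none\<close>, or only inside \<open>Z\<close>, where the
          trace of \<open>?X\<close> would not be new.\<close>
        have step: False if D: "D \<in> F (Suc i)" "D \<subseteq> ?Y \<union> Z"
            and E: "E \<in> F i" "E \<union> D = ?X \<or> E = ?X \<union> D" for D E
        proof (cases "D \<subseteq> ?Y")
          case True
          then have "E - ?Y = ?X - ?Y" using E by blast
          then show False using none E by blast
        next
          case False
          then have "D \<subseteq> Z" using absorb [OF D] D(2) by blast
          then have "E - Z = ?X - Z" using E by blast
          then show False using I(4) E by blast
        qed
        \<comment> \<open>\<open>exists_complement\<close> brings a larger \<open>K\<close> down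
          towards \<open>?X\<close>: either \<open>K\<close> is \<open>?X\<close> together with one
          member inside \<open>?Y \<union> Z\<close>, or a smaller member strictly above
          \<open>?X\<close> takes its place.\<close>
        have up: False if K: "K \<in> F i" "?X \<subset> K" "K - (?Y \<union> Z) = ?X - (?Y \<union> Z)" for K
          using K
        proof (induction "card K" arbitrary: K rule: less_induct)
          case less
          have KF: "K \<in> F (Suc i)" using less.prems Fi by blast
          obtain K' where K': "K' \<in> F (Suc i)" "?X \<subseteq> K'" "K' \<subset> K" "K - K' \<in> F (Suc i)"
            using exists_complement [OF fb XF KF less.prems(2)] by blast
          show False
          proof (cases "K' = ?X")
            case True
            have "K - K' \<subseteq> ?Y \<union> Z" "K = ?X \<union> (K - K')" using less.prems True by blast+
            then show False using step [OF K'(4)] less.prems(1) by blast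
          next
            case False
            then have "K' \<in> F i" "?X \<subset> K'" using K' X(2) by blast+
            moreover have "K' - (?Y \<union> Z) = ?X - (?Y \<union> Z)" using less.prems K' by blast
            moreover have "card K' < card K"
              using K'(3) building_finite [OF bi less.prems(1)] by (simp add: psubset_card_mono)
            ultimately show False using less.hyps by blast
          qed
        qed
        have KX: "K \<inter> ?X \<noteq> {}" using KYZ XYZ by blast
        then have KX2: "K \<union> ?X \<in> F (Suc i)" using building_union [OF b _ XF, of K] K Fi by blast
        show False
        proof (cases "K \<subseteq> ?X")
          case True
          then have "K \<subset> ?X" using K(1) X(1) by blast
          then obtain K' where K': "K' \<in> F (Suc i)" "K \<subseteq> K'" "K' \<subset> ?X" "?X - K' \<in> F (Suc i)"
            using exists_complement [OF fb _ XF, of K] K(1) Fi by blast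
          then have "K' \<in> F i" using X(2) by blast
          moreover have "?X - K' \<subseteq> ?Y \<union> Z" "K' \<union> (?X - K') = ?X" using KYZ K' by blast+
          ultimately show False using step [OF K'(4)] by blast
        next
          case False
          then have "K \<union> ?X \<in> F i" "?X \<subset> K \<union> ?X" using KX2 X(2) by blast+
          then show False using up [of "K \<union> ?X"] KYZ by blast
        qed
      qed
    qed
    then show ?thesis by blast
  qed
  show ?thesis
    unfolding linked_iff [OF filtration_contraction [OF F] ik ei] linked_iff [OF F ik I(1)]
      I(2) J(2) sub_iff using inner outer by argo
qed

text \<open>If the stage of \<open>?X\<close> comes later, then \<open>?X \<subseteq> Z\<close>, and
  a trace that is new outside \<open>Z\<close> is new outside \<open>?X\<close>. If it comes
  earlier, \<open>new_contraction_absorbs\<close> shows that \<open>?X\<close> lies inside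
  \<open>?Y\<close> or is disjoint from it, and each alternative of \<open>linked_iff\<close>
  settles one of the cases.\<close>

lemma linked_join:
  assumes F: "filtration S k F" and ij: "i < k" "j < k" "i \<noteq> j"
    and ei: "essential (\<lambda>l. restriction Z (F l)) i" and ej: "essential (\<lambda>l. contraction Z (F l)) j"
  shows "gamma_edge F i j"
proof -
  note I = essential_restrictionD [OF F ij(1) ei] and J = essential_contractionD [OF F ij(2) ej]
  let ?X = "newset F i" and ?Y = "newset F j"
  note X = essentialD [OF F ij(1) I(1)] and Y = essentialD [OF F ij(2) J(1)]
  show ?thesis
  proof (cases "i < j")
    case True
    have sub: "F (Suc i) \<subseteq> F j" using filtration_mono [OF F, of "Suc i" j] ij True by simp
    have absorb: "T \<subseteq> ?Y" if "T \<in> F (Suc i)" "T \<subseteq> Z" "T \<inter> ?Y \<noteq> {}" for T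
      using new_contraction_absorbs [OF F ij(2) ej] that sub by blast
    have "building_set S (F (Suc i))" using filtration_building [OF F, of "Suc i"] ij by simp
    then have ne: "?X \<noteq> {}" using building_setD(2) X(2) insertI1 by metis
    have "linked F i j"
    proof (cases "?X \<subseteq> ?Y")
      case True
      obtain K where K: "K \<in> F i" "?X \<subset> K" "K \<subseteq> Z" using I(4) by blast
      then have "K \<subseteq> ?Y" using absorb [of K] X(2) True ne by blast
      then show ?thesis using linked_iff [OF F ij(1) I(1), of j] K True by blast
    next
      case False
      then have dis: "?X \<inter> ?Y = {}" using absorb [of ?X] X(2) I(3) by blast
      have "K - ?Y \<noteq> ?X - ?Y" if K: "K \<in> F i" for K
      proof
        assume eq: "K - ?Y = ?X - ?Y"
        then have "K \<noteq> ?X" using K X(1) by blast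
        then have "K \<inter> ?Y \<noteq> {}" using eq dis by blast
        moreover have "K \<subseteq> ?Y \<union> Z" using eq I(3) by blast
        moreover have "K \<in> F j" using sub K X(2) by blast
        ultimately have "K \<subseteq> ?Y" using new_contraction_absorbs [OF F ij(2) ej] by blast
        then show False using eq dis ne by blast
      qed
      then show ?thesis using linked_iff [OF F ij(1) I(1), of j] False by blast
    qed
    then show ?thesis using True by (simp add: gamma_edge_def)
  next
    case False
    have "\<not> ?Y \<subseteq> ?X" using I(3) J(3) by blast
    moreover have "K - ?X \<noteq> ?Y - ?X" if "K \<in> F j" for K using J(4) that I(3) by blast
    ultimately have "linked F j i" using linked_iff [OF F ij(2) J(1), of i] by blast
    then show ?thesis using False ij by (simp add: gamma_edge_def)
  qed
qed

section \<open>The recursion for clique polynomials along a filtration\<close>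

lemma nonmax_singletons: "nonmax ((\<lambda>x. {x}) ` S) = {}"
  by (auto simp: nonmax_def)

lemma bdim_singletons: "bdim S ((\<lambda>x. {x}) ` S) = 0"
proof -
  have "maximals ((\<lambda>x. {x}) ` S) = (\<lambda>x. {x}) ` S" by (auto simp: maximals_def)
  then show ?thesis by (simp add: bdim_def card_image)
qed

text \<open>The induction leaves \<open>S\<close> and \<open>F\<close> arbitrary, since restriction
  and contraction give filtrations of the same length on other ground sets. The bound on clique
  sizes is what makes the f-polynomial of \<open>\<Gamma>\<close> admissible as a
  \<open>\<gamma>\<close>-polynomial; it follows the same recursion, a new vertex being paid for by
  the drop of the dimensions by 2.\<close>

theorem clique_poly_filtration:
  assumes "filtration S k F"
  shows "\<And>u. 1 + 2 * u \<noteq> 0 \<Longrightarrow> clique_poly (compat (F k)) (nonmax (F k)) u =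
      (1 + 2 * u) ^ bdim S (F k) *
      clique_poly (gamma_edge F) (gamma_verts F k) (u * (1 + u) / (1 + 2 * u)\<^sup>2)"
    and "\<forall>\<tau>\<in>cliques (gamma_edge F) (gamma_verts F k). 2 * card \<tau> \<le> bdim S (F k)"
proof -
  have "(\<forall>u. 1 + 2 * u \<noteq> 0 \<longrightarrow> clique_poly (compat (F k)) (nonmax (F k)) u =
      (1 + 2 * u) ^ bdim S (F k) *
      clique_poly (gamma_edge F) (gamma_verts F k) (u * (1 + u) / (1 + 2 * u)\<^sup>2)) \<and>
    (\<forall>\<tau>\<in>cliques (gamma_edge F) (gamma_verts F k). 2 * card \<tau> \<le> bdim S (F k))"
    using assms
  proof (induction k arbitrary: S F)
    case 0
    then have "F 0 = (\<lambda>x. {x}) ` S" by (simp add: filtration_def)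
    then show ?case
      by (simp add: nonmax_singletons bdim_singletons gamma_verts_def cliques_def)
  next
    case (Suc k)
    note F = filtration_le [OF Suc.prems, of k, simplified]
    note IH = Suc.IH [OF F]
    let ?y = "\<lambda>u::real. 1 + 2 * u" and ?z = "\<lambda>u::real. u * (1 + u) / (1 + 2 * u)\<^sup>2"
    have kk: "k < Suc k" by simp
    show ?case
    proof (cases "F (Suc k) = F k")
      case True
      then have "gamma_verts F (Suc k) = gamma_verts F k"
        by (auto simp: gamma_verts_def essential_def less_Suc_eq)
      then show ?thesis using IH True by simp
    next
      case False
      note Z = newset_mem [OF Suc.prems kk False]
      let ?Z = "newset F k"
      have fb: "flag_building S (F k)" "flag_building S (insert ?Z (F k))"
        using Suc.prems Z(2) by (auto simp: filtration_def)
      show ?thesis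
      proof (cases "essential F k")
        case False
        then have "gamma_verts F (Suc k) = gamma_verts F k"
          by (auto simp: gamma_verts_def less_Suc_eq)
        moreover have "\<not> (\<exists>M\<in>F k. ?Z \<subset> M)"
          using False \<open>F (Suc k) \<noteq> F k\<close> by (auto simp: essential_def)
        note step = clique_poly_merge_step [OF fb Z(1) this]
        ultimately show ?thesis using IH step unfolding Z(2) by (auto simp: le_SucI)
      next
        case True
        then obtain M where M: "M \<in> F k" "?Z \<subset> M" by (auto simp: essential_def)
        note step = clique_poly_essential_step [OF fb Z(1) M]
        note dim = bdim_essential_step [OF fb Z(1) M]
        have ZS: "?Z \<subseteq> S" using flag_buildingD(1) [OF fb(2)] building_setD(3) by blast
        let ?R = "\<lambda>l. restriction ?Z (F l)" and ?C = "\<lambda>l. contraction ?Z (F l)"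
        note FR = filtration_restriction [OF F ZS] and FC = filtration_contraction [OF F, of ?Z]
        note IHR = Suc.IH [OF FR] and IHC = Suc.IH [OF FC]
        let ?V = "gamma_verts F k" and ?VR = "gamma_verts ?R k" and ?VC = "gamma_verts ?C k"
        have fin: "finite (gamma_verts G k)" for G :: "nat \<Rightarrow> 'a set set"
            by (simp add: gamma_verts_def)
        have V': "gamma_verts F (Suc k) = insert k ?V" "k \<notin> ?V"
          using True by (auto simp: gamma_verts_def less_Suc_eq)
        have N: "{i \<in> ?V. gamma_edge F k i} = ?VR \<union> ?VC"
        proof -
          have "gamma_edge F k i \<longleftrightarrow> linked F i k" if "i < k" for i
            using that by (simp add: gamma_edge_def)
          then show ?thesis
            using essential_restrictionD(1) [OF F] essential_contractionD(1) [OF F]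
            unfolding gamma_verts_def linked_def by blast
        qed
        have dis: "?VR \<inter> ?VC = {}"
          using essential_restrictionD(3) [OF F] essential_contractionD(3) [OF F]
          unfolding gamma_verts_def by blast
        have join: "gamma_edge F i j" if "i \<in> ?VR" "j \<in> ?VC" for i j
        proof (rule linked_join [OF F])
          show "i \<noteq> j" using that dis by blast
        qed (use that in \<open>auto simp: gamma_verts_def\<close>)
        have eR: "gamma_edge F i j = gamma_edge ?R i j" if "i \<in> ?VR" "j \<in> ?VR" for i j
          using that linked_restriction [OF F _ _ ZS]
          unfolding gamma_verts_def gamma_edge_def by blast
        have eC: "gamma_edge F i j = gamma_edge ?C i j" if "i \<in> ?VC" "j \<in> ?VC" for i j
          using that linked_contraction [OF F, of _ _ ?Z]
          unfolding gamma_verts_def gamma_edge_def by blast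
        have cR: "cliques (gamma_edge F) ?VR = cliques (gamma_edge ?R) ?VR"
          by (rule cliques_cong) (rule eR)
        have cC: "cliques (gamma_edge F) ?VC = cliques (gamma_edge ?C) ?VC"
          by (rule cliques_cong) (rule eC)
        have P: "clique_poly (gamma_edge F) (gamma_verts F (Suc k)) w =
            clique_poly (gamma_edge F) ?V w +
            w * (clique_poly (gamma_edge ?R) ?VR w * clique_poly (gamma_edge ?C) ?VC w)" for w
        proof -
          have "clique_poly (gamma_edge F) (?VR \<union> ?VC) w =
              clique_poly (gamma_edge F) ?VR w * clique_poly (gamma_edge F) ?VC w"
            by (rule clique_poly_join [OF fin fin dis symp_gamma_edge join])
          also have "\<dots> = clique_poly (gamma_edge ?R) ?VR w * clique_poly (gamma_edge ?C) ?VC w"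
            using cR cC by (simp add: clique_poly_def)
          finally show ?thesis
            unfolding V'(1) clique_poly_insert [OF fin V'(2) symp_gamma_edge] N by simp
        qed
        show ?thesis
        proof (intro conjI allI impI ballI)
          fix u :: real assume u: "?y u \<noteq> 0"
          \<comment> \<open>The two dimensions lost in the link supply the square of
            \<open>1 + 2 * u\<close>, which turns \<open>?z u\<close> into the factor
            \<open>u * (1 + u)\<close> of the subdivision.\<close>
          have pw: "?y u ^ bdim S (F k) =
              ?y u ^ bdim ?Z (?R k) * ?y u ^ bdim (S - ?Z) (?C k) * (?y u)\<^sup>2"
            unfolding dim(2) [symmetric] by (simp only: power_add)
          have zz: "(?y u)\<^sup>2 * ?z u = u * (1 + u)" using u by simp
          have "clique_poly (compat (F (Suc k))) (nonmax (F (Suc k))) u =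
              ?y u ^ bdim S (F k) * clique_poly (gamma_edge F) ?V (?z u) +
              u * (1 + u) * (?y u ^ bdim ?Z (?R k) * clique_poly (gamma_edge ?R) ?VR (?z u)) *
              (?y u ^ bdim (S - ?Z) (?C k) * clique_poly (gamma_edge ?C) ?VC (?z u))"
            unfolding Z(2) step using IH IHR IHC u by simp
          also have "\<dots> = ?y u ^ bdim S (F k) * clique_poly (gamma_edge F) ?V (?z u) +
              ((?y u)\<^sup>2 * ?z u) * (?y u ^ bdim ?Z (?R k) * clique_poly (gamma_edge ?R) ?VR (?z u)) *
              (?y u ^ bdim (S - ?Z) (?C k) * clique_poly (gamma_edge ?C) ?VC (?z u))"
            unfolding zz ..
          also have "\<dots> =
              ?y u ^ bdim S (F k) * clique_poly (gamma_edge F) (gamma_verts F (Suc k)) (?z u)"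
            unfolding P pw by (simp only: distrib_left mult_ac)
          finally show "clique_poly (compat (F (Suc k))) (nonmax (F (Suc k))) u =
              ?y u ^ bdim S (F (Suc k)) * clique_poly (gamma_edge F) (gamma_verts F (Suc k)) (?z u)"
            unfolding Z(2) dim(1) .
        next
          fix \<tau> assume "\<tau> \<in> cliques (gamma_edge F) (gamma_verts F (Suc k))"
          then consider "\<tau> \<in> cliques (gamma_edge F) ?V" |
            \<rho> where "\<rho> \<in> cliques (gamma_edge F) (?VR \<union> ?VC)" "\<tau> = insert k \<rho>"
            unfolding V'(1) cliques_insert [OF V'(2) symp_gamma_edge] N by blast
          then show "2 * card \<tau> \<le> bdim S (F (Suc k))"
          proof cases
            case 1
            then show ?thesis using IH unfolding Z(2) dim(1) by blast
          next
            case 2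
            have f\<rho>: "finite \<rho>" using 2(1) fin finite_subset unfolding cliques_def
              by (metis (no_types, lifting) finite_UnI mem_Collect_eq)
            have "\<rho> \<inter> ?VR \<in> cliques (gamma_edge ?R) ?VR" "\<rho> \<inter> ?VC \<in> cliques (gamma_edge ?C) ?VC"
              unfolding cR [symmetric] cC [symmetric] using 2(1) by (auto simp: cliques_def)
            then have "2 * card (\<rho> \<inter> ?VR) \<le> bdim ?Z (?R k)"
              "2 * card (\<rho> \<inter> ?VC) \<le> bdim (S - ?Z) (?C k)"
              using IHR IHC by blast+
            moreover have "card \<rho> \<le> card (\<rho> \<inter> ?VR) + card (\<rho> \<inter> ?VC)"
            proof -
              have "\<rho> = (\<rho> \<inter> ?VR) \<union> (\<rho> \<inter> ?VC)" using 2(1) by (auto simp: cliques_def)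
              then show ?thesis by (metis card_Un_le)
            qed
            moreover have "card \<tau> \<le> Suc (card \<rho>)" using 2(2) f\<rho> by (simp add: card_insert_if)
            ultimately show ?thesis unfolding Z(2) dim(1) using dim(2) by linarith
          qed
        qed
      qed
    qed
  qed
  then show "\<And>u. 1 + 2 * u \<noteq> 0 \<Longrightarrow> clique_poly (compat (F k)) (nonmax (F k)) u =
      (1 + 2 * u) ^ bdim S (F k) *
      clique_poly (gamma_edge F) (gamma_verts F k) (u * (1 + u) / (1 + 2 * u)\<^sup>2)"
    and "\<forall>\<tau>\<in>cliques (gamma_edge F) (gamma_verts F k). 2 * card \<tau> \<le> bdim S (F k)"
    by blast+
qed

text \<open>The set added is one of maximal cardinality among the members of \<open>B - G\<close> that decompose
  in \<open>G\<close>: a union violating closure would be a larger such set.\<close>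

lemma exists_flag_extension:
  assumes B: "flag_building S B" and G: "flag_building S G" "G \<subset> B"
  shows "\<exists>Z\<in>B - G. flag_building S (insert Z G)"
proof -
  note bB = flag_buildingD(1) [OF B] and bG = flag_buildingD(1) [OF G(1)]
  define P where "P Z \<longleftrightarrow> Z \<in> B - G \<and> (\<exists>J\<in>G. \<exists>K\<in>G. J \<inter> K = {} \<and> J \<union> K = Z)" for Z
  have ex: "\<exists>Z. P Z"
  proof -
    obtain Z0 where "Z0 \<in> B - G" using G(2) by blast
    \<comment> \<open>The two parts of a smallest missing set are smaller, hence present in
      \<open>G\<close>.\<close>
    then obtain Z where Z: "Z \<in> B - G" "\<And>Y. Y \<in> B - G \<Longrightarrow> card Z \<le> card Y"
      using ex_has_least_nat [of "\<lambda>Z. Z \<in> B - G" Z0 card] by blast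
    have "\<not> (\<exists>i. Z = {i})" using Z(1) building_setD(3) [OF bB, of Z] building_setD(4) [OF bG]
        by auto
    then obtain J K where JK: "J \<in> B" "K \<in> B" "J \<inter> K = {}" "J \<union> K = Z"
      using flag_buildingD(2) [OF B] Z(1) by blast
    have "J \<subset> Z" "K \<subset> Z" using JK building_setD(2) [OF bB JK(1)] building_setD(2) [OF bB JK(2)]
        by auto
    then have "card J < card Z" "card K < card Z"
      using building_finite [OF bB, of Z] Z(1) by (simp_all add: psubset_card_mono)
    then have "J \<in> G" "K \<in> G" using Z(2) [of J] Z(2) [of K] JK by auto
    then show ?thesis using Z JK unfolding P_def by blast
  qed
  have bound: "\<forall>Z. P Z \<longrightarrow> card Z \<le> card S"
    using building_setD(1,3) [OF bB] by (auto simp: P_def intro: card_mono)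
  obtain Z where Z: "P Z" "\<And>Y. P Y \<Longrightarrow> card Y \<le> card Z"
    using ex_has_greatest_nat [of P _ card "Suc (card S)"] ex bound by (metis less_Suc_eq_le)
  obtain J K where JK: "J \<in> G" "K \<in> G" "J \<inter> K = {}" "J \<union> K = Z" and ZB: "Z \<in> B" "Z \<notin> G"
    using Z(1) unfolding P_def by blast
  have one: "T \<union> Z \<in> insert Z G" if T: "T \<in> G" "T \<inter> J \<noteq> {}"
      and JK': "J \<in> G" "K \<in> G" "J \<inter> K = {}" "J \<union> K = Z" for T J K
  proof (rule ccontr)
    assume n: "T \<union> Z \<notin> insert Z G"
    have TJ: "T \<union> J \<in> G" using building_union [OF bG T(1) JK'(1)] T by blast
    have "T \<inter> K = {}"
    proof (rule ccontr)
      assume "T \<inter> K \<noteq> {}"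
      then have "T \<union> J \<union> K \<in> G" using building_union [OF bG TJ JK'(2)] by blast
      moreover have "T \<union> J \<union> K = T \<union> Z" using JK' by blast
      ultimately show False using n by simp
    qed
    then have "(T \<union> J) \<inter> K = {}" "(T \<union> J) \<union> K = T \<union> Z" using JK' by blast+
    moreover have "T \<union> Z \<in> B" using building_union [OF bB, of T Z] T JK' G(2) ZB by blast
    ultimately have "P (T \<union> Z)" unfolding P_def using n TJ JK'(2) by blast
    moreover have "Z \<subset> T \<union> Z" using n by blast
    then have "card Z < card (T \<union> Z)"
      using building_finite [OF bB \<open>T \<union> Z \<in> B\<close>] by (simp add: psubset_card_mono)
    ultimately show False using Z(2) by fastforce
  qed
  have meetZ: "T \<union> Z \<in> insert Z G" if T: "T \<in> G" "T \<inter> Z \<noteq> {}" for T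
  proof (cases "T \<inter> J = {}")
    case True
    then have "T \<inter> K \<noteq> {}" using T JK(4) by blast
    then show ?thesis using one [OF T(1) _ JK(2,1)] JK(3,4) by blast
  qed (use one [OF T(1) _ JK] in blast)
  have "building_set S (insert Z G)"
    unfolding building_set_def
  proof (intro conjI ballI impI)
    show "finite S" by (rule building_setD(1) [OF bB])
    show "I \<noteq> {}" "I \<subseteq> S" if "I \<in> insert Z G" for I
      using that G(2) ZB building_setD(2,3) [OF bB, of I] by blast+
    show "{i} \<in> insert Z G" if "i \<in> S" for i using building_setD(4) [OF bG that] by simp
    show "I \<union> I' \<in> insert Z G" if II: "I \<in> insert Z G" "I' \<in> insert Z G" "I \<inter> I' \<noteq> {}" for I I'
    proof -
      consider "I = Z" "I' = Z" | "I \<in> G" "I' = Z" | "I = Z" "I' \<in> G" | "I \<in> G" "I' \<in> G"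
        using II(1,2) by blast
      then show ?thesis
      proof cases
        case 3
        then show ?thesis using meetZ [of I'] II(3) by (simp add: Un_commute Int_commute)
      qed (use meetZ II building_union [OF bG, of I I'] in auto)
    qed
  qed
  moreover have "decomposable (insert Z G)"
    using G(1) JK unfolding flag_building_def decomposable_def by blast
  ultimately show ?thesis using ZB by (auto simp: flag_building_def)
qed

theorem exists_filtration:
  assumes B: "flag_building S B"
  shows "\<exists>k F. filtration S k F \<and> F k = B"
proof -
  note bB = flag_buildingD(1) [OF B]
  \<comment> \<open>Every extension adds a set, so a filtration that never reached \<open>B\<close>
    would outgrow its cardinality.\<close>
  have "\<exists>k F. filtration S k F \<and> F k \<subseteq> B \<and> (F k = B \<or> card (F k) \<ge> n)" for n
  proof (induction n)
    case 0
    let ?G = "(\<lambda>x. {x}) ` S"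
    have "flag_building S ?G"
      using building_setD(1) [OF bB] unfolding flag_building_def building_set_def decomposable_def
          by auto
    then have "filtration S 0 (\<lambda>_. ?G)" by (simp add: filtration_def)
    moreover have "?G \<subseteq> B" using building_setD(4) [OF bB] by auto
    ultimately show ?case by (intro exI [of _ 0] exI [of _ "\<lambda>_. ?G"]) simp
  next
    case (Suc n)
    then obtain k F where F: "filtration S k F" "F k \<subseteq> B" "F k = B \<or> card (F k) \<ge> n" by blast
    show ?case
    proof (cases "F k = B")
      case False
      have fb: "flag_building S (F k)" using F(1) by (simp add: filtration_def)
      obtain Z where Z: "Z \<in> B - F k" "flag_building S (insert Z (F k))"
        using exists_flag_extension [OF B fb] F(2) False by blast
      let ?F = "\<lambda>i. if i \<le> k then F i else insert Z (F k)"
      have "filtration S (Suc k) ?F"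
        unfolding filtration_def
      proof (intro conjI allI impI)
        show "?F 0 = (\<lambda>x. {x}) ` S" using F(1) by (simp add: filtration_def)
        show "flag_building S (?F i)" for i using F(1) Z(2) by (simp add: filtration_def)
        fix i assume "i < Suc k"
        then consider "i < k" | "i = k" by linarith
        then show "?F (Suc i) = ?F i \<or> (\<exists>Z. Z \<notin> ?F i \<and> ?F (Suc i) = insert Z (?F i))"
        proof cases
          case 1
          then show ?thesis using F(1) by (simp add: filtration_def)
        next
          case 2
          then show ?thesis using Z(1) by auto
        qed
      qed
      moreover have "Suc n \<le> card (insert Z (F k))"
        using F False Z(1) finite_building [OF flag_buildingD(1) [OF fb]] by simp
      ultimately show ?thesis using F(2) Z(1)
        by (intro exI [of _ "Suc k"] exI [of _ ?F]) simp
    qed (use F in blast)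
  qed
  then obtain k F where "filtration S k F" "F k \<subseteq> B" "F k = B \<or> card (F k) \<ge> Suc (card B)" by blast
  then show ?thesis using card_mono [OF finite_building [OF bB], of "F k"] by fastforce
qed

subsection \<open>Nested sets and tight inequalities\<close>

definition csum :: "'n set \<Rightarrow> real ^ 'n::finite \<Rightarrow> real" where
  "csum I x = (\<Sum>i\<in>I. x $ i)"

text \<open>The minimum of \<open>csum I\<close> on the nestohedron: a simplex on a subset of
  \<open>I\<close> contributes 1, any other simplex at least 0 and possibly 0.\<close>

definition low :: "'n set set \<Rightarrow> 'n set \<Rightarrow> real" where
  "low B I = real (card {J \<in> B. J \<subseteq> I})"

definition tight :: "'n set set \<Rightarrow> real ^ 'n::finite \<Rightarrow> 'n set set" where
  "tight B x = {I \<in> nonmax B. csum I x = low B I}"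

definition nested :: "'a set set \<Rightarrow> 'a set set \<Rightarrow> bool" where
  "nested B \<sigma> \<longleftrightarrow> \<sigma> \<subseteq> nonmax B \<and> (\<forall>I\<in>\<sigma>. \<forall>J\<in>\<sigma>. I \<subseteq> J \<or> J \<subseteq> I \<or> I \<inter> J = {}) \<and>
     (\<forall>\<rho>\<subseteq>\<sigma>. (\<exists>I\<in>\<rho>. \<exists>J\<in>\<rho>. I \<noteq> J) \<and> (\<forall>I\<in>\<rho>. \<forall>J\<in>\<rho>. I \<noteq> J \<longrightarrow> I \<inter> J = {}) \<longrightarrow> \<Union>\<rho> \<notin> B)"

lemma nestedD:
  assumes "nested B \<sigma>"
  shows nested_nonmax: "\<sigma> \<subseteq> nonmax B"
    and nested_laminar: "\<And>I J. I \<in> \<sigma> \<Longrightarrow> J \<in> \<sigma> \<Longrightarrow> I \<subseteq> J \<or> J \<subseteq> I \<or> I \<inter> J = {}"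
    and nested_Union: "\<And>\<rho> I J. \<rho> \<subseteq> \<sigma> \<Longrightarrow> I \<in> \<rho> \<Longrightarrow> J \<in> \<rho> \<Longrightarrow> I \<noteq> J \<Longrightarrow>
      \<forall>I\<in>\<rho>. \<forall>J\<in>\<rho>. I \<noteq> J \<longrightarrow> I \<inter> J = {} \<Longrightarrow> \<Union>\<rho> \<notin> B"
proof -
  show "\<sigma> \<subseteq> nonmax B" using assms by (simp add: nested_def)
  show "\<And>I J. I \<in> \<sigma> \<Longrightarrow> J \<in> \<sigma> \<Longrightarrow> I \<subseteq> J \<or> J \<subseteq> I \<or> I \<inter> J = {}"
    using assms by (simp add: nested_def)
  fix \<rho> I J assume \<rho>: "\<rho> \<subseteq> \<sigma>" "I \<in> \<rho>" "J \<in> \<rho>" "I \<noteq> J" "\<forall>I\<in>\<rho>. \<forall>J\<in>\<rho>. I \<noteq> J \<longrightarrow> I \<inter> J = {}"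
  have "(\<exists>I\<in>\<rho>. \<exists>J\<in>\<rho>. I \<noteq> J) \<and> (\<forall>I\<in>\<rho>. \<forall>J\<in>\<rho>. I \<noteq> J \<longrightarrow> I \<inter> J = {}) \<longrightarrow> \<Union>\<rho> \<notin> B"
    using assms \<rho>(1) by (simp add: nested_def)
  moreover have "\<exists>I\<in>\<rho>. \<exists>J\<in>\<rho>. I \<noteq> J" using \<rho>(2-4) by blast
  ultimately show "\<Union>\<rho> \<notin> B" using \<rho>(5) by blast
qed

lemma nested_subset: "nested B \<sigma> \<Longrightarrow> \<tau> \<subseteq> \<sigma> \<Longrightarrow> nested B \<tau>"
  unfolding nested_def by (meson subsetD subset_trans)

lemma linear_csum: "linear (csum I)"
  by (rule linearI) (simp_all add: csum_def sum.distrib sum_distrib_left)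

lemma csum_inner: "csum I x = inner (\<chi> i. if i \<in> I then 1 else 0) x"
  by (simp add: csum_def inner_vec_def if_distrib [of "\<lambda>c. c * _"] sum.If_cases cong: if_cong)

lemma coord_simplexD:
  fixes y :: "real ^ 'n::finite"
  assumes "y \<in> coord_simplex J"
  shows "0 \<le> y $ i" "i \<notin> J \<Longrightarrow> y $ i = 0" "csum J y = 1"
proof -
  let ?T = "{y :: real ^ 'n. (\<forall>i. 0 \<le> y $ i) \<and> (\<forall>i. i \<notin> J \<longrightarrow> y $ i = 0) \<and> csum J y = 1}"
  have "convex ?T"
    unfolding convex_def csum_def
    by (auto simp: sum.distrib sum_distrib_left [symmetric])
  moreover have "(\<lambda>i. axis i 1) ` J \<subseteq> ?T"
    by (auto simp: axis_def csum_def)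
  ultimately have "coord_simplex J \<subseteq> ?T" unfolding coord_simplex_def
      by (rule hull_minimal [rotated])
  then show "0 \<le> y $ i" "i \<notin> J \<Longrightarrow> y $ i = 0" "csum J y = 1" using assms by auto
qed

text \<open>Prescribes the zero pattern of a summand, which is all that tightness in
  \<open>csum_eq_low_iff\<close> depends on.\<close>

lemma barycentre:
  fixes K J :: "'n::finite set"
  assumes "K \<noteq> {}" "K \<subseteq> J"
  shows "\<exists>y\<in>coord_simplex J. \<forall>i. (y $ i \<noteq> 0) = (i \<in> K)"
proof (intro bexI allI)
  let ?y = "(\<Sum>j\<in>K. (1 / card K) *\<^sub>R axis j 1) :: real ^ 'n"
  have pos: "card K > 0" using assms(1) by (simp add: card_gt_0_iff)
  show "?y \<in> coord_simplex J"
    unfolding coord_simplex_def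
  proof (rule convex_sum)
    show "axis i 1 \<in> convex hull (\<lambda>i. axis i 1) ` J" if "i \<in> K" for i
      using that assms(2) by (intro hull_inc) auto
  qed (use pos in \<open>auto simp: convex_convex_hull\<close>)
  show "(?y $ i \<noteq> 0) = (i \<in> K)" for i
  proof -
    have "?y $ i = (\<Sum>j\<in>K. if i = j then 1 / card K else 0)"
      by (simp add: axis_def if_distrib cong: if_cong)
    then show ?thesis using assms(1) by (simp add: sum.delta)
  qed
qed

lemma nestohedron_iff:
  "x \<in> nestohedron B \<longleftrightarrow> (\<exists>y. (\<forall>J\<in>B. y J \<in> coord_simplex J) \<and> x = (\<Sum>J\<in>B. y J))"
  for B :: "'n::finite set set"
  unfolding nestohedron_def by (subst set_sum_alt) auto

lemma csum_decomposition:
  fixes B :: "'n::finite set set"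
  assumes "\<forall>J\<in>B. y J \<in> coord_simplex J"
  shows "csum I (\<Sum>J\<in>B. y J) = low B I + (\<Sum>J\<in>{J \<in> B. \<not> J \<subseteq> I}. csum I (y J))"
proof -
  have "csum I (\<Sum>J\<in>B. y J) = (\<Sum>J\<in>B. csum I (y J))" by (rule linear_sum [OF linear_csum])
  also have "\<dots> = (\<Sum>J\<in>{J \<in> B. J \<subseteq> I}. csum I (y J)) + (\<Sum>J\<in>{J \<in> B. \<not> J \<subseteq> I}. csum I (y J))"
    by (subst sum.union_disjoint [symmetric]) (auto intro: sum.cong)
  also have "(\<Sum>J\<in>{J \<in> B. J \<subseteq> I}. csum I (y J)) = low B I"
  proof -
    have "csum I (y J) = 1" if "J \<in> B" "J \<subseteq> I" for J
    proof -
      have yJ: "y J \<in> coord_simplex J" using assms that by simp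
      have "csum I (y J) = csum J (y J)"
        unfolding csum_def using that coord_simplexD(2) [OF yJ]
        by (intro sum.mono_neutral_right) auto
      then show ?thesis using coord_simplexD(3) [OF yJ] by simp
    qed
    then show ?thesis by (simp add: low_def)
  qed
  finally show ?thesis .
qed

text \<open>The excess over \<open>low B I\<close> is the sum of the nonnegative masses that the
  summands not supported inside \<open>I\<close> put on \<open>I\<close>.\<close>

lemma csum_eq_low_iff:
  fixes B :: "'n::finite set set"
  assumes "\<forall>J\<in>B. y J \<in> coord_simplex J"
  shows "csum I (\<Sum>J\<in>B. y J) \<ge> low B I"
    and "csum I (\<Sum>J\<in>B. y J) = low B I \<longleftrightarrow> (\<forall>J\<in>B. \<not> J \<subseteq> I \<longrightarrow> (\<forall>i\<in>I. y J $ i = 0))"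
proof -
  have nn: "0 \<le> y J $ i" if "J \<in> B" for J i using coord_simplexD(1) assms that by blast
  have nn': "0 \<le> csum I (y J)" if "J \<in> B" for J unfolding csum_def using nn [OF that]
      by (simp add: sum_nonneg)
  show "csum I (\<Sum>J\<in>B. y J) \<ge> low B I"
    unfolding csum_decomposition [OF assms]
    using sum_nonneg [of "{J \<in> B. \<not> J \<subseteq> I}" "\<lambda>J. csum I (y J)"] nn' by simp
  have "csum I (\<Sum>J\<in>B. y J) = low B I \<longleftrightarrow> (\<forall>J\<in>{J \<in> B. \<not> J \<subseteq> I}. csum I (y J) = 0)"
    unfolding csum_decomposition [OF assms]
    using sum_nonneg_eq_0_iff [of "{J \<in> B. \<not> J \<subseteq> I}" "\<lambda>J. csum I (y J)"] nn' by simp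
  also have "\<dots> \<longleftrightarrow> (\<forall>J\<in>B. \<not> J \<subseteq> I \<longrightarrow> (\<forall>i\<in>I. y J $ i = 0))"
    unfolding csum_def using nn by (auto simp: sum_nonneg_eq_0_iff)
  finally show "csum I (\<Sum>J\<in>B. y J) = low B I \<longleftrightarrow> (\<forall>J\<in>B. \<not> J \<subseteq> I \<longrightarrow> (\<forall>i\<in>I. y J $ i = 0))" .
qed

lemma csum_ge_low: "x \<in> nestohedron B \<Longrightarrow> csum I x \<ge> low B I"
  using csum_eq_low_iff(1) nestohedron_iff by metis

lemma csum_maximal:
  fixes B :: "'n::finite set set"
  assumes B: "building_set UNIV B" and I: "I \<in> maximals B" and x: "x \<in> nestohedron B"
  shows "csum I x = low B I"
proof -
  obtain y where y: "\<forall>J\<in>B. y J \<in> coord_simplex J" "x = (\<Sum>J\<in>B. y J)" using x nestohedron_iff by blast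
  have "y J $ i = 0" if "J \<in> B" "\<not> J \<subseteq> I" "i \<in> I" for J i
  proof -
    have "I \<inter> J = {}" using maximals_disjoint [OF B I that(1)] that(2) by blast
    then show ?thesis using coord_simplexD(2) y(1) that by blast
  qed
  then show ?thesis using csum_eq_low_iff(2) [OF y(1)] y(2) by blast
qed

text \<open>If tight sets covered a member \<open>U\<close> and none of them contained it, the
  summand on \<open>U\<close> would vanish on all of \<open>U\<close>, although its coordinates add
  up to 1. Each way of violating nestedness produces such a cover.\<close>

lemma nested_tight:
  fixes B :: "'n::finite set set"
  assumes B: "building_set UNIV B" and x: "x \<in> nestohedron B"
  shows "nested B (tight B x)"
proof -
  obtain y where y: "\<forall>J\<in>B. y J \<in> coord_simplex J" "x = (\<Sum>J\<in>B. y J)" using x nestohedron_iff by blast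
  have van: "y J $ i = 0" if "I \<in> tight B x" "J \<in> B" "\<not> J \<subseteq> I" "i \<in> I" for I J i
    using that csum_eq_low_iff(2) [OF y(1), of I] unfolding tight_def y(2) by blast
  have key: False if U: "U \<in> B" "\<rho> \<subseteq> tight B x" "\<And>I. I \<in> \<rho> \<Longrightarrow> \<not> U \<subseteq> I" "U \<subseteq> \<Union>\<rho>" for U \<rho>
  proof -
    have "y U $ i = 0" if "i \<in> U" for i
    proof -
      obtain I where "I \<in> \<rho>" "i \<in> I" using U(4) \<open>i \<in> U\<close> by blast
      then show ?thesis using van [of I U i] U(1-3) by blast
    qed
    then have "csum U (y U) = 0" by (simp add: csum_def)
    then show False using coord_simplexD(3) [of "y U" U] y(1) U(1) by auto
  qed
  have TB: "I \<in> B" if "I \<in> tight B x" for I using that by (auto simp: tight_def nonmax_def)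
  show ?thesis
    unfolding nested_def
  proof (intro conjI ballI allI impI)
    show "tight B x \<subseteq> nonmax B" by (auto simp: tight_def)
    fix I J assume IJ: "I \<in> tight B x" "J \<in> tight B x"
    show "I \<subseteq> J \<or> J \<subseteq> I \<or> I \<inter> J = {}"
    proof (rule ccontr)
      assume n: "\<not> ?thesis"
      then have "I \<union> J \<in> B" using building_union [OF B TB TB] IJ by blast
      then show False using key [of "I \<union> J" "{I, J}"] n IJ by auto
    qed
  next
    fix \<rho> assume \<rho>: "\<rho> \<subseteq> tight B x"
      "(\<exists>I\<in>\<rho>. \<exists>J\<in>\<rho>. I \<noteq> J) \<and> (\<forall>I\<in>\<rho>. \<forall>J\<in>\<rho>. I \<noteq> J \<longrightarrow> I \<inter> J = {})"
    show "\<Union>\<rho> \<notin> B"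
    proof
      assume U: "\<Union>\<rho> \<in> B"
      have "\<not> \<Union>\<rho> \<subseteq> I" if I: "I \<in> \<rho>" for I
      proof
        assume sub: "\<Union>\<rho> \<subseteq> I"
        obtain J where J: "J \<in> \<rho>" "J \<noteq> I" using \<rho>(2) by blast
        then have "I \<inter> J = {}" using \<rho>(2) I by blast
        moreover have "J \<noteq> {}" using building_setD(2) [OF B TB] J \<rho>(1) by blast
        ultimately show False using sub J by blast
      qed
      then show False using key [OF U \<rho>(1)] by blast
    qed
  qed
qed

text \<open>Suppose that the sets of \<open>\<sigma>\<close> not above \<open>J\<close> cover it.
  The maximal ones among those meeting \<open>J\<close> are disjoint, and there are at least two.
  Uniting them with \<open>J\<close> one by one yields a member, namely their own union, which
  nestedness forbids.\<close>

lemma nested_root_nonempty: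
  assumes B: "building_set S B" and \<sigma>: "nested B \<sigma>" and J: "J \<in> B"
  shows "J - \<Union>{I \<in> \<sigma>. \<not> J \<subseteq> I} \<noteq> {}"
proof
  assume "J - \<Union>{I \<in> \<sigma>. \<not> J \<subseteq> I} = {}"
  then have cov: "J \<subseteq> \<Union>{I \<in> \<sigma>. \<not> J \<subseteq> I}" by blast
  let ?M = "{I \<in> \<sigma>. \<not> J \<subseteq> I \<and> I \<inter> J \<noteq> {}}"
  have \<sigma>B: "I \<in> B" if "I \<in> \<sigma>" for I using \<sigma> that by (auto simp: nested_def nonmax_def)
  have finM: "finite ?M" using finite_subset [of ?M B] finite_building [OF B] \<sigma>B by blast
  define \<rho> where "\<rho> = {I \<in> ?M. \<forall>K\<in>?M. I \<subseteq> K \<longrightarrow> I = K}"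
  have ext: "\<exists>K\<in>\<rho>. I \<subseteq> K" if I: "I \<in> ?M" for I
  proof -
    have A: "finite {K \<in> ?M. I \<subseteq> K}" "{K \<in> ?M. I \<subseteq> K} \<noteq> {}"
      using finite_subset [OF Collect_restrict finM] I by blast+
    from finite_has_maximal [OF A] obtain K where
      K: "K \<in> {K \<in> ?M. I \<subseteq> K}" "\<forall>L\<in>{K \<in> ?M. I \<subseteq> K}. K \<subseteq> L \<longrightarrow> K = L" by (rule bexE)
    then have "K = L" if "L \<in> ?M" "K \<subseteq> L" for L using that by fastforce
    then have "K \<in> \<rho>" using K(1) unfolding \<rho>_def by blast
    then show ?thesis using K(1) by blast
  qed
  have \<rho>M: "\<rho> \<subseteq> ?M" by (auto simp: \<rho>_def)
  have J\<rho>: "J \<subseteq> \<Union>\<rho>"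
  proof
    fix i assume "i \<in> J"
    then obtain I where "I \<in> ?M" "i \<in> I" using cov by blast
    then show "i \<in> \<Union>\<rho>" using ext [of I] by blast
  qed
  have disj: "I \<inter> K = {}" if "I \<in> \<rho>" "K \<in> \<rho>" "I \<noteq> K" for I K
  proof -
    have IK: "I \<in> ?M" "K \<in> ?M" using that(1,2) \<rho>M by blast+
    then have "\<not> I \<subseteq> K" "\<not> K \<subseteq> I" using that unfolding \<rho>_def by blast+
    then show ?thesis using nested_laminar [OF \<sigma>] IK by blast
  qed
  have ex2: "\<exists>I\<in>\<rho>. \<exists>K\<in>\<rho>. I \<noteq> K"
  proof -
    obtain i where "i \<in> J" using building_setD(2) [OF B J] by blast
    then obtain I where I: "I \<in> \<rho>" using J\<rho> by blast
    then have "\<not> J \<subseteq> I" using \<rho>M by blast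
    then obtain K where "K \<in> \<rho>" "K \<noteq> I" using J\<rho> by blast
    then show ?thesis using I by blast
  qed
  have "finite \<rho>" using finM \<rho>M finite_subset by blast
  have "J \<union> \<Union>\<tau> \<in> B" if "finite \<tau>" "\<tau> \<subseteq> ?M" for \<tau>
    using that
  proof (induction \<tau> rule: finite_induct)
    case (insert I \<tau>)
    then have "J \<union> \<Union>\<tau> \<in> B" "I \<in> B" "(J \<union> \<Union>\<tau>) \<inter> I \<noteq> {}" using \<sigma>B by auto
    then have "(J \<union> \<Union>\<tau>) \<union> I \<in> B" by (rule building_union [OF B])
    moreover have "(J \<union> \<Union>\<tau>) \<union> I = J \<union> \<Union>(insert I \<tau>)" by auto
    ultimately show ?case by simp
  qed (use J in simp)
  then have "J \<union> \<Union>\<rho> \<in> B" using \<open>finite \<rho>\<close> \<rho>M by blast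
  then have "\<Union>\<rho> \<in> B" using J\<rho> by (simp add: Un_absorb1)
  moreover have "\<rho> \<subseteq> \<sigma>" using \<rho>M by blast
  moreover obtain I K where "I \<in> \<rho>" "K \<in> \<rho>" "I \<noteq> K" using ex2 by blast
  moreover have "\<forall>I\<in>\<rho>. \<forall>J\<in>\<rho>. I \<noteq> J \<longrightarrow> I \<inter> J = {}" using disj by simp
  ultimately show False using nested_Union [OF \<sigma>, of \<rho> I K] by simp
qed

text \<open>The summand on \<open>J\<close> is spread over exactly those elements of
  \<open>J\<close> that lie in no set of \<open>\<sigma>\<close> not containing \<open>J\<close>.
  This makes all sets of \<open>\<sigma>\<close> tight while keeping as many coordinates as possible
  positive.\<close>

lemma nested_realized:
  fixes B :: "'n::finite set set"
  assumes B: "building_set UNIV B" and \<sigma>: "nested B \<sigma>"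
  shows "\<exists>x\<in>nestohedron B. tight B x = \<sigma>"
proof -
  define r where "r J = J - \<Union>{I \<in> \<sigma>. \<not> J \<subseteq> I}" for J
  have "\<exists>y\<in>coord_simplex J. \<forall>i. (y $ i \<noteq> 0) = (i \<in> r J)" if "J \<in> B" for J
    using nested_root_nonempty [OF B \<sigma> that] by (intro barycentre) (auto simp: r_def)
  then obtain y :: "'n set \<Rightarrow> real ^ 'n" where
    y: "\<forall>J\<in>B. y J \<in> coord_simplex J" "\<And>J i. J \<in> B \<Longrightarrow> (y J $ i \<noteq> 0) = (i \<in> r J)"
    by metis
  let ?x = "\<Sum>J\<in>B. y J"
  have xP: "?x \<in> nestohedron B" using y(1) nestohedron_iff by blast
  have \<sigma>V: "\<sigma> \<subseteq> nonmax B" using \<sigma> by (simp add: nested_def)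
  have iff: "csum I ?x = low B I \<longleftrightarrow> (\<forall>J\<in>B. \<not> J \<subseteq> I \<longrightarrow> r J \<inter> I = {})" for I
    unfolding csum_eq_low_iff(2) [OF y(1)] using y(2) by blast
  have "\<sigma> \<subseteq> tight B ?x"
  proof
    fix I assume I: "I \<in> \<sigma>"
    have "r J \<inter> I = {}" if "\<not> J \<subseteq> I" for J using that I by (auto simp: r_def)
    then have "csum I ?x = low B I" unfolding iff by simp
    then show "I \<in> tight B ?x" using I \<sigma>V by (auto simp: tight_def)
  qed
  moreover have "tight B ?x \<subseteq> \<sigma>"
  proof
    fix I assume I: "I \<in> tight B ?x"
    then have IV: "I \<in> nonmax B" "I \<in> B" by (auto simp: tight_def nonmax_def)
    have "csum I ?x = low B I" using I by (simp add: tight_def)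
    then have van: "r J \<inter> I = {}" if "J \<in> B" "\<not> J \<subseteq> I" for J
      unfolding iff using that by simp
    show "I \<in> \<sigma>"
    proof (rule ccontr)
      assume n: "I \<notin> \<sigma>"
      obtain i where i: "i \<in> r I" using nested_root_nonempty [OF B \<sigma> IV(2)] unfolding r_def by blast
      let ?A = "{L \<in> \<sigma> \<union> maximals B. I \<subseteq> L}"
      obtain M where "M \<in> ?A" using exists_maximal_superset [OF B IV(2)] by blast
      \<comment> \<open>The smallest set above \<open>I\<close> in \<open>\<sigma>\<close> or among
        the maximal members. Its summand is positive at \<open>i \<in> I\<close> although
        \<open>K\<close> is not inside \<open>I\<close>, so \<open>I\<close> is not tight.\<close>
      then obtain K where K: "K \<in> ?A" "\<And>L. L \<in> ?A \<Longrightarrow> card K \<le> card L"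
        using ex_has_least_nat [of "\<lambda>L. L \<in> ?A" M card] by blast
      have KB: "K \<in> B" using K(1) \<sigma>V by (auto simp: nonmax_def maximals_def)
      have "I \<notin> maximals B" using IV(1) by (auto simp: nonmax_def maximals_def)
      then have "K \<noteq> I" using K(1) n by blast
      then have "\<not> K \<subseteq> I" using K(1) by blast
      moreover have "i \<in> r K"
      proof -
        have "i \<notin> L" if L: "L \<in> \<sigma>" "\<not> K \<subseteq> L" for L
        proof
          assume "i \<in> L"
          then have IL: "I \<subseteq> L" using i L(1) unfolding r_def by blast
          have "L \<subseteq> K"
          proof (cases "K \<in> \<sigma>")
            case True
            then have "L \<subseteq> K \<or> K \<subseteq> L \<or> L \<inter> K = {}" using nested_laminar [OF \<sigma> L(1)] by blast
            then show ?thesis using L(2) IL K(1) i unfolding r_def by blast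
          next
            case False
            then have "K \<in> maximals B" using K(1) by blast
            then show ?thesis
              using maximals_disjoint [OF B, of K L] L(1) \<sigma>V IL K(1) i unfolding r_def nonmax_def
                  by blast
          qed
          then have "L \<subset> K" using L(2) by blast
          then have "card L < card K" by (simp add: psubset_card_mono)
          moreover have "card K \<le> card L" using K(2) [of L] L(1) IL by blast
          ultimately show False by simp
        qed
        moreover have "i \<in> K" using i K(1) unfolding r_def by blast
        ultimately show ?thesis unfolding r_def by blast
      qed
      moreover have "i \<in> I" using i by (simp add: r_def)
      ultimately show False using van [OF KB] by blast
    qed
  qed
  ultimately show ?thesis using xP by blast
qed

section \<open>Decomposition of linear functionals\<close>

definition components :: "'a set set \<Rightarrow> 'a set \<Rightarrow> 'a set set" where
  "components B U = {I \<in> B. I \<subseteq> U \<and> (\<forall>J\<in>B. I \<subseteq> J \<and> J \<subseteq> U \<longrightarrow> J = I)}"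

lemma components_absorb:
  assumes "building_set S B" "I \<in> components B U" "J \<in> B" "J \<subseteq> U" "I \<inter> J \<noteq> {}"
  shows "J \<subseteq> I"
proof -
  have "I \<in> B" "I \<subseteq> U" using assms(2) by (auto simp: components_def)
  then have "I \<union> J \<in> B" using building_union [OF assms(1) _ assms(3,5)] by blast
  moreover have "I \<subseteq> I \<union> J" "I \<union> J \<subseteq> U" using \<open>I \<subseteq> U\<close> assms(4) by auto
  ultimately have "I \<union> J = I" using assms(2) unfolding components_def by blast
  then show ?thesis by blast
qed

text \<open>Singletons are members and members that meet unite, so the components partition
  \<open>U\<close>.\<close>

lemma sum_components:
  fixes B :: "'n::finite set set"
  assumes B: "building_set UNIV B"
  shows "(\<Sum>I\<in>B. if I \<in> components B U \<and> i \<in> I then 1 else 0) = (if i \<in> U then 1 else (0::real))"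
proof (cases "i \<in> U")
  case True
  let ?A = "{I \<in> B. I \<subseteq> U \<and> i \<in> I}"
  have "{i} \<in> ?A" using True building_setD(4) [OF B] by simp
  then have A: "finite ?A" "?A \<noteq> {}" by auto
  from finite_has_maximal [OF A] obtain K where
    K: "K \<in> ?A" "\<forall>L\<in>?A. K \<subseteq> L \<longrightarrow> K = L" by (rule bexE)
  then have KC: "K \<in> components B U" unfolding components_def by blast
  have "(I \<in> components B U \<and> i \<in> I) = (I = K)" if "I \<in> B" for I
  proof
    assume I: "I \<in> components B U \<and> i \<in> I"
    then have "I \<subseteq> U" by (simp add: components_def)
    have "K \<subseteq> I" "I \<subseteq> K"
      using components_absorb [OF B, of I U K] components_absorb [OF B KC, of I] I K(1) \<open>I \<subseteq> U\<close> that by blast+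
    then show "I = K" by blast
  qed (use KC K(1) in blast)
  then have "(\<Sum>I\<in>B. if I \<in> components B U \<and> i \<in> I then 1 else 0) = (\<Sum>I\<in>B. if I =
      K then 1 else (0::real))"
    by (intro sum.cong) auto
  then show ?thesis using True K(1) by simp
next
  case False
  have "(\<Sum>I\<in>B. if I \<in> components B U \<and> i \<in> I then 1 else 0) = (0::real)"
    using False by (intro sum.neutral) (auto simp: components_def)
  then show ?thesis using False by simp
qed

lemma components_UNIV: "components B UNIV = maximals B"
  by (auto simp: components_def maximals_def)

text \<open>The coefficient of a component of sublevel sets is the sum of the gaps above the
  values at which it occurs.\<close>

lemma level_decomposition:
  fixes B :: "'n::finite set set" and w :: "'n \<Rightarrow> real"
  assumes B: "building_set UNIV B"
  shows "\<exists>\<mu>. (\<forall>I\<in>nonmax B. 0 \<le> \<mu> I \<and> (\<mu> I \<noteq> 0 \<longrightarrow> (\<exists>t. I \<in> components B {i. w i \<le> t}))) \<and>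
    (\<forall>i. w i = - (\<Sum>I\<in>B. if i \<in> I then \<mu> I else 0))"
proof (induction "card (range w)" arbitrary: w rule: less_induct)
  case less
  have notV: "I \<notin> nonmax B" if "I \<in> maximals B" for I using that
      by (auto simp: nonmax_def maximals_def)
  have mult: "(\<Sum>I\<in>B. if i \<in> I then if I \<in> components B U then c else 0 else 0) =
      (if i \<in> U then c else 0)" for c :: real and U and i :: 'n
  proof -
    have "(\<Sum>I\<in>B. if i \<in> I then if I \<in> components B U then c else 0 else 0) =
        (\<Sum>I\<in>B. c * (if I \<in> components B U \<and> i \<in> I then 1 else 0))"
      by (intro sum.cong) auto
    also have "\<dots> = c * (if i \<in> U then 1 else 0)"
      unfolding sum_distrib_left [symmetric] sum_components [OF B] ..
    finally show ?thesis by simp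
  qed
  define v where "v = Max (range w)"
  have v: "v \<in> range w" "w i \<le> v" for i unfolding v_def by (auto intro: Max_in)
  show ?case
  proof (cases "range w = {v}")
    case True
    then have wv: "w i = v" for i by auto
    let ?l = "\<lambda>I. if I \<in> components B UNIV then - v else 0"
    have "w i = - (\<Sum>I\<in>B. if i \<in> I then ?l I else 0)" for i
      using mult [of i UNIV "- v"] wv by simp
    moreover have "?l I = 0" if "I \<in> nonmax B" for I using notV that by (auto simp: components_UNIV)
    ultimately show ?thesis by (intro exI [of _ ?l]) auto
  next
    case False
    let ?R = "range w - {v}"
    have R: "finite ?R" "?R \<noteq> {}" using False v(1) by auto
    \<comment> \<open>The second largest value. Cutting \<open>w\<close> off at \<open>v'\<close>
      loses \<open>v - v'\<close> outside \<open>?U\<close>, which is the constant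
      \<open>v - v'\<close> minus \<open>v - v'\<close> on \<open>?U\<close>. The constant is booked
      on the maximal members, the rest on the components of \<open>?U\<close>.\<close>
    define v' where "v' = Max ?R"
    have v': "v' \<in> ?R" "\<And>i. w i \<noteq> v \<Longrightarrow> w i \<le> v'" using Max_in [OF R] Max_ge [OF R(1)]
        by (auto simp: v'_def)
    have "v' \<noteq> v" "v' \<le> v" using v'(1) v(2) by auto
    then have vv: "v' < v" by simp
    define w' where "w' i = min (w i) v'" for i
    have "range w' \<subseteq> ?R"
    proof
      fix z assume "z \<in> range w'"
      then obtain i where i: "z = w' i" by auto
      show "z \<in> ?R"
      proof (cases "w i = v")
        case True then show ?thesis using i vv v'(1) by (simp add: w'_def)
      next
        case False
        then show ?thesis using i v'(2) [OF False] by (auto simp: w'_def min_def)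
      qed
    qed
    then have "card (range w') < card (range w)"
      using psubset_card_mono [of "range w" "range w'"] v(1) by auto
    from less.hyps [OF this] obtain \<mu> where
      \<mu>: "\<forall>I\<in>nonmax B. 0 \<le> \<mu> I \<and> (\<mu> I \<noteq> 0 \<longrightarrow> (\<exists>t. I \<in> components B {i. w' i \<le> t}))"
      "\<forall>i. w' i = - (\<Sum>I\<in>B. if i \<in> I then \<mu> I else 0)" by blast
    let ?U = "{i. w i \<le> v'}" and ?d = "v - v'"
    let ?l = "\<lambda>I. \<mu> I + (if I \<in> components B ?U then ?d else 0) + (if I \<in> components B UNIV then -
        ?d else 0)"
    have w: "w i = - (\<Sum>I\<in>B. if i \<in> I then ?l I else 0)" for i
    proof -
      have "(\<Sum>I\<in>B. if i \<in> I then ?l I else 0) =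
          (\<Sum>I\<in>B. (if i \<in> I then \<mu> I else 0) + (if i \<in> I then
              if I \<in> components B ?U then ?d else 0 else 0) +
            (if i \<in> I then if I \<in> components B UNIV then - ?d else 0 else 0))"
        by (intro sum.cong) auto
      also have "\<dots> = - w' i + (if i \<in> ?U then ?d else 0) + - ?d"
        unfolding sum.distrib mult using \<mu>(2) by simp
      also have "\<dots> = - w i"
        using v'(2) [of i] vv by (cases "w i = v") (auto simp: w'_def min_def)
      finally show ?thesis by simp
    qed
    have "0 \<le> ?l I \<and> (?l I \<noteq> 0 \<longrightarrow> (\<exists>t. I \<in> components B {i. w i \<le> t}))" if I: "I \<in> nonmax B" for I
    proof
      have nI: "I \<notin> components B UNIV" using notV I by (auto simp: components_UNIV)
      then show "0 \<le> ?l I" using \<mu>(1) I vv by simp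
      show "?l I \<noteq> 0 \<longrightarrow> (\<exists>t. I \<in> components B {i. w i \<le> t})"
      proof
        assume "?l I \<noteq> 0"
        then consider "I \<in> components B ?U" | "\<mu> I \<noteq> 0" using nI by fastforce
        then show "\<exists>t. I \<in> components B {i. w i \<le> t}"
        proof cases
          case 2
          then obtain t where t: "I \<in> components B {i. w' i \<le> t}" using \<mu>(1) I by blast
          show ?thesis
          proof (cases "v' \<le> t")
            case True
            then have "{i. w' i \<le> t} = UNIV" by (auto simp: w'_def)
            then show ?thesis using t nI by simp
          next
            case False
            then have "{i. w' i \<le> t} = {i. w i \<le> t}" by (auto simp: w'_def)
            then show ?thesis using t by auto
          qed
        qed blast
      qed
    qed
    then have "\<forall>I\<in>nonmax B. 0 \<le> ?l I \<and> (?l I \<noteq> 0 \<longrightarrow> (\<exists>t. I \<in> components B {i. w i \<le> t}))"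
      by (rule ballI)
    then show ?thesis using w by (intro exI [of _ ?l] conjI allI)
  qed
qed

text \<open>A component of a sublevel set contains or avoids every component from a lower level. If
  the union of a disjoint family were a member, the set of highest level would absorb it.\<close>

lemma nested_components:
  fixes B :: "'n::finite set set" and w :: "'n \<Rightarrow> real"
  assumes B: "building_set UNIV B" and \<sigma>: "\<sigma> \<subseteq> nonmax B"
    and level: "\<And>I. I \<in> \<sigma> \<Longrightarrow> \<exists>t. I \<in> components B {i. w i \<le> t}"
  shows "nested B \<sigma>"
proof -
  obtain t where t: "\<And>I. I \<in> \<sigma> \<Longrightarrow> I \<in> components B {i. w i \<le> t I}" using level by metis
  have \<sigma>B: "I \<in> B" "I \<noteq> {}" if "I \<in> \<sigma>" for I
    using that \<sigma> building_setD(2) [OF B, of I] by (auto simp: nonmax_def)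
  have half: "J \<subseteq> I \<or> I \<inter> J = {}" if "I \<in> \<sigma>" "J \<in> \<sigma>" "t J \<le> t I" for I J
  proof -
    have "J \<subseteq> {i. w i \<le> t I}" using t [OF that(2)] that(3) by (force simp: components_def)
    then show ?thesis using components_absorb [OF B t [OF that(1)] \<sigma>B(1) [OF that(2)]] by metis
  qed
  show ?thesis
    unfolding nested_def
  proof (intro conjI ballI allI impI)
    show "\<sigma> \<subseteq> nonmax B" by (rule \<sigma>)
    fix I J assume "I \<in> \<sigma>" "J \<in> \<sigma>"
    then show "I \<subseteq> J \<or> J \<subseteq> I \<or> I \<inter> J = {}"
      using half [of I J] half [of J I] by (cases "t J \<le> t I") auto
  next
    fix \<rho> assume \<rho>: "\<rho> \<subseteq> \<sigma>"
      "(\<exists>I\<in>\<rho>. \<exists>J\<in>\<rho>. I \<noteq> J) \<and> (\<forall>I\<in>\<rho>. \<forall>J\<in>\<rho>. I \<noteq> J \<longrightarrow> I \<inter> J = {})"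
    have f\<rho>: "finite \<rho>" "\<rho> \<noteq> {}" using \<rho> by auto
    then have "Max (t ` \<rho>) \<in> t ` \<rho>" by (intro Max_in) auto
    then obtain I where I: "I \<in> \<rho>" "Max (t ` \<rho>) = t I" by auto
    then have le: "t J \<le> t I" if "J \<in> \<rho>" for J using f\<rho> that by (metis Max_ge finite_imageI imageI)
    obtain J where J: "J \<in> \<rho>" "J \<noteq> I" using \<rho>(2) by blast
    show "\<Union>\<rho> \<notin> B"
    proof
      assume U: "\<Union>\<rho> \<in> B"
      have "J' \<subseteq> {i. w i \<le> t I}" if "J' \<in> \<rho>" for J'
        using t [of J'] le [OF that] \<rho>(1) that by (force simp: components_def)
      then have "\<Union>\<rho> \<subseteq> {i. w i \<le> t I}" by blast
      moreover have "I \<inter> \<Union>\<rho> \<noteq> {}" using I(1) \<sigma>B(2) [of I] \<rho>(1) by blast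
      ultimately have "\<Union>\<rho> \<subseteq> I" using components_absorb [OF B t U] I(1) \<rho>(1) by blast
      moreover have "I \<inter> J = {}" using \<rho>(2) I(1) J by blast
      moreover have "J \<noteq> {}" using J(1) \<sigma>B(2) \<rho>(1) by blast
      ultimately show False using J(1) by blast
    qed
  qed
qed

text \<open>This describes the normal fan: \<open>w\<close> is largest on the nestohedron exactly
  where all sets with positive coefficient are tight. On maximal members, whose coordinate sums are
  constant there, the coefficients may have any sign.\<close>

lemma functional_decomposition:
  fixes B :: "'n::finite set set" and w :: "real ^ 'n"
  assumes B: "building_set UNIV B"
  obtains \<mu> where "\<And>I. I \<in> nonmax B \<Longrightarrow> 0 \<le> \<mu> I" "nested B {I \<in> nonmax B. 0 < \<mu> I}"
    "\<And>x. inner w x = - (\<Sum>I\<in>B. \<mu> I * csum I x)"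
proof -
  obtain \<mu> where \<mu>: "\<forall>I\<in>nonmax B. 0 \<le> \<mu> I \<and> (\<mu> I \<noteq> 0 \<longrightarrow> (\<exists>t. I \<in> components B {i. w $ i \<le> t}))"
    "\<forall>i. w $ i = - (\<Sum>I\<in>B. if i \<in> I then \<mu> I else 0)"
    using level_decomposition [OF B, of "\<lambda>i. w $ i"] by (elim exE conjE)
  have "nested B {I \<in> nonmax B. 0 < \<mu> I}"
    using \<mu>(1) by (intro nested_components [OF B, of _ "\<lambda>i. w $ i"]) auto
  moreover have "inner w x = - (\<Sum>I\<in>B. \<mu> I * csum I x)" for x
  proof -
    have "inner w x = (\<Sum>i\<in>UNIV. - (\<Sum>I\<in>B. if i \<in> I then \<mu> I else 0) * x $ i)"
      unfolding inner_vec_def using \<mu>(2) by simp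
    also have "\<dots> = - (\<Sum>i\<in>UNIV. \<Sum>I\<in>B. if i \<in> I then \<mu> I * x $ i else 0)"
      by (simp add: sum_distrib_right sum_negf if_distrib [of "\<lambda>c. c * _"] cong: if_cong)
    also have "\<dots> = - (\<Sum>I\<in>B. \<Sum>i\<in>UNIV. if i \<in> I then \<mu> I * x $ i else 0)"
      by (subst sum.swap) simp
    also have "\<dots> = - (\<Sum>I\<in>B. \<mu> I * csum I x)"
      by (simp add: csum_def sum_distrib_left sum.If_cases)
    finally show ?thesis .
  qed
  ultimately show thesis using \<mu>(1) by (intro that) auto
qed

subsection \<open>Duals and facets of nestohedra\<close>

lemma nestohedron_nonempty: "building_set UNIV B \<Longrightarrow> nestohedron B \<noteq> {}"
  for B :: "'n::finite set set"
  using nested_realized [of B "{}"] by (auto simp: nested_def)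

lemma nested_singleton: "I \<in> nonmax B \<Longrightarrow> nested B {I}"
  unfolding nested_def by (auto simp: subset_singleton_iff)

text \<open>Some point of the nestohedron has no tight set. If \<open>c\<close> satisfied the
  inequality with equality, the segment from that point to \<open>c\<close> could be prolonged
  inside the nestohedron to a point violating it.\<close>

lemma csum_rel_interior:
  fixes B :: "'n::finite set set"
  assumes B: "building_set UNIV B" and P: "convex (nestohedron B)"
    and c: "c \<in> rel_interior (nestohedron B)" and I: "I \<in> nonmax B"
  shows "csum I c > low B I"
proof (rule ccontr)
  assume "\<not> ?thesis"
  moreover have "c \<in> nestohedron B" using c rel_interior_subset by blast
  ultimately have eq: "csum I c = low B I" using csum_ge_low [of c B I] by simp
  have "nested B {}" by (simp add: nested_def)
  then obtain x where x: "x \<in> nestohedron B" "tight B x = {}" using nested_realized [OF B] by blast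
  then have lt: "csum I x > low B I" using csum_ge_low [of x B I] I by (auto simp: tight_def)
  obtain e where e: "e > 1" "(1 - e) *\<^sub>R x + e *\<^sub>R c \<in> nestohedron B"
    using c x(1) convex_rel_interior_iff [OF P nestohedron_nonempty [OF B]] by blast
  have "low B I \<le> csum I ((1 - e) *\<^sub>R x + e *\<^sub>R c)" by (rule csum_ge_low [OF e(2)])
  also have "\<dots> = (1 - e) * csum I x + e * csum I c"
    by (simp add: linear_add [OF linear_csum] linear_cmul [OF linear_csum])
  finally have "(1 - e) * (csum I x - low B I) \<ge> 0" using eq by (simp add: algebra_simps)
  moreover have "(1 - e) * (csum I x - low B I) < 0" using e(1) lt by (intro mult_neg_pos) auto
  ultimately show False by simp
qed

text \<open>The missing weight is put on 0.\<close>

lemma scaled_sum_in_convex: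
  fixes a :: "'i \<Rightarrow> 'a::real_vector"
  assumes "convex H" "0 \<in> H" "finite V" "\<And>i. i \<in> V \<Longrightarrow> a i \<in> H" "\<And>i. i \<in> V \<Longrightarrow> 0 \<le> m i" "sum m V \<le> 1"
  shows "(\<Sum>i\<in>V. m i *\<^sub>R a i) \<in> H"
proof (cases "sum m V = 0")
  case True
  then have "m i = 0" if "i \<in> V" for i using sum_nonneg_eq_0_iff [OF assms(3), of m] assms(5) that
      by simp
  then show ?thesis using assms(2) by simp
next
  case False
  let ?s = "sum m V"
  have s: "0 < ?s" using False assms(5) sum_nonneg [of V m] by (simp add: less_le)
  have "(\<Sum>i\<in>V. (m i / ?s) *\<^sub>R a i) \<in> H"
    using assms s by (intro convex_sum) (auto simp: sum_divide_distrib [symmetric])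
  then have "?s *\<^sub>R (\<Sum>i\<in>V. (m i / ?s) *\<^sub>R a i) + (1 - ?s) *\<^sub>R 0 \<in> H"
    using assms(1,2,6) s by (intro convexD) auto
  then show ?thesis using s by (simp add: scaleR_sum_right)
qed

text \<open>\<open>a I\<close> is scaled so that the inequality of \<open>I\<close> reads
  \<open>inner (x - c) (a I) \<le> 1\<close>, with equality iff \<open>I\<close> is tight at
  \<open>x\<close>. The proper faces of the dual \<open>Q\<close> are the sets \<open>G x\<close>
  for points \<open>x\<close> of the nestohedron, and the vertices of \<open>G x\<close> are the
  \<open>a I\<close> with \<open>I\<close> tight at \<open>x\<close>. By \<open>nested_tight\<close>
  and \<open>nested_realized\<close> these are the images of the nested sets.\<close>

theorem boundary_complex_polar_dual_nestohedron:
  fixes B :: "'n::finite set set"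
  assumes B: "building_set UNIV B" and poly: "polytope (nestohedron B)"
  shows "\<exists>a. inj_on a (nonmax B) \<and>
    boundary_complex (polar_dual (nestohedron B)) = (`) a ` {\<sigma>. nested B \<sigma>}"
proof -
  let ?P = "nestohedron B" and ?V = "nonmax B"
  define c where "c = (SOME c. c \<in> rel_interior ?P)"
  have conv: "convex ?P" using poly polytope_imp_convex by blast
  have comp: "compact ?P" using poly polytope_imp_compact by blast
  have "rel_interior ?P \<noteq> {}" using nestohedron_nonempty [OF B] rel_interior_eq_empty [OF conv]
      by simp
  then have cr: "c \<in> rel_interior ?P" unfolding c_def by (simp add: some_in_eq)
  then have cP: "c \<in> ?P" using rel_interior_subset by blast
  define L where "L = span ((\<lambda>x. x - c) ` ?P)"
  define Q where "Q = polar_dual ?P"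
  have Q: "Q = {y \<in> L. \<forall>x\<in>?P. inner (x - c) y \<le> 1}"
    by (simp add: Q_def polar_dual_def c_def L_def Let_def)
  have PL: "x - c \<in> L" if "x \<in> ?P" for x using that unfolding L_def by (intro span_base) auto
  have Lsub: "subspace L" by (simp add: L_def)
  have "\<exists>p. p \<in> L \<and> (\<forall>z\<in>L. inner z p = inner z v)" for v
  proof -
    obtain p q where p: "p \<in> span ((\<lambda>x. x - c) ` ?P)"
      "\<And>z. z \<in> span ((\<lambda>x. x - c) ` ?P) \<Longrightarrow> orthogonal q z" "v = p + q"
      using orthogonal_subspace_decomp_exists [of "(\<lambda>x. x - c) ` ?P" v] by blast
    have "inner z p = inner z v" if "z \<in> L" for z
    proof -
      have "inner z q = 0" using p(2) [of z] that by (simp add: L_def orthogonal_def inner_commute)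
      then show ?thesis using p(3) by (simp add: inner_add_right)
    qed
    then show ?thesis using p(1) by (auto simp: L_def)
  qed
  then obtain proj where proj: "\<And>v. proj v \<in> L" "\<And>v z. z \<in> L \<Longrightarrow> inner z (proj v) = inner z v"
    by metis
  define s where "s I = csum I c - low B I" for I
  have s: "s I > 0" if "I \<in> ?V" for I using csum_rel_interior [OF B conv cr that]
      by (simp add: s_def)
  define a where "a I = (- (1 / s I)) *\<^sub>R proj (\<chi> i. if i \<in> I then 1 else 0)" for I
  have aL: "a I \<in> L" for I unfolding a_def by (rule subspace_scale [OF Lsub proj(1)])
  have az: "inner z (a I) = - csum I z / s I" if "z \<in> L" for z I
    using proj(2) [OF that, of "\<chi> i. if i \<in> I then 1 else 0"]
    by (simp add: a_def csum_inner inner_commute)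
  have axc: "inner (x - c) (a I) = (csum I c - csum I x) / s I" if "x \<in> ?P" for x I
    using az [OF PL [OF that], of I] by (simp add: linear_diff [OF linear_csum])
  have ale: "inner (x - c) (a I) \<le> 1" if "x \<in> ?P" "I \<in> ?V" for x I
    using axc [OF that(1), of I] csum_ge_low [OF that(1), of I] s [OF that(2)]
    by (simp add: s_def divide_le_eq_1)
  have aeq: "inner (x - c) (a I) = 1 \<longleftrightarrow> I \<in> tight B x" if "x \<in> ?P" "I \<in> ?V" for x I
    using axc [OF that(1), of I] s [OF that(2)] that(2)
        by (auto simp: tight_def s_def divide_eq_1_iff)
  have inj: "inj_on a ?V"
  proof (rule inj_onI)
    fix I J assume IJ: "I \<in> ?V" "J \<in> ?V" "a I = a J"
    obtain x where x: "x \<in> ?P" "tight B x = {I}"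
        using nested_realized [OF B nested_singleton [OF IJ(1)]] by blast
    have "inner (x - c) (a I) = 1" using aeq [OF x(1) IJ(1)] x(2) by simp
    then have "J \<in> tight B x" using aeq [OF x(1) IJ(2)] IJ(3) by simp
    then show "I = J" using x(2) by simp
  qed
  have csum0: "csum I z = 0" if "I \<in> maximals B" "z \<in> L" for I z
  proof -
    have "subspace {z. csum I z = 0}"
      by (auto simp: subspace_def linear_0 [OF linear_csum] linear_add [OF linear_csum] linear_cmul
          [OF linear_csum])
    moreover have "(\<lambda>x. x - c) ` ?P \<subseteq> {z. csum I z = 0}"
      using csum_maximal [OF B that(1)] cP by (auto simp: linear_diff [OF linear_csum])
    ultimately have "L \<subseteq> {z. csum I z = 0}" unfolding L_def by (intro span_minimal)
    then show ?thesis using that(2) by blast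
  qed
  have convQ: "convex Q"
  proof -
    have "Q = L \<inter> (\<Inter>x\<in>?P. {y. inner (x - c) y \<le> 1})" unfolding Q by auto
    moreover have "convex (\<Inter>x\<in>?P. {y. inner (x - c) y \<le> 1})"
      by (intro convex_INT convex_halfspace_le)
    ultimately show ?thesis using subspace_imp_convex [OF Lsub] by (simp add: convex_Int)
  qed
  have Q0: "0 \<in> Q" using Lsub by (simp add: Q subspace_0)
  have aQ: "a I \<in> Q" if "I \<in> ?V" for I using that aL ale by (simp add: Q)
  have finV: "finite ?V" by (rule finite_nonmax [OF B])
  \<comment> \<open>Including 0 admits combinations of total weight at most 1; it contributes no
    vertex to a proper face, as 0 lies in no \<open>G x\<close>.\<close>
  have Qhull: "Q = convex hull (insert 0 (a ` ?V))"
  proof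
    show "convex hull (insert 0 (a ` ?V)) \<subseteq> Q" using Q0 aQ convQ by (intro hull_minimal) auto
    show "Q \<subseteq> convex hull (insert 0 (a ` ?V))"
    proof
      fix y assume y: "y \<in> Q"
      obtain \<mu> where \<mu>: "\<And>I. I \<in> ?V \<Longrightarrow> 0 \<le> \<mu> I" "nested B {I \<in> ?V. 0 < \<mu> I}"
        "\<And>x. inner y x = - (\<Sum>I\<in>B. \<mu> I * csum I x)"
        using functional_decomposition [OF B, of y] by blast
      let ?y = "\<Sum>I\<in>?V. (\<mu> I * s I) *\<^sub>R a I"
      have yL: "y \<in> L" using y by (simp add: Q)
      have y'L: "?y \<in> L" using Lsub aL by (intro subspace_sum) (auto intro: subspace_scale)
      have BV: "B = ?V \<union> maximals B" "?V \<inter> maximals B = {}" by (auto simp: nonmax_def maximals_def)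
      have zy: "inner z y = inner z ?y" if z: "z \<in> L" for z
      proof -
        have "inner z y = - (\<Sum>I\<in>B. \<mu> I * csum I z)" using \<mu>(3) [of z] by (simp add: inner_commute)
        also have "(\<Sum>I\<in>B. \<mu> I * csum I z) = (\<Sum>I\<in>?V. \<mu> I * csum I z)"
        proof (rule sum.mono_neutral_right)
          show "\<forall>i\<in>B - ?V. \<mu> i * csum i z = 0"
          proof
            fix I assume "I \<in> B - ?V"
            then have "I \<in> maximals B" using BV(1) by blast
            then show "\<mu> I * csum I z = 0" using csum0 z by simp
          qed
        qed (auto simp: nonmax_def)
        also have "- \<dots> = (\<Sum>I\<in>?V. (\<mu> I * s I) * inner z (a I))"
          using s by (simp add: az [OF z] sum_negf [symmetric]) (intro sum.cong, auto simp:
              less_imp_neq [symmetric])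
        also have "\<dots> = inner z ?y" by (simp add: inner_sum_right)
        finally show ?thesis .
      qed
      have "y - ?y \<in> L" using yL y'L Lsub by (simp add: subspace_diff)
      then have "inner (y - ?y) (y - ?y) = 0" using zy by (simp add: inner_diff_right)
      then have eq: "y = ?y" by simp
      \<comment> \<open>At this \<open>x\<close> every \<open>a I\<close> with positive coefficient
        has inner product 1 with \<open>x - c\<close>, so the total weight equals
        \<open>inner (x - c) y\<close>, which is at most 1 for \<open>y \<in> Q\<close>.\<close>
      obtain x where x: "x \<in> ?P" "tight B x = {I \<in> ?V. 0 < \<mu> I}" using nested_realized [OF B \<mu>(2)]
          by blast
      have "(\<Sum>I\<in>?V. \<mu> I * s I) = inner (x - c) ?y"
      proof -
        have "inner (x - c) ?y = (\<Sum>I\<in>?V. (\<mu> I * s I) * inner (x - c) (a I))"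
            by (simp add: inner_sum_right)
        also have "\<dots> = (\<Sum>I\<in>?V. \<mu> I * s I)"
        proof (rule sum.cong)
          fix I assume I: "I \<in> ?V"
          show "\<mu> I * s I * inner (x - c) (a I) = \<mu> I * s I"
          proof (cases "\<mu> I = 0")
            case False
            then have "I \<in> tight B x" using \<mu>(1) [OF I] I x(2) by simp
            then show ?thesis using aeq [OF x(1) I] by simp
          qed simp
        qed simp
        finally show ?thesis by simp
      qed
      also have "\<dots> \<le> 1" using y x(1) eq by (simp add: Q)
      finally have le: "(\<Sum>I\<in>?V. \<mu> I * s I) \<le> 1" .
      have "?y \<in> convex hull (insert 0 (a ` ?V))"
      proof (rule scaled_sum_in_convex [OF convex_convex_hull _ finV _ _ le])
        show "a i \<in> convex hull (insert 0 (a ` ?V))" if "i \<in> ?V" for i using that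
            by (intro hull_inc) auto
        show "0 \<le> \<mu> i * s i" if "i \<in> ?V" for i using \<mu>(1) s that by (simp add: less_imp_le)
      qed (simp add: hull_inc)
      then show "y \<in> convex hull (insert 0 (a ` ?V))" using eq by simp
    qed
  qed
  have polyQ: "polytope Q" unfolding Qhull using finV by (intro polytope_convex_hull) auto
  have compQ: "compact Q" using polyQ polytope_imp_compact by blast
  define G where "G x = Q \<inter> {y. inner (x - c) y = 1}" for x
  have Gface: "G x face_of Q" if "x \<in> ?P" for x
    unfolding G_def using that convQ by (intro face_of_Int_supporting_hyperplane_le) (auto simp: Q)
  have G0: "0 \<notin> G x" for x by (simp add: G_def)
  have extQ: "v = 0 \<or> v \<in> a ` ?V" if "v extreme_point_of Q" for v
    using extreme_point_of_convex_hull [of v "insert 0 (a ` ?V)"] that unfolding Qhull by blast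
  have extG1: "v \<in> a ` tight B x" if x: "x \<in> ?P" and v: "v extreme_point_of G x" for x v
  proof -
    have vG: "v \<in> G x" "v extreme_point_of Q"
      using extreme_point_of_face [OF Gface [OF x]] v by auto
    then have "v \<noteq> 0" using G0 by blast
    then obtain I where I: "I \<in> ?V" "v = a I" using extQ [OF vG(2)] by blast
    then have "I \<in> tight B x" using vG(1) aeq [OF x I(1)] by (simp add: G_def)
    then show ?thesis using I(2) by blast
  qed
  \<comment> \<open>If \<open>I\<close> is the only tight set at \<open>x\<close>, the nonempty
    compact face \<open>G x\<close> has a vertex, and \<open>a I\<close> is the only
    candidate.\<close>
  have aext: "a I extreme_point_of Q" if I: "I \<in> ?V" for I
  proof -
    obtain x where x: "x \<in> ?P" "tight B x = {I}"
        using nested_realized [OF B nested_singleton [OF I]] by blast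
    have "a I \<in> G x" using aQ [OF I] aeq [OF x(1) I] x(2) by (simp add: G_def)
    moreover have "compact (G x)" "convex (G x)"
      using face_of_imp_compact [OF convQ compQ Gface [OF x(1)]] face_of_imp_convex [OF Gface [OF
          x(1)]]
      by auto
    ultimately obtain v where v: "v extreme_point_of G x"
      using extreme_point_exists_convex [of "G x"] by blast
    then have "v = a I" using extG1 [OF x(1) v] x(2) by simp
    then show ?thesis using v extreme_point_of_face [OF Gface [OF x(1)]] by blast
  qed
  have extG: "{v. v extreme_point_of G x} = a ` tight B x" if x: "x \<in> ?P" for x
  proof
    show "{v. v extreme_point_of G x} \<subseteq> a ` tight B x" using extG1 [OF x] by blast
    show "a ` tight B x \<subseteq> {v. v extreme_point_of G x}"
    proof
      fix v assume "v \<in> a ` tight B x"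
      then obtain I where I: "I \<in> tight B x" "v = a I" by blast
      then have IV: "I \<in> ?V" by (simp add: tight_def)
      have "v \<in> G x" using aQ [OF IV] aeq [OF x IV] I by (simp add: G_def)
      then show "v \<in> {v. v extreme_point_of G x}"
        using extreme_point_of_face [OF Gface [OF x]] aext [OF IV] I(2) by simp
    qed
  qed
  \<comment> \<open>A form of 0 being relatively interior to \<open>Q\<close>: a supporting
    hyperplane through 0 must contain all of \<open>Q\<close>.\<close>
  have neg: "\<exists>e>0. - (e *\<^sub>R y) \<in> Q" if y: "y \<in> Q" for y
  proof -
    have "bounded ((\<lambda>x. inner (x - c) y) ` ?P)"
      using comp by (intro compact_imp_bounded compact_continuous_image continuous_intros)
    then obtain M where M: "\<And>x. x \<in> ?P \<Longrightarrow> \<bar>inner (x - c) y\<bar> \<le> M"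
      unfolding bounded_iff by auto
    have M0: "M \<ge> 0" using M [OF cP] by simp
    let ?e = "1 / (M + 1)"
    have "- (?e *\<^sub>R y) \<in> L" using y Lsub unfolding Q by (simp add: subspace_neg subspace_scale)
    moreover have "inner (x - c) (- (?e *\<^sub>R y)) \<le> 1" if "x \<in> ?P" for x
    proof -
      have "- inner (x - c) y \<le> M + 1" using M [OF that] by linarith
      then have "?e * (- inner (x - c) y) \<le> ?e * (M + 1)" using M0 by (intro mult_left_mono) auto
      also have "?e * (M + 1) = 1" using M0 by simp
      finally show ?thesis by (simp only: inner_minus_right inner_scaleR_right mult_minus_right)
    qed
    ultimately have "- (?e *\<^sub>R y) \<in> Q" unfolding Q by blast
    moreover have "?e > 0" using M0 by simp
    ultimately show ?thesis by blast
  qed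
  \<comment> \<open>A point outside the nestohedron is separated from it by some \<open>h\<close>;
    the projection of \<open>h\<close>, suitably scaled, is a point of \<open>Q\<close> that
    violates \<open>le\<close>.\<close>
  have bipolar: "z + c \<in> ?P" if z: "z \<in> L" and le: "\<And>y. y \<in> Q \<Longrightarrow> inner z y \<le> 1" for z
  proof (rule ccontr)
    assume n: "z + c \<notin> ?P"
    obtain h b where h: "inner h (z + c) < b" "\<And>x. x \<in> ?P \<Longrightarrow> inner h x > b"
      using separating_hyperplane_closed_point [OF conv compact_imp_closed [OF comp] n] by blast
    let ?b = "inner h c - b"
    have b: "?b > 0" using h(2) [OF cP] by simp
    let ?g = "(- (1 / ?b)) *\<^sub>R proj h"
    have gz: "inner v ?g = - inner h v / ?b" if "v \<in> L" for v
      using proj(2) [OF that, of h] by (simp add: inner_commute)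
    have "?g \<in> Q"
    proof -
      have "?g \<in> L" by (rule subspace_scale [OF Lsub proj(1)])
      moreover have "inner (x - c) ?g \<le> 1" if "x \<in> ?P" for x
        unfolding gz [OF PL [OF that]] using h(2) [OF that] b
        by (simp add: divide_le_eq_1 inner_diff_right)
      ultimately show ?thesis unfolding Q by blast
    qed
    then have "inner z ?g \<le> 1" by (rule le)
    then have "- inner h z / ?b \<le> 1" unfolding gz [OF z] .
    then have "- inner h z \<le> ?b" using divide_le_eq_1_pos [OF b] by blast
    then show False using h(1) by (simp add: inner_add_right)
  qed
  \<comment> \<open>Faces of a polytope are exposed. The exposing functional is projected to
    \<open>L\<close> and divided by its value on the face; by bipolarity it then has the form
    \<open>x - c\<close> with \<open>x\<close> in the nestohedron.\<close>
  have faces: "\<exists>x\<in>?P. T = G x" if T: "T face_of Q" "T \<noteq> Q" for T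
  proof -
    have "T exposed_face_of Q"
      using exposed_face_of_polyhedron [OF polytope_imp_polyhedron [OF polyQ]] T(1) by blast
    then obtain h b where h: "Q \<subseteq> {y. inner h y \<le> b}" "T = Q \<inter> {y. inner h y = b}"
      unfolding exposed_face_of_def by blast
    have b0: "b \<ge> 0" using h(1) Q0 by auto
    have "b \<noteq> 0"
    proof
      assume b: "b = 0"
      have "inner h y = 0" if y: "y \<in> Q" for y
      proof -
        obtain e where e: "e > 0" "- (e *\<^sub>R y) \<in> Q" using neg [OF y] by blast
        have "inner h (- (e *\<^sub>R y)) \<le> 0" using h(1) e(2) b by blast
        then have "inner h y \<ge> 0" using e(1) by (simp add: zero_le_mult_iff)
        moreover have "inner h y \<le> 0" using h(1) y b by blast
        ultimately show ?thesis by simp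
      qed
      then have "T = Q" using h(2) b by auto
      then show False using T(2) by simp
    qed
    then have b: "b > 0" using b0 by simp
    let ?z = "(1 / b) *\<^sub>R proj h"
    have zL: "?z \<in> L" by (rule subspace_scale [OF Lsub proj(1)])
    have zy: "inner ?z y = inner h y / b" if "y \<in> Q" for y
    proof -
      have "y \<in> L" using that by (simp add: Q)
      then show ?thesis using proj(2) [of y h] by (simp add: inner_commute)
    qed
    have "?z + c \<in> ?P"
    proof (rule bipolar [OF zL])
      fix y assume y: "y \<in> Q"
      then have "inner h y \<le> b" using h(1) by blast
      then show "inner ?z y \<le> 1" unfolding zy [OF y] using b by (simp add: divide_le_eq_1)
    qed
    moreover have "T = G (?z + c)"
    proof -
      have "inner h y = b \<longleftrightarrow> inner (?z + c - c) y = 1" if "y \<in> Q" for y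
        using zy [OF that] b by auto
      then show ?thesis unfolding h(2) G_def by blast
    qed
    ultimately show ?thesis by blast
  qed
  have "boundary_complex Q = {a ` tight B x |x. x \<in> ?P}"
  proof
    show "boundary_complex Q \<subseteq> {a ` tight B x |x. x \<in> ?P}"
    proof
      fix \<tau> assume "\<tau> \<in> boundary_complex Q"
      then obtain T where T: "T face_of Q" "T \<noteq> Q" "\<tau> = {v. v extreme_point_of T}"
        by (auto simp: boundary_complex_def)
      obtain x where x: "x \<in> ?P" "T = G x" using faces [OF T(1,2)] by blast
      then have "\<tau> = a ` tight B x" using T(3) extG [OF x(1)] by simp
      then show "\<tau> \<in> {a ` tight B x |x. x \<in> ?P}" using x(1) by blast
    qed
    show "{a ` tight B x |x. x \<in> ?P} \<subseteq> boundary_complex Q"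
    proof
      fix \<tau> assume "\<tau> \<in> {a ` tight B x |x. x \<in> ?P}"
      then obtain x where x: "x \<in> ?P" "\<tau> = a ` tight B x" by blast
      have "G x \<noteq> Q" using G0 [of x] Q0 by auto
      then show "\<tau> \<in> boundary_complex Q"
        unfolding boundary_complex_def x(2) using Gface [OF x(1)] extG [OF x(1)] by blast
    qed
  qed
  also have "\<dots> = (`) a ` {\<sigma>. nested B \<sigma>}"
  proof -
    have "{\<sigma>. nested B \<sigma>} = tight B ` ?P"
    proof
      show "{\<sigma>. nested B \<sigma>} \<subseteq> tight B ` ?P" using nested_realized [OF B] by blast
      show "tight B ` ?P \<subseteq> {\<sigma>. nested B \<sigma>}" using nested_tight [OF B] by blast
    qed
    then show ?thesis by auto
  qed
  finally show ?thesis using inj unfolding Q_def by blast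
qed

text \<open>The face lies in some facet \<open>H\<close>, and by
  \<open>functional_decomposition\<close> \<open>H\<close> consists of the points at which all sets
  of a certain \<open>?s\<close> are tight. A point of the face with \<open>I\<close> as its only
  tight set gives \<open>?s \<subseteq> {I}\<close>, and \<open>?s\<close> is nonempty since
  \<open>H\<close> is proper.\<close>

lemma facet_of_nestohedron:
  fixes B :: "'n::finite set set"
  assumes B: "building_set UNIV B" and poly: "polytope (nestohedron B)" and I: "I \<in> nonmax B"
  shows "{x \<in> nestohedron B. csum I x = low B I} facet_of nestohedron B"
proof -
  let ?P = "nestohedron B" and ?V = "nonmax B"
  let ?F = "{x \<in> ?P. csum I x = low B I}"
  have polyh: "polyhedron ?P" using poly polytope_imp_polyhedron by blast
  have "?F = ?P \<inter> {x. inner (\<chi> i. if i \<in> I then 1 else 0) x = low B I}"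
    by (auto simp: csum_inner)
  moreover have "\<dots> face_of ?P"
    using polytope_imp_convex [OF poly] csum_ge_low [of _ B I]
    by (intro face_of_Int_supporting_hyperplane_ge) (auto simp: csum_inner)
  ultimately have face: "?F face_of ?P" by simp
  obtain x where x: "x \<in> ?P" "tight B x = {I}" using nested_realized [OF B nested_singleton [OF I]]
      by blast
  have xF: "x \<in> ?F" using x by (auto simp: tight_def)
  have "nested B {}" by (simp add: nested_def)
  then obtain x0 where x0: "x0 \<in> ?P" "tight B x0 = {}" using nested_realized [OF B] by blast
  have "x0 \<notin> ?F" using x0(2) I by (auto simp: tight_def)
  then have "?F \<noteq> ?P" using x0(1) by blast
  then obtain H where H: "H facet_of ?P" "?F \<subseteq> H"
    using face_of_polyhedron_subset_facet [OF polyh face] xF by blast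
  have Hface: "H face_of ?P" using H(1) by (simp add: facet_of_def)
  then obtain w b where w: "?P \<subseteq> {x. inner w x \<le> b}" "H = ?P \<inter> {x. inner w x = b}"
    using exposed_face_of_polyhedron [OF polyh] unfolding exposed_face_of_def by blast
  obtain \<mu> where \<mu>: "\<And>I. I \<in> ?V \<Longrightarrow> 0 \<le> \<mu> I" "nested B {I \<in> ?V. 0 < \<mu> I}"
    "\<And>x. inner w x = - (\<Sum>I\<in>B. \<mu> I * csum I x)"
    using functional_decomposition [OF B, of w] by blast
  let ?s = "{I \<in> ?V. 0 < \<mu> I}"
  define m where "m = - (\<Sum>I\<in>B. \<mu> I * low B I)"
  have gap: "m - inner w y = (\<Sum>I\<in>?V. \<mu> I * (csum I y - low B I))" if y: "y \<in> ?P" for y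
  proof -
    have "m - inner w y = (\<Sum>I\<in>B. \<mu> I * (csum I y - low B I))"
      unfolding m_def \<mu>(3) by (simp add: sum_subtractf right_diff_distrib)
    also have "\<dots> = (\<Sum>I\<in>?V. \<mu> I * (csum I y - low B I))"
    proof (rule sum.mono_neutral_right)
      show "\<forall>i\<in>B - ?V. \<mu> i * (csum i y - low B i) = 0"
      proof
        fix J assume "J \<in> B - ?V"
        then have "J \<in> maximals B" by (auto simp: nonmax_def maximals_def)
        then show "\<mu> J * (csum J y - low B J) = 0" using csum_maximal [OF B _ y] by simp
      qed
    qed (auto simp: nonmax_def)
    finally show ?thesis .
  qed
  have nn: "0 \<le> \<mu> J * (csum J y - low B J)" if "y \<in> ?P" "J \<in> ?V" for y J
    using \<mu>(1) [OF that(2)] csum_ge_low [OF that(1), of J] by simp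
  have le: "inner w y \<le> m" if "y \<in> ?P" for y
    using gap [OF that] sum_nonneg [of ?V "\<lambda>J. \<mu> J * (csum J y - low B J)"] nn [OF that] by simp
  have eq: "inner w y = m \<longleftrightarrow> ?s \<subseteq> tight B y" if y: "y \<in> ?P" for y
  proof -
    have "inner w y = m \<longleftrightarrow> (\<Sum>J\<in>?V. \<mu> J * (csum J y - low B J)) = 0" using gap [OF y] by auto
    also have "\<dots> \<longleftrightarrow> (\<forall>J\<in>?V. \<mu> J * (csum J y - low B J) = 0)"
      using nn [OF y] finite_nonmax [OF B] by (simp add: sum_nonneg_eq_0_iff)
    also have "\<dots> \<longleftrightarrow> ?s \<subseteq> tight B y" using \<mu>(1) by (fastforce simp: tight_def less_le)
    finally show ?thesis .
  qed
  obtain xs where xs: "xs \<in> ?P" "tight B xs = ?s" using nested_realized [OF B \<mu>(2)] by blast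
  have "inner w x = b" using xF H(2) w(2) by blast
  moreover have "inner w xs \<le> b" using w(1) xs(1) by blast
  moreover have "inner w xs = m" using eq [OF xs(1)] xs(2) by simp
  ultimately have bm: "b = m" using le [OF x(1)] by linarith
  have Hs: "H = {y \<in> ?P. ?s \<subseteq> tight B y}" unfolding w(2) bm using eq by blast
  have "?s \<subseteq> {I}" using xF H(2) x(2) unfolding Hs by auto
  moreover have "?s \<noteq> {}"
  proof
    assume "?s = {}"
    then have "H = ?P" unfolding Hs by blast
    then show False using H(1) by simp
  qed
  ultimately have "?s = {I}" by blast
  then have "H = ?F" unfolding Hs using I by (auto simp: tight_def)
  then show ?thesis using H(1) by simp
qed

text \<open>A compatible pair is nested, so its two facets meet by \<open>nested_realized\<close>.
  Flagness then provides a point on all the facets, and its tight sets form a nested set containing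
  \<open>\<sigma>\<close>.\<close>

lemma nested_of_compat:
  fixes B :: "'n::finite set set"
  assumes B: "building_set UNIV B" and flag: "flag_polytope (nestohedron B)"
    and \<sigma>: "\<sigma> \<in> cliques (compat B) (nonmax B)"
  shows "nested B \<sigma>"
proof (cases "\<sigma> = {}")
  case True
  then show ?thesis by (simp add: nested_def)
next
  case False
  let ?P = "nestohedron B"
  let ?F = "\<lambda>I. {x \<in> ?P. csum I x = low B I}"
  have poly: "polytope ?P" using flag by (simp add: flag_polytope_def simple_polytope_def)
  have \<sigma>V: "\<sigma> \<subseteq> nonmax B" using \<sigma> by (simp add: cliques_def)
  have pair: "?F I \<inter> ?F J \<noteq> {}" if IJ: "I \<in> \<sigma>" "J \<in> \<sigma>" for I J
  proof -
    have "I = J \<or> compat B I J" using \<sigma> IJ by (auto simp: cliques_def)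
    then have c: "compat B I J" by (auto simp: compat_def)
    have V: "I \<in> nonmax B" "J \<in> nonmax B" using IJ \<sigma>V by auto
    then have ne: "I \<noteq> {}" "J \<noteq> {}" using building_setD(2) [OF B] by (auto simp: nonmax_def)
    have "nested B {I, J}"
      unfolding nested_def
    proof (intro conjI ballI allI impI)
      show "{I, J} \<subseteq> nonmax B" using V by simp
      show "X \<subseteq> Y \<or> Y \<subseteq> X \<or> X \<inter> Y = {}" if "X \<in> {I, J}" "Y \<in> {I, J}" for X Y
        using that c by (auto simp: compat_def)
      fix \<rho> assume \<rho>: "\<rho> \<subseteq> {I, J}"
        "(\<exists>I\<in>\<rho>. \<exists>J\<in>\<rho>. I \<noteq> J) \<and> (\<forall>I\<in>\<rho>. \<forall>J\<in>\<rho>. I \<noteq> J \<longrightarrow> I \<inter> J = {})"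
      then have "\<rho> = {I, J}" "I \<noteq> J" by blast+
      moreover from this have "I \<inter> J = {}" using \<rho>(2) by blast
      ultimately show "\<Union>\<rho> \<notin> B" using c ne by (auto simp: compat_def)
    qed
    then obtain x where x: "x \<in> ?P" "tight B x = {I, J}" using nested_realized [OF B] by blast
    then have "I \<in> tight B x" "J \<in> tight B x" by auto
    then have "x \<in> ?F I \<inter> ?F J" using x(1) by (simp add: tight_def)
    then show ?thesis by blast
  qed
  have "\<Inter>(?F ` \<sigma>) \<noteq> {}"
  proof -
    have "?F ` \<sigma> \<subseteq> {F. F facet_of ?P}" using facet_of_nestohedron [OF B poly] \<sigma>V by blast
    moreover have "\<forall>F\<in>?F ` \<sigma>. \<forall>G\<in>?F ` \<sigma>. F \<inter> G \<noteq> {}" using pair by blast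
    ultimately show ?thesis using flag unfolding flag_polytope_def by blast
  qed
  then obtain x where x: "\<And>I. I \<in> \<sigma> \<Longrightarrow> x \<in> ?F I" by blast
  then have "x \<in> ?P" using False by blast
  moreover have "\<sigma> \<subseteq> tight B x" using x \<sigma>V by (auto simp: tight_def)
  ultimately show ?thesis using nested_subset [OF nested_tight [OF B]] by blast
qed

lemma cliques_eq_nested:
  fixes B :: "'n::finite set set"
  assumes B: "building_set UNIV B" and flag: "flag_polytope (nestohedron B)"
  shows "{\<sigma>. nested B \<sigma>} = cliques (compat B) (nonmax B)"
proof
  show "cliques (compat B) (nonmax B) \<subseteq> {\<sigma>. nested B \<sigma>}" using nested_of_compat [OF assms] by blast
  show "{\<sigma>. nested B \<sigma>} \<subseteq> cliques (compat B) (nonmax B)"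
  proof
    fix \<sigma> assume "\<sigma> \<in> {\<sigma>. nested B \<sigma>}"
    then have n: "nested B \<sigma>" by simp
    have "compat B I J" if IJ: "I \<in> \<sigma>" "J \<in> \<sigma>" "I \<noteq> J" for I J
    proof (cases "I \<subseteq> J \<or> J \<subseteq> I")
      case False
      then have dis: "I \<inter> J = {}" using nested_laminar [OF n IJ(1,2)] by blast
      have "\<forall>X\<in>{I, J}. \<forall>Y\<in>{I, J}. X \<noteq> Y \<longrightarrow> X \<inter> Y = {}" using dis by blast
      then have "\<Union>{I, J} \<notin> B" using nested_Union [OF n, of "{I, J}" I J] IJ by simp
      then show ?thesis using dis by (simp add: compat_def)
    qed (auto simp: compat_def)
    then show "\<sigma> \<in> cliques (compat B) (nonmax B)" using nested_nonmax [OF n]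
        by (simp add: cliques_def)
  qed
qed

text \<open>A partition of \<open>I\<close> into as few proper members as possible has two parts, since otherwise
  its parts would be pairwise compatible.\<close>

lemma flag_nestohedron_decomposable:
  fixes B :: "'n::finite set set"
  assumes B: "building_set UNIV B" and flag: "flag_polytope (nestohedron B)"
  shows "flag_building UNIV B"
proof -
  have "\<exists>J\<in>B. \<exists>K\<in>B. J \<inter> K = {} \<and> J \<union> K = I" if I: "I \<in> B" "\<not> (\<exists>i. I = {i})" for I
  proof -
    define part where "part \<rho> \<longleftrightarrow> \<rho> \<subseteq> B - {I} \<and> \<Union>\<rho> = I \<and>
      (\<forall>X\<in>\<rho>. \<forall>Y\<in>\<rho>. X \<noteq> Y \<longrightarrow> X \<inter> Y = {})" for \<rho>
    have "part ((\<lambda>i. {i}) ` I)" using I building_setD(4) [OF B] unfolding part_def by auto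
    then obtain \<rho> where \<rho>: "part \<rho>" "\<And>\<rho>'. part \<rho>' \<Longrightarrow> card \<rho> \<le> card \<rho>'"
      using ex_has_least_nat [of part "(\<lambda>i. {i}) ` I" card] by blast
    have \<rho>B: "\<And>X. X \<in> \<rho> \<Longrightarrow> X \<in> B \<and> X \<subset> I" and U: "\<Union>\<rho> = I"
      and dis: "\<And>X Y. X \<in> \<rho> \<Longrightarrow> Y \<in> \<rho> \<Longrightarrow> X \<noteq> Y \<Longrightarrow> X \<inter> Y = {}"
      using \<rho>(1) unfolding part_def by blast+
    have ne: "X \<noteq> {}" if "X \<in> B" for X using building_setD(2) [OF B that] .
    have "\<exists>X\<in>\<rho>. \<exists>Y\<in>\<rho>. X \<noteq> Y \<and> X \<union> Y \<in> B"
    proof (rule ccontr)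
      assume n: "\<not> ?thesis"
      have "compat B X Y" if XY: "X \<in> \<rho>" "Y \<in> \<rho>" "X \<noteq> Y" for X Y
        using n XY dis [OF XY] by (auto simp: compat_def)
      moreover have "\<rho> \<subseteq> nonmax B" using \<rho>B I(1) by (auto simp: nonmax_def)
      ultimately have "nested B \<rho>" by (intro nested_of_compat [OF assms]) (auto simp: cliques_def)
      moreover obtain X where X: "X \<in> \<rho>" using U ne [OF I(1)] by blast
      moreover have "\<exists>Y\<in>\<rho>. Y \<noteq> X"
      proof (rule ccontr)
        assume "\<not> (\<exists>Y\<in>\<rho>. Y \<noteq> X)"
        then have "I = X" using X U by blast
        then show False using \<rho>B [OF X] by blast
      qed
      ultimately obtain Y where "nested B \<rho>" "X \<in> \<rho>" "Y \<in> \<rho>" "X \<noteq> Y" by blast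
      then have "\<Union>\<rho> \<notin> B" using nested_Union [of B \<rho> \<rho> X Y] dis by simp
      then show False using U I(1) by simp
    qed
    then obtain X Y where XY: "X \<in> \<rho>" "Y \<in> \<rho>" "X \<noteq> Y" "X \<union> Y \<in> B" by blast
    \<comment> \<open>Otherwise merging \<open>X\<close> and \<open>Y\<close> would give a partition
      with fewer parts.\<close>
    have "X \<union> Y = I"
    proof (rule ccontr)
      assume n: "X \<union> Y \<noteq> I"
      let ?\<rho> = "insert (X \<union> Y) (\<rho> - {X, Y})"
      have "part ?\<rho>"
        unfolding part_def
      proof (intro conjI ballI impI)
        show "?\<rho> \<subseteq> B - {I}" using XY(4) n \<rho>(1) unfolding part_def by blast
        show "\<Union>?\<rho> = I" using U XY by blast
        show "S \<inter> T = {}" if ST: "S \<in> ?\<rho>" "T \<in> ?\<rho>" "S \<noteq> T" for S T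
        proof -
          have *: "(X \<union> Y) \<inter> R = {}" if "R \<in> \<rho> - {X, Y}" for R
            using dis [of X R] dis [of Y R] that XY by blast
          consider "S = X \<union> Y" "T \<in> \<rho> - {X, Y}" | "T = X \<union> Y" "S \<in> \<rho> - {X, Y}" | "S \<in> \<rho>" "T \<in> \<rho>"
            using ST by blast
          then show ?thesis
          proof cases
            case 1 then show ?thesis using * by simp
          next
            case 2 then show ?thesis using * [of S] by (simp add: Int_commute)
          next
            case 3 then show ?thesis using dis ST(3) by simp
          qed
        qed
      qed
      then have "card \<rho> \<le> card ?\<rho>" by (rule \<rho>(2))
      also have "\<dots> \<le> Suc (card (\<rho> - {X, Y}))" by (rule card_insert_le_m1) auto
      also have "card (\<rho> - {X, Y}) = card \<rho> - 2"
        using XY by (simp add: card_Diff_subset)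
      finally have "card \<rho> \<le> Suc (card \<rho> - 2)" .
      moreover have "2 \<le> card \<rho>" using card_mono [of \<rho> "{X, Y}"] XY by simp
      ultimately show False by simp
    qed
    then show ?thesis using XY \<rho>B dis [OF XY(1-3)] by blast
  qed
  then show ?thesis using B unfolding flag_building_def decomposable_def by blast
qed

subsection \<open>From f-vectors to gamma-vectors\<close>

lemma sum_over_faces:
  fixes \<phi> :: "nat \<Rightarrow> 'b::comm_ring_1"
  assumes "finite \<Delta>" "\<And>\<sigma>. \<sigma> \<in> \<Delta> \<Longrightarrow> card \<sigma> \<le> m"
  shows "(\<Sum>\<sigma>\<in>\<Delta>. \<phi> (card \<sigma>)) = (\<Sum>i\<le>m. of_nat (f_num \<Delta> i) * \<phi> i)"
proof -
  have "(\<Sum>\<sigma>\<in>\<Delta>. \<phi> (card \<sigma>)) = (\<Sum>i\<le>m. \<Sum>\<sigma>\<in>{\<sigma> \<in> \<Delta>. card \<sigma> = i}. \<phi> (card \<sigma>))"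
    using assms by (intro sum.group [symmetric]) auto
  also have "\<dots> = (\<Sum>i\<le>m. of_nat (f_num \<Delta> i) * \<phi> i)"
    by (intro sum.cong) (auto simp: f_num_def)
  finally show ?thesis .
qed

lemma f_num_above_rank: "asc \<Delta> \<Longrightarrow> rank_complex \<Delta> < i \<Longrightarrow> f_num \<Delta> i = 0"
proof -
  assume "asc \<Delta>" "rank_complex \<Delta> < i"
  then have "{\<sigma> \<in> \<Delta>. card \<sigma> = i} = {}" using card_le_rank by fastforce
  then show ?thesis by (simp only: f_num_def card.empty)
qed

lemma f_num_rank: "asc \<Delta> \<Longrightarrow> f_num \<Delta> (rank_complex \<Delta>) > 0"
proof -
  assume \<Delta>: "asc \<Delta>"
  then have "{\<sigma> \<in> \<Delta>. card \<sigma> = rank_complex \<Delta>} \<noteq> {}" using rank_complex_attained by blast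
  moreover have "finite \<Delta>" using \<Delta> by (simp add: asc_def)
  ultimately show ?thesis by (simp add: f_num_def card_gt_0_iff)
qed

lemma coeff_f_poly: "asc \<Delta> \<Longrightarrow> coeff (f_poly \<Delta>) i = int (f_num \<Delta> i)"
  using f_num_above_rank [of \<Delta> i] by (auto simp: f_poly_def coeff_sum not_le)

lemma poly_eqI_infinite:
  fixes p q :: "'b::idom poly"
  assumes "infinite A" "\<And>x. x \<in> A \<Longrightarrow> poly p x = poly q x"
  shows "p = q"
proof (rule ccontr)
  assume "p \<noteq> q"
  then have "finite {x. poly (p - q) x = 0}" by (intro poly_roots_finite) simp
  moreover have "A \<subseteq> {x. poly (p - q) x = 0}" using assms(2) by auto
  ultimately show False using assms(1) finite_subset by blast
qed

text \<open>Each summand on the right is a polynomial in \<open>u\<close> of degree exactly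
  \<open>d\<close> with positive leading coefficient, so nothing cancels. The rank is thus read off
  from the identity, with no dimension count for the nestohedron.\<close>

lemma rank_of_gamma_form:
  assumes \<Delta>: "asc \<Delta>" and \<Gamma>: "finite \<Gamma>" "{} \<in> \<Gamma>" "\<And>\<tau>. \<tau> \<in> \<Gamma> \<Longrightarrow> 2 * card \<tau> \<le> d"
    and eq: "\<And>u::real. 1 + 2 * u \<noteq> 0 \<Longrightarrow>
      (\<Sum>\<sigma>\<in>\<Delta>. u ^ card \<sigma>) = (\<Sum>\<tau>\<in>\<Gamma>. (u * (1 + u)) ^ card \<tau> * (1 + 2 * u) ^ (d - 2 * card \<tau>))"
  shows "rank_complex \<Delta> = d"
proof -
  let ?r = "rank_complex \<Delta>"
  define p :: "real poly" where "p = (\<Sum>i\<le>?r. monom (real (f_num \<Delta> i)) i)"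
  define q :: "real poly" where "q = (\<Sum>\<tau>\<in>\<Gamma>. [:0, 1, 1:] ^ card \<tau> * [:1, 2:] ^ (d - 2 * card \<tau>))"
  have "poly p u = (\<Sum>\<sigma>\<in>\<Delta>. u ^ card \<sigma>)" for u
    using sum_over_faces [of \<Delta> ?r "\<lambda>i. u ^ i"] card_le_rank [OF \<Delta>] \<Delta>
    by (simp add: p_def poly_sum poly_monom asc_def)
  moreover have "poly q u = (\<Sum>\<tau>\<in>\<Gamma>. (u * (1 + u)) ^ card \<tau> * (1 + 2 * u) ^ (d - 2 * card \<tau>))" for u
    by (simp add: q_def poly_sum poly_power mult.commute)
  ultimately have pq: "p = q"
    using eq by (intro poly_eqI_infinite [of "{0<..}"]) (auto simp: infinite_Ioi)
  have cp: "coeff p i = real (f_num \<Delta> i)" for i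
    using f_num_above_rank [OF \<Delta>, of i] by (auto simp: p_def coeff_sum not_le)
  have deg: "degree ([:0, 1, 1:] ^ card \<tau> * [:1, 2:] ^ (d - 2 * card \<tau>) :: real poly) = d"
    and pos: "coeff ([:0, 1, 1:] ^ card \<tau> * [:1, 2:] ^ (d - 2 * card \<tau>) :: real poly) d > 0"
    if "\<tau> \<in> \<Gamma>" for \<tau> :: "'b set"
  proof -
    let ?t = "[:0, 1, 1:] ^ card \<tau> * [:1, 2:] ^ (d - 2 * card \<tau>) :: real poly"
    show deg: "degree ?t = d" using \<Gamma>(3) [OF that] by (simp add: degree_mult_eq degree_power_eq)
    have "lead_coeff ?t = 2 ^ (d - 2 * card \<tau>)" by (simp add: lead_coeff_mult lead_coeff_power)
    then show "coeff ?t d > 0" using deg by simp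
  qed
  have "coeff q d > 0"
    unfolding q_def coeff_sum using \<Gamma>(1,2) pos by (intro sum_pos) auto
  then have "f_num \<Delta> d \<noteq> 0" using cp [of d] pq by auto
  then have "d \<le> ?r" using f_num_above_rank [OF \<Delta>, of d] by (meson not_le)
  moreover have "degree q \<le> d" unfolding q_def using deg \<Gamma>(1) by (intro degree_sum_le) auto
  then have "coeff p i = 0" if "d < i" for i using that pq by (simp add: coeff_eq_0)
  then have "?r \<le> d" using cp [of ?r] f_num_rank [OF \<Delta>]
      by (metis not_le of_nat_eq_0_iff less_irrefl)
  ultimately show ?thesis by simp
qed

lemma gamma_poly_of_gamma_form:
  assumes \<Delta>: "asc \<Delta>" and \<Gamma>: "asc \<Gamma>" "\<And>\<tau>. \<tau> \<in> \<Gamma> \<Longrightarrow> 2 * card \<tau> \<le> d"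
    and eq: "\<And>u::real. 1 + 2 * u \<noteq> 0 \<Longrightarrow>
      (\<Sum>\<sigma>\<in>\<Delta>. u ^ card \<sigma>) = (1 + 2 * u) ^ d * (\<Sum>\<tau>\<in>\<Gamma>. (u * (1 + u) / (1 + 2 * u)\<^sup>2) ^ card \<tau>)"
  shows "gamma_poly \<Delta> = f_poly \<Gamma>"
proof -
  have fin: "finite \<Delta>" "finite \<Gamma>" "{} \<in> \<Gamma>" using \<Delta> \<Gamma>(1) by (auto simp: asc_def)
  have eq': "(\<Sum>\<sigma>\<in>\<Delta>. u ^ card \<sigma>) = (\<Sum>\<tau>\<in>\<Gamma>. (u * (1 + u)) ^ card \<tau> * (1 + 2 * u) ^ (d - 2 * card \<tau>))"
    if u: "1 + 2 * u \<noteq> 0" for u :: real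
    unfolding eq [OF u] sum_distrib_left
  proof (rule sum.cong)
    fix \<tau> assume "\<tau> \<in> \<Gamma>"
    then have "(1 + 2 * u) ^ d = (1 + 2 * u) ^ (2 * card \<tau>) * (1 + 2 * u) ^ (d - 2 * card \<tau>)"
      using \<Gamma>(2) by (simp add: power_add [symmetric])
    then show "(1 + 2 * u) ^ d * (u * (1 + u) / (1 + 2 * u)\<^sup>2) ^ card \<tau> =
        (u * (1 + u)) ^ card \<tau> * (1 + 2 * u) ^ (d - 2 * card \<tau>)"
      using u by (simp add: power_divide power_mult)
  qed simp
  have rank: "rank_complex \<Delta> = d" by (rule rank_of_gamma_form [OF \<Delta> fin(2,3) \<Gamma>(2) eq'])
  have half: "card \<tau> \<le> d div 2" if "\<tau> \<in> \<Gamma>" for \<tau> using \<Gamma>(2) [OF that] by simp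
  have rank\<Gamma>: "rank_complex \<Gamma> \<le> d div 2" using rank_complex_attained [OF \<Gamma>(1)] half by metis
  show ?thesis
  proof (rule gamma_poly_eqI, unfold rank)
    show "degree (f_poly \<Gamma>) \<le> d div 2"
      unfolding f_poly_def using rank\<Gamma>
      by (intro degree_sum_le) (auto intro: order_trans [OF degree_monom_le])
    show "h_poly \<Delta> = gamma_expansion d (f_poly \<Gamma>)"
    proof (rule poly_eqI_infinite)
      show "infinite {2::int..}" by (rule infinite_Ici)
      fix t :: int assume "t \<in> {2..}"
      then have t: "2 \<le> t" by simp
      \<comment> \<open>Solves \<open>t = 1 + 1 / u\<close>, which turns f-polynomials into
        h-polynomials. Integers from 2 on keep \<open>t - 1\<close> positive and are numerous enough
        to identify polynomials.\<close>
      define u where "u = 1 / (real_of_int t - 1)"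
      have t1: "real_of_int t - 1 > 0" using t by simp
      have u: "1 + 2 * u = (real_of_int t + 1) / (real_of_int t - 1)"
        "u * (1 + u) = real_of_int t / (real_of_int t - 1)\<^sup>2"
        using t1 by (simp_all add: u_def field_simps power2_eq_square)
      then have u0: "1 + 2 * u \<noteq> 0" using t1 by simp
      have "real_of_int (poly (h_poly \<Delta>) t) = (\<Sum>\<sigma>\<in>\<Delta>. (real_of_int t - 1) ^ (d - card \<sigma>))"
        using sum_over_faces [of \<Delta> d "\<lambda>i. (real_of_int t - 1) ^ (d - i)"] fin card_le_rank [OF \<Delta>]
        by (simp add: h_poly_def rank poly_sum poly_power)
      also have "\<dots> = (real_of_int t - 1) ^ d * (\<Sum>\<sigma>\<in>\<Delta>. u ^ card \<sigma>)"
        unfolding sum_distrib_left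
      proof (rule sum.cong)
        fix \<sigma> assume "\<sigma> \<in> \<Delta>"
        then have "card \<sigma> \<le> d" using card_le_rank [OF \<Delta>] rank by auto
        then show "(real_of_int t - 1) ^ (d - card \<sigma>) = (real_of_int t - 1) ^ d * u ^ card \<sigma>"
          using t1 by (simp add: u_def power_diff power_divide)
      qed simp
      also have "\<dots> = (\<Sum>\<tau>\<in>\<Gamma>. real_of_int t ^ card \<tau> * (1 + real_of_int t) ^ (d - 2 * card \<tau>))"
        unfolding eq' [OF u0] sum_distrib_left
      proof (rule sum.cong)
        fix \<tau> assume "\<tau> \<in> \<Gamma>"
        then have "(real_of_int t - 1) ^ d =
            ((real_of_int t - 1)\<^sup>2) ^ card \<tau> * (real_of_int t - 1) ^ (d - 2 * card \<tau>)"
          using \<Gamma>(2) by (simp add: power_add [symmetric] power_mult [symmetric])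
        then show "(real_of_int t - 1) ^ d * ((u * (1 + u)) ^ card \<tau> * (1 + 2 * u) ^ (d - 2 * card
            \<tau>)) =
            real_of_int t ^ card \<tau> * (1 + real_of_int t) ^ (d - 2 * card \<tau>)"
          unfolding u using t1 by (simp add: power_divide add.commute)
      qed simp
      also have "\<dots> = real_of_int (poly (gamma_expansion d (f_poly \<Gamma>)) t)"
        using sum_over_faces [of \<Gamma> "d div 2"
            "\<lambda>i. real_of_int t ^ i * (1 + real_of_int t) ^ (d - 2 * i)"] fin half
        by (simp add: gamma_expansion_def poly_sum poly_power poly_monom coeff_f_poly [OF \<Gamma>(1)])
      finally show "poly (h_poly \<Delta>) t = poly (gamma_expansion d (f_poly \<Gamma>)) t"
        by (simp only: of_int_eq_iff)
    qed
  qed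
qed

text \<open>The \<open>\<gamma>\<close>-polynomial depends only on face numbers, which an injective
  renaming of vertices preserves.\<close>

lemma gamma_poly_image:
  assumes inj: "inj_on a V" and \<Delta>: "\<And>\<sigma>. \<sigma> \<in> \<Delta> \<Longrightarrow> \<sigma> \<subseteq> V"
  shows "gamma_poly ((`) a ` \<Delta>) = gamma_poly \<Delta>"
proof -
  have card: "card (a ` \<sigma>) = card \<sigma>" if "\<sigma> \<in> \<Delta>" for \<sigma>
    using \<Delta> [OF that] inj by (intro card_image) (rule inj_on_subset)
  then have "card ` (`) a ` \<Delta> = card ` \<Delta>" by (force simp: image_image)
  then have rank: "rank_complex ((`) a ` \<Delta>) = rank_complex \<Delta>" by (simp add: rank_complex_def)
  have injI: "inj_on ((`) a) \<Delta>"
    using inj_on_image_Pow [OF inj] by (rule inj_on_subset) (use \<Delta> in auto)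
  have "f_num ((`) a ` \<Delta>) i = f_num \<Delta> i" for i
  proof -
    have "{\<sigma> \<in> (`) a ` \<Delta>. card \<sigma> = i} = (`) a ` {\<sigma> \<in> \<Delta>. card \<sigma> = i}" using card by auto
    moreover have "inj_on ((`) a) {\<sigma> \<in> \<Delta>. card \<sigma> = i}" using injI by (rule inj_on_subset) auto
    ultimately show ?thesis by (simp add: f_num_def card_image)
  qed
  then show ?thesis by (simp add: gamma_poly_def h_poly_def rank)
qed

lemma flag_complex_cliques:
  assumes "finite X" "symp E"
  shows "flag_complex (cliques E X)"
  unfolding flag_complex_def
proof (intro conjI allI impI)
  show "asc (cliques E X)" by (rule asc_cliques [OF assms(1)])
  fix \<sigma> assume \<sigma>: "\<sigma> \<subseteq> \<Union>(cliques E X) \<and> (\<forall>u\<in>\<sigma>. \<forall>v\<in>\<sigma>. u \<noteq> v \<longrightarrow> {u, v} \<in> cliques E X)"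
  then show "\<sigma> \<in> cliques E X" unfolding cliques_def by auto
qed

theorem theorem1p3:
  fixes B :: "'n::finite set set"
  assumes "building_set (UNIV :: 'n set) B"
    and "flag_polytope (nestohedron B)"
  shows "(\<exists>\<Gamma> :: nat set set. flag_complex \<Gamma> \<and> f_poly \<Gamma> = gamma_polytope (nestohedron B)) \<and>
    satisfies_FFK (gamma_polytope (nestohedron B))"
proof -
  let ?\<Delta> = "cliques (compat B) (nonmax B)"
  have poly: "polytope (nestohedron B)"
    using assms(2) by (simp add: flag_polytope_def simple_polytope_def)
  obtain a where a: "inj_on a (nonmax B)"
    "boundary_complex (polar_dual (nestohedron B)) = (`) a ` ?\<Delta>"
    using boundary_complex_polar_dual_nestohedron [OF assms(1) poly] cliques_eq_nested [OF assms]
    by auto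
  have "gamma_polytope (nestohedron B) = gamma_poly ?\<Delta>"
    unfolding gamma_polytope_def a(2) by (rule gamma_poly_image [OF a(1)]) (auto simp: cliques_def)
  moreover obtain k F where F: "filtration UNIV k F" "F k = B"
    using exists_filtration [OF flag_nestohedron_decomposable [OF assms]] by blast
  \<comment> \<open>The vertices are stage numbers, so this is a complex on \<open>nat\<close>.
    Being a clique complex it is flag, and it is also what
    \<open>balanced_complex_of_cliques\<close> is applied to.\<close>
  let ?\<Gamma> = "cliques (gamma_edge F) (gamma_verts F k)"
  have fin: "finite (gamma_verts F k)" by (simp add: gamma_verts_def)
  have "gamma_poly ?\<Delta> = f_poly ?\<Gamma>"
    using clique_poly_filtration [OF F(1)] unfolding F(2) clique_poly_def
    by (intro gamma_poly_of_gamma_form [where d = "bdim UNIV B"] asc_cliques fin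
        finite_nonmax [OF assms(1)]) auto
  ultimately have eq: "gamma_polytope (nestohedron B) = f_poly ?\<Gamma>" by simp
  show ?thesis
    unfolding eq satisfies_FFK_def
    using flag_complex_cliques [OF fin symp_gamma_edge]
      balanced_complex_of_cliques [OF fin symp_gamma_edge] by blast
qed

end
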